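(* Let $A$ be a homogeneous matrix, $w$ a generic direction, $v$ a fake exponent of $H_A(\beta)$ in the direction $w$, and $\mathcal N$ a negative support family for $v$. Write $M=M_{\mathcal N}$, $P=P_{\mathcal N}(t)$ and $Q=UM+P$. There are natural right-exact sequences $$\operatorname{Tor}^{\widehat R}_1(\widehat R/U,\widehat R/P)\longrightarrow\operatorname{Tor}^{\widehat R}_1(\widehat R/U,\widehat R/M)\longrightarrow\mathfrak T_{\mathcal N}\longrightarrow0\qquad(1)$$ and $$\operatorname{Tor}^{\widehat R}_1(\widehat R/\langle e\rangle,\widehat R/Q)\longrightarrow\operatorname{Tor}^{\widehat R}_1(\widehat R/\langle e\rangle,\widehat R/(U+P))\longrightarrow\mathfrak D_{\mathcal N}(e)\longrightarrow0.\qquad(2)$$ In (1) and (2) the first maps are induced by the quotient maps associated with $P\subseteq M$ and with $Q\subseteq U+P$, respectively. The sequence (2) is induced by the natural exact sequence $$\operatorname{Tor}^{\widehat R}_1(\widehat R/\langle e\rangle,\widehat R/Q)\to\operatorname{Tor}^{\widehat R}_1(\widehat R/\langle e\rangle,\widehat R/(U+P))\xrightarrow{\partial_e}\frac{U+P}{Q}\to\frac{\widehat R}{Q+\langle e\rangle}\to\frac{\widehat R}{U+P+\langle e\rangle}\to0 .$$ The image of $\partial_e$ is naturally isomorphic to $\mathfrak D_{\mathcal N}(e)$. Equivalently, $$\mathfrak D_{\mathcal N}(e)\simeq\ker\left(\frac{U+P}{Q}\longrightarrow\frac{\widehat R}{Q+\langle e\rangle}\right).$$ Under multiplication by $e$,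 the last nonzero term $\mathfrak D_{\mathcal N}(e)$ in (2) is identified with the submodule of $\mathfrak T_{\mathcal N}$ consisting of the classes represented by multiples of $e$.
   Context: System. $\mathbb N=\{0,1,2,\dots\}$. $A=(a_{ij})\in\mathbb Z^{d\times n}$ has rank $d$ and its columns lie in an affine hyperplane not containing the origin ("homogeneous"). $L=\ker_{\mathbb Z}(A)$. For $u\in L$ write $u=u_+-u_-$ with $u_\pm\in\mathbb N^n$ of disjoint support. $I_A=\langle\partial^{u_+}-\partial^{u_-}\mid u\in L\rangle\subseteq\mathbb C[\partial_1,\dots,\partial_n]$. For $\beta\in\mathbb C^d$, $H_A(\beta)$ is the left ideal of the Weyl algebra in $x_1,\dots,x_n$ generated by $I_A$ and $\sum_j a_{ij}x_j\partial_j-\beta_i$ $(1\le i\le d)$. $\operatorname{in}_w$ takes terms of largest $w$-weight; $\operatorname{in}_{(-w,w)}$ is the initial ideal in the Weyl algebra for weights $-w$ on $x$, $w$ on $\partial$. A direction $w\in\mathbb R^n$ is generic if $\operatorname{in}_w(I_A)$ is a monomial ideal and $w$ lies in the interior of a full-dimensional cone of the small Gröbner fan of $H_A(\beta)$ (so $\operatorname{in}_{(-w',w')}(H_A(\beta))$ is constant for $w'$ in that interior). For $z\in\mathbb C^n$, $p\in\mathbb N^n$: $[z]_p=\prod_j z_j(z_j-1)\cdots(z_j-p_j+1)$. A fake exponent of $H_A(\beta)$ in the direction $w$ is $v\in\mathbb C^n$ with $Av=\beta$ and $[v]_p=0$ for every monomial $\partial^p\in\operatorname{in}_w(I_A)$.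 Negative supports. $\operatorname{nsupp}(z)=\{j\mid z_j\in\mathbb Z_{<0}\}$. For $u\in L$, $I_u=\operatorname{nsupp}(v+u)$; $I_0=\operatorname{nsupp}(v)$; $\mathcal S(v)=\{I_u\mid u\in L\}$. $\mathcal N_v=\{I\in\mathcal S(v)\mid w\cdot u\ge0\text{ for every }u\in L\text{ with }I_u=I\}$. A negative support family for $v$ is a set $\mathcal N$ with $I_0\in\mathcal N\subseteq\mathcal N_v$. $K_{\mathcal N}=\bigcap_{I\in\mathcal N}I$. Ideals. $\widehat R=\mathbb C[[t_1,\dots,t_n]]$, $t^J=\prod_{j\in J}t_j$ ($t^\varnothing=1$), $e=t^{I_0\setminus K_{\mathcal N}}$. $U=\langle At\rangle$ is generated by the entries $\sum_j a_{ij}t_j$; $M_{\mathcal N}=\langle t^{I\setminus K_{\mathcal N}}\mid I\in\mathcal N\rangle$; $P_{\mathcal N}(t)=\langle t^{(I\cup J)\setminus K_{\mathcal N}}\mid I\in\mathcal N,\ J\in\mathcal S(v)\setminus\mathcal N\rangle$. $$\mathfrak D_{\mathcal N}(e)=\frac{(U+P_{\mathcal N}(t)):e}{(UM_{\mathcal N}+P_{\mathcal N}(t)):e},\qquad \mathfrak T_{\mathcal N}=\frac{(U\cap M_{\mathcal N})+P_{\mathcal N}(t)}{UM_{\mathcal N}+P_{\mathcal N}(t)}.$$ *)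

theory Defs
  imports
    "HOL-Analysis.Analysis"
    "HOL-Library.Poly_Mapping"
    "HOL-Algebra.Ideal_Product"
    "HOL-Algebra.Module"
    "HOL-Algebra.Algebraic_Closure_Type"
begin

text \<open>The index types \<open>'n\<close> and \<open>'d\<close> stand for the column indices \<open>1,\<dots>,n\<close> and the row indices
  \<open>1,\<dots>,d\<close>. Elements of type \<^typ>\<open>nat^'n\<close> are exponent vectors.\<close>

definition homogeneous :: "int^'n^'d \<Rightarrow> bool" where
  "homogeneous A \<longleftrightarrow> rank (map_matrix real_of_int A) = CARD('d) \<and>
     (\<exists>(h::real^'d) c. h \<noteq> 0 \<and> 0 \<notin> {y. h \<bullet> y = c} \<and>
        (\<forall>j. column j (map_matrix real_of_int A) \<in> {y. h \<bullet> y = c}))"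

definition lattice_ker :: "int^'n^'d \<Rightarrow> (int^'n) set" where
  "lattice_ker A = {u. A *v u = 0}"

definition pos_part :: "int^'n \<Rightarrow> nat^'n" where
  "pos_part u = (\<chi> j. nat (u $ j))"

definition neg_part :: "int^'n \<Rightarrow> nat^'n" where
  "neg_part u = (\<chi> j. nat (- u $ j))"

text \<open>\<open>\<complex>[\<partial>\<^sub>1,\<dots>,\<partial>\<^sub>n]\<close> is the monoid algebra of the exponent vectors.\<close>

type_synonym 'n dpoly = "(nat^'n) \<Rightarrow>\<^sub>0 complex"

definition toric_ideal :: "int^'n^'d \<Rightarrow> ('n dpoly) set" where
  "toric_ideal A = Idl\<^bsub>ring_of_type_algebra\<^esub>
     {Poly_Mapping.single (pos_part u) 1 - Poly_Mapping.single (neg_part u) 1 | u. u \<in> lattice_ker A}"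

definition initial_form :: "('m \<Rightarrow> real) \<Rightarrow> ('m \<Rightarrow>\<^sub>0 complex) \<Rightarrow> ('m \<Rightarrow>\<^sub>0 complex)" where
  "initial_form wt f =
     (\<Sum>m \<in> {m \<in> Poly_Mapping.keys f. \<forall>m' \<in> Poly_Mapping.keys f. wt m' \<le> wt m}. Poly_Mapping.single m (Poly_Mapping.lookup f m))"

definition nat_weight :: "real^'n \<Rightarrow> nat^'n \<Rightarrow> real" where
  "nat_weight w p = (\<Sum>j\<in>UNIV. w $ j * real (p $ j))"

definition initial_ideal :: "real^'n \<Rightarrow> ('n dpoly) set \<Rightarrow> ('n dpoly) set" where
  "initial_ideal w I = Idl\<^bsub>ring_of_type_algebra\<^esub> (initial_form (nat_weight w) ` I)"

definition monomial_ideal :: "('n::finite dpoly) set \<Rightarrow> bool" where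
  "monomial_ideal I \<longleftrightarrow>
     (\<exists>S. I = Idl\<^bsub>ring_of_type_algebra\<^esub> {Poly_Mapping.single p 1 | p. p \<in> S})"

text \<open>The Weyl algebra in normally ordered form: the key \<open>(a, b)\<close> stands for \<open>x\<^sup>a \<partial>\<^sup>b\<close>.
  The product is \<^term>\<open>weyl_mult\<close> below, given by the Leibniz rule
  \<open>\<partial>\<^sup>b x\<^sup>c = (\<Sum>k. (\<Prod>j. k\<^sub>j! (b\<^sub>j choose k\<^sub>j) (c\<^sub>j choose k\<^sub>j)) x\<^bsup>c-k\<^esup> \<partial>\<^bsup>b-k\<^esup>)\<close>; the
  multiplication that the type inherits from \<^theory>\<open>HOL-Library.Poly_Mapping\<close> is commutative
  and is not used.\<close>

type_synonym 'n weyl = "((nat^'n) \<times> (nat^'n)) \<Rightarrow>\<^sub>0 complex"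

definition weyl_mult :: "'n::finite weyl \<Rightarrow> 'n weyl \<Rightarrow> 'n weyl" where
  "weyl_mult f g =
     (\<Sum>(a, b) \<in> Poly_Mapping.keys f. \<Sum>(c, d) \<in> Poly_Mapping.keys g. \<Sum>k \<in> {k. k \<le> b \<and> k \<le> c}.
        Poly_Mapping.single (a + (c - k), (b - k) + d)
          (Poly_Mapping.lookup f (a, b) * Poly_Mapping.lookup g (c, d) *
           (\<Prod>j\<in>UNIV. of_nat (fact (k $ j) * (b $ j choose k $ j) * (c $ j choose k $ j)))))"

definition weyl_left_ideal :: "('n::finite weyl) set \<Rightarrow> bool" where
  "weyl_left_ideal I \<longleftrightarrow> 0 \<in> I \<and> (\<forall>f\<in>I. \<forall>g\<in>I. f + g \<in> I) \<and> (\<forall>f\<in>I. \<forall>a. weyl_mult a f \<in> I)"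

definition dpoly_to_weyl :: "'n::finite dpoly \<Rightarrow> 'n weyl" where
  "dpoly_to_weyl f = (\<Sum>p \<in> Poly_Mapping.keys f. Poly_Mapping.single (0, p) (Poly_Mapping.lookup f p))"

definition euler_op :: "int^'n^'d \<Rightarrow> complex^'d \<Rightarrow> 'd \<Rightarrow> 'n weyl" where
  "euler_op A \<beta> i =
     (\<Sum>j\<in>UNIV. Poly_Mapping.single (axis j 1, axis j 1) (of_int (A $ i $ j)))
     - Poly_Mapping.single (0, 0) (\<beta> $ i)"

definition hypergeometric_ideal :: "int^'n^'d \<Rightarrow> complex^'d \<Rightarrow> ('n weyl) set" where
  "hypergeometric_ideal A \<beta> =
     weyl_left_ideal hull (dpoly_to_weyl ` toric_ideal A \<union> range (euler_op A \<beta>))"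

definition weyl_initial_ideal :: "real^'n \<Rightarrow> ('n weyl) set \<Rightarrow> ('n weyl) set" where
  "weyl_initial_ideal w I =
     weyl_left_ideal hull (initial_form (\<lambda>(a, b). - nat_weight w a + nat_weight w b) ` I)"

text \<open>The cones of the small Groebner fan are the closures of the classes of directions with the
  same initial ideal.\<close>

definition small_groebner_fan :: "('n::finite weyl) set \<Rightarrow> (real^'n) set set" where
  "small_groebner_fan I =
     {closure {w'. weyl_initial_ideal w' I = weyl_initial_ideal w I} | w. True}"

definition generic_direction :: "int^'n^'d \<Rightarrow> complex^'d \<Rightarrow> real^'n \<Rightarrow> bool" where
  "generic_direction A \<beta> w \<longleftrightarrow>
     monomial_ideal (initial_ideal w (toric_ideal A)) \<and>
     (\<exists>C \<in> small_groebner_fan (hypergeometric_ideal A \<beta>).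
        aff_dim C = int CARD('n) \<and> w \<in> interior C)"

definition falling :: "complex^'n \<Rightarrow> nat^'n \<Rightarrow> complex" where
  "falling z p = (\<Prod>j\<in>UNIV. \<Prod>k<p $ j. z $ j - of_nat k)"

definition fake_exponent :: "int^'n^'d \<Rightarrow> complex^'d \<Rightarrow> real^'n \<Rightarrow> complex^'n \<Rightarrow> bool" where
  "fake_exponent A \<beta> w v \<longleftrightarrow>
     map_matrix of_int A *v v = \<beta> \<and>
     (\<forall>p. Poly_Mapping.single p 1 \<in> initial_ideal w (toric_ideal A) \<longrightarrow> falling v p = 0)"

definition nsupp :: "complex^'n \<Rightarrow> 'n set" where
  "nsupp z = {j. \<exists>k::int. k < 0 \<and> z $ j = of_int k}"

definition nsupp_shift :: "complex^'n \<Rightarrow> int^'n \<Rightarrow> 'n set" where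
  "nsupp_shift v u = nsupp (v + (\<chi> j. of_int (u $ j)))"

definition nsupps :: "int^'n^'d \<Rightarrow> complex^'n \<Rightarrow> 'n set set" where
  "nsupps A v = nsupp_shift v ` lattice_ker A"

definition nonneg_nsupps :: "int^'n^'d \<Rightarrow> real^'n \<Rightarrow> complex^'n \<Rightarrow> 'n set set" where
  "nonneg_nsupps A w v =
     {I \<in> nsupps A v. \<forall>u \<in> lattice_ker A. nsupp_shift v u = I \<longrightarrow>
        (\<Sum>j\<in>UNIV. w $ j * real_of_int (u $ j)) \<ge> 0}"

definition negative_support_family ::
    "int^'n^'d \<Rightarrow> real^'n \<Rightarrow> complex^'n \<Rightarrow> 'n set set \<Rightarrow> bool" where
  "negative_support_family A w v \<N> \<longleftrightarrow> nsupp v \<in> \<N> \<and> \<N> \<subseteq> nonneg_nsupps A w v"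

type_synonym 'n mps = "(nat^'n) \<Rightarrow> complex"

definition mps_ring :: "('n::finite mps) ring" where
  "mps_ring = \<lparr>carrier = UNIV,
     mult = (\<lambda>f g m. \<Sum>(p, q) \<in> {(p, q). p + q = m}. f p * g q),
     one = (\<lambda>m. if m = 0 then 1 else 0),
     zero = (\<lambda>m. 0),
     add = (\<lambda>f g m. f m + g m)\<rparr>"

definition mps_var :: "'n::finite \<Rightarrow> 'n mps" where
  "mps_var j = (\<lambda>m. if m = axis j 1 then 1 else 0)"

definition mps_monom :: "'n::finite set \<Rightarrow> 'n mps" where
  "mps_monom J = finprod mps_ring mps_var J"

definition linear_ideal :: "int^'n^'d \<Rightarrow> ('n mps) set" where
  "linear_ideal A =
     Idl\<^bsub>mps_ring\<^esub> (range (\<lambda>i m. \<Sum>j\<in>UNIV. of_int (A $ i $ j) * mps_var j m))"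

definition family_ideal :: "'n::finite set set \<Rightarrow> ('n mps) set" where
  "family_ideal \<N> = Idl\<^bsub>mps_ring\<^esub> {mps_monom (I - \<Inter>\<N>) | I. I \<in> \<N>}"

definition complement_ideal :: "int^'n^'d \<Rightarrow> complex^'n \<Rightarrow> 'n set set \<Rightarrow> ('n mps) set" where
  "complement_ideal A v \<N> =
     Idl\<^bsub>mps_ring\<^esub> {mps_monom ((I \<union> J) - \<Inter>\<N>) | I J. I \<in> \<N> \<and> J \<in> nsupps A v - \<N>}"

definition colon :: "('r, 'x) ring_scheme \<Rightarrow> 'r set \<Rightarrow> 'r \<Rightarrow> 'r set" where
  "colon R I e = {r \<in> carrier R. r \<otimes>\<^bsub>R\<^esub> e \<in> I}"

text \<open>The fields \<open>mult\<close> and \<open>one\<close> of a module record are irrelevant.\<close>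

definition mod_hom ::
    "('r, 'x) ring_scheme \<Rightarrow> ('r, 'm, 'y) module_scheme \<Rightarrow> ('r, 'k, 'z) module_scheme \<Rightarrow> ('m \<Rightarrow> 'k) set"
  where
  "mod_hom R M N = {f \<in> carrier M \<rightarrow> carrier N.
     (\<forall>x\<in>carrier M. \<forall>y\<in>carrier M. f (x \<oplus>\<^bsub>M\<^esub> y) = f x \<oplus>\<^bsub>N\<^esub> f y) \<and>
     (\<forall>r\<in>carrier R. \<forall>x\<in>carrier M. f (r \<odot>\<^bsub>M\<^esub> x) = r \<odot>\<^bsub>N\<^esub> f x)}"

definition mod_iso ::
    "('r, 'x) ring_scheme \<Rightarrow> ('r, 'm, 'y) module_scheme \<Rightarrow> ('r, 'k, 'z) module_scheme \<Rightarrow> ('m \<Rightarrow> 'k) set"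
  where
  "mod_iso R M N = {f \<in> mod_hom R M N. bij_betw f (carrier M) (carrier N)}"

definition mod_ker :: "('r, 'm, 'y) module_scheme \<Rightarrow> ('r, 'k, 'z) module_scheme \<Rightarrow> ('m \<Rightarrow> 'k) \<Rightarrow> 'm set"
  where
  "mod_ker M N f = {x \<in> carrier M. f x = \<zero>\<^bsub>N\<^esub>}"

definition mod_exact ::
    "('r, 'x) ring_scheme \<Rightarrow> ('r, 'm, 'y) module_scheme \<Rightarrow> ('m \<Rightarrow> 'k) \<Rightarrow> ('r, 'k, 'z) module_scheme
      \<Rightarrow> ('k \<Rightarrow> 'l) \<Rightarrow> ('r, 'l, 'u) module_scheme \<Rightarrow> bool"
  where
  "mod_exact R M' f M g M'' \<longleftrightarrow>
     f \<in> mod_hom R M' M \<and> g \<in> mod_hom R M M'' \<and> f ` carrier M' = mod_ker M M'' g"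

definition quot_module :: "('r, 'm, 'y) module_scheme \<Rightarrow> 'm set \<Rightarrow> ('r, 'm set) module" where
  "quot_module M N = \<lparr>carrier = a_rcosets\<^bsub>M\<^esub> N, mult = undefined, one = undefined, zero = N,
     add = set_add M, smult = (\<lambda>r Z. \<Union>x\<in>Z. N +>\<^bsub>M\<^esub> (r \<odot>\<^bsub>M\<^esub> x))\<rparr>"

text \<open>The map \<open>M/N \<rightarrow> M'/N'\<close> induced by \<open>f : M \<rightarrow> M'\<close> (which is to satisfy \<open>f(N) \<subseteq> N'\<close>): the
  union has a single member.\<close>

definition quot_map :: "('r, 'k, 'y) module_scheme \<Rightarrow> 'k set \<Rightarrow> ('m \<Rightarrow> 'k) \<Rightarrow> 'm set \<Rightarrow> 'k set" where
  "quot_map M' N' f Z = (\<Union>x\<in>Z. N' +>\<^bsub>M'\<^esub> f x)"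

definition reg_module :: "('r, 'x) ring_scheme \<Rightarrow> ('r, 'r) module" where
  "reg_module R = \<lparr>carrier = carrier R, mult = mult R, one = one R, zero = zero R, add = add R,
     smult = mult R\<rparr>"

abbreviation ideal_module :: "('r, 'x) ring_scheme \<Rightarrow> 'r set \<Rightarrow> ('r, 'r) module" where
  "ideal_module R J \<equiv> (reg_module R)\<lparr>carrier := J\<rparr>"

definition free_module :: "('r, 'x) ring_scheme \<Rightarrow> 'b set \<Rightarrow> ('r, 'b \<Rightarrow> 'r) module" where
  "free_module R B = \<lparr>carrier = {\<phi>. range \<phi> \<subseteq> carrier R \<and> finite {b. \<phi> b \<noteq> \<zero>\<^bsub>R\<^esub>} \<and>
       {b. \<phi> b \<noteq> \<zero>\<^bsub>R\<^esub>} \<subseteq> B},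
     mult = undefined, one = undefined, zero = (\<lambda>b. \<zero>\<^bsub>R\<^esub>),
     add = (\<lambda>\<phi> \<psi> b. \<phi> b \<oplus>\<^bsub>R\<^esub> \<psi> b), smult = (\<lambda>r \<phi> b. r \<otimes>\<^bsub>R\<^esub> \<phi> b)\<rparr>"

definition free_gen :: "('r, 'x) ring_scheme \<Rightarrow> 'b \<Rightarrow> 'b \<Rightarrow> 'r" where
  "free_gen R b = (\<lambda>b'. if b' = b then \<one>\<^bsub>R\<^esub> else \<zero>\<^bsub>R\<^esub>)"

text \<open>The map of free modules given by \<open>h\<close> on the basis elements.\<close>

definition free_map :: "('r, 'x) ring_scheme \<Rightarrow> ('b \<Rightarrow> 'c) \<Rightarrow> ('b \<Rightarrow> 'r) \<Rightarrow> 'c \<Rightarrow> 'r" where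
  "free_map R h \<phi> = (\<lambda>c. finsum R \<phi> {b. \<phi> b \<noteq> \<zero>\<^bsub>R\<^esub> \<and> h b = c})"

definition is_free :: "('r, 'x) ring_scheme \<Rightarrow> ('r, 'm, 'y) module_scheme \<Rightarrow> bool" where
  "is_free R M \<longleftrightarrow> module R M \<and> (\<exists>(B::'m set) \<phi>. \<phi> \<in> mod_iso R (free_module R B) M)"

definition submodule_span :: "('r, 'x) ring_scheme \<Rightarrow> ('r, 'm, 'y) module_scheme \<Rightarrow> 'm set \<Rightarrow> 'm set" where
  "submodule_span R M S = \<Inter>{H. submodule H R M \<and> S \<subseteq> H}"

definition tensor_free ::
    "('r, 'x) ring_scheme \<Rightarrow> ('r, 'm, 'y) module_scheme \<Rightarrow> ('r, 'k, 'z) module_scheme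
      \<Rightarrow> ('r, 'm \<times> 'k \<Rightarrow> 'r) module"
  where
  "tensor_free R M N = free_module R (carrier M \<times> carrier N)"

definition tensor_rel ::
    "('r, 'x) ring_scheme \<Rightarrow> ('r, 'm, 'y) module_scheme \<Rightarrow> ('r, 'k, 'z) module_scheme
      \<Rightarrow> ('m \<times> 'k \<Rightarrow> 'r) set"
  where
  "tensor_rel R M N = (let T = tensor_free R M N; g = free_gen R in
     submodule_span R T
       ({g (x \<oplus>\<^bsub>M\<^esub> x', y) \<ominus>\<^bsub>T\<^esub> (g (x, y) \<oplus>\<^bsub>T\<^esub> g (x', y)) | x x' y.
           x \<in> carrier M \<and> x' \<in> carrier M \<and> y \<in> carrier N} \<union>
        {g (x, y \<oplus>\<^bsub>N\<^esub> y') \<ominus>\<^bsub>T\<^esub> (g (x, y) \<oplus>\<^bsub>T\<^esub> g (x, y')) | x y y'.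
           x \<in> carrier M \<and> y \<in> carrier N \<and> y' \<in> carrier N} \<union>
        {g (r \<odot>\<^bsub>M\<^esub> x, y) \<ominus>\<^bsub>T\<^esub> (r \<odot>\<^bsub>T\<^esub> g (x, y)) | r x y.
           r \<in> carrier R \<and> x \<in> carrier M \<and> y \<in> carrier N} \<union>
        {g (x, r \<odot>\<^bsub>N\<^esub> y) \<ominus>\<^bsub>T\<^esub> (r \<odot>\<^bsub>T\<^esub> g (x, y)) | r x y.
           r \<in> carrier R \<and> x \<in> carrier M \<and> y \<in> carrier N}))"

definition tensor ::
    "('r, 'x) ring_scheme \<Rightarrow> ('r, 'm, 'y) module_scheme \<Rightarrow> ('r, 'k, 'z) module_scheme
      \<Rightarrow> ('r, ('m \<times> 'k \<Rightarrow> 'r) set) module"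
  where
  "tensor R M N = quot_module (tensor_free R M N) (tensor_rel R M N)"

definition pure_tensor ::
    "('r, 'x) ring_scheme \<Rightarrow> ('r, 'm, 'y) module_scheme \<Rightarrow> ('r, 'k, 'z) module_scheme
      \<Rightarrow> 'm \<Rightarrow> 'k \<Rightarrow> ('m \<times> 'k \<Rightarrow> 'r) set"
  where
  "pure_tensor R M N x y = tensor_rel R M N +>\<^bsub>tensor_free R M N\<^esub> free_gen R (x, y)"

text \<open>\<open>f \<otimes> g : M \<otimes> N \<rightarrow> M' \<otimes> N'\<close>; only the target modules are needed as arguments.\<close>

definition tensor_map ::
    "('r, 'x) ring_scheme \<Rightarrow> ('r, 'm1, 'y) module_scheme \<Rightarrow> ('r, 'k1, 'z) module_scheme
      \<Rightarrow> ('m \<Rightarrow> 'm1) \<Rightarrow> ('k \<Rightarrow> 'k1) \<Rightarrow> ('m \<times> 'k \<Rightarrow> 'r) set \<Rightarrow> ('m1 \<times> 'k1 \<Rightarrow> 'r) set"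
  where
  "tensor_map R M' N' f g =
     quot_map (tensor_free R M' N') (tensor_rel R M' N') (free_map R (map_prod f g))"

text \<open>\<open>\<dots> \<rightarrow> F\<^sub>2 \<rightarrow> F\<^sub>1 \<rightarrow> F\<^sub>0 \<rightarrow> M \<rightarrow> 0\<close> with \<open>d i : F\<^bsub>i+1\<^esub> \<rightarrow> F\<^sub>i\<close>
  and augmentation \<open>\<epsilon>\<close>.\<close>

definition free_resolution ::
    "('r, 'x) ring_scheme \<Rightarrow> ('r, 'm, 'y) module_scheme \<Rightarrow> (nat \<Rightarrow> ('r, 'f) module)
      \<Rightarrow> (nat \<Rightarrow> 'f \<Rightarrow> 'f) \<Rightarrow> ('f \<Rightarrow> 'm) \<Rightarrow> bool"
  where
  "free_resolution R M F d \<epsilon> \<longleftrightarrow>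
     (\<forall>i. is_free R (F i)) \<and>
     (\<forall>i. mod_exact R (F (Suc (Suc i))) (d (Suc i)) (F (Suc i)) (d i) (F i)) \<and>
     mod_exact R (F 1) (d 0) (F 0) \<epsilon> M \<and>
     \<epsilon> ` carrier (F 0) = carrier M"

fun tor_cycles ::
    "('r, 'x) ring_scheme \<Rightarrow> (nat \<Rightarrow> ('r, 'f) module) \<Rightarrow> (nat \<Rightarrow> 'f \<Rightarrow> 'f)
      \<Rightarrow> ('r, 'k, 'z) module_scheme \<Rightarrow> nat \<Rightarrow> ('f \<times> 'k \<Rightarrow> 'r) set set"
  where
  "tor_cycles R F d N 0 = carrier (tensor R (F 0) N)"
| "tor_cycles R F d N (Suc i) =
     mod_ker (tensor R (F (Suc i)) N) (tensor R (F i) N) (tensor_map R (F i) N (d i) id)"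

definition tor_boundaries ::
    "('r, 'x) ring_scheme \<Rightarrow> (nat \<Rightarrow> ('r, 'f) module) \<Rightarrow> (nat \<Rightarrow> 'f \<Rightarrow> 'f)
      \<Rightarrow> ('r, 'k, 'z) module_scheme \<Rightarrow> nat \<Rightarrow> ('f \<times> 'k \<Rightarrow> 'r) set set"
  where
  "tor_boundaries R F d N i = tensor_map R (F i) N (d i) id ` carrier (tensor R (F (Suc i)) N)"

text \<open>\<open>Tor\<^sub>i(M, N) = H\<^sub>i(F \<otimes> N)\<close>, computed from a free resolution \<open>F\<close> of \<open>M\<close>, and its
  functoriality in \<open>N\<close>. The resolution is an argument: statements about \<open>Tor\<close> quantify
  over all free resolutions \<open>F\<close>.\<close>

definition tor ::
    "('r, 'x) ring_scheme \<Rightarrow> (nat \<Rightarrow> ('r, 'f) module) \<Rightarrow> (nat \<Rightarrow> 'f \<Rightarrow> 'f)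
      \<Rightarrow> ('r, 'k, 'z) module_scheme \<Rightarrow> nat \<Rightarrow> ('r, ('f \<times> 'k \<Rightarrow> 'r) set set) module"
  where
  "tor R F d N i =
     quot_module ((tensor R (F i) N)\<lparr>carrier := tor_cycles R F d N i\<rparr>) (tor_boundaries R F d N i)"

definition tor_map ::
    "('r, 'x) ring_scheme \<Rightarrow> (nat \<Rightarrow> ('r, 'f) module) \<Rightarrow> (nat \<Rightarrow> 'f \<Rightarrow> 'f)
      \<Rightarrow> ('r, 'k1, 'z) module_scheme \<Rightarrow> ('k \<Rightarrow> 'k1) \<Rightarrow> nat
      \<Rightarrow> ('f \<times> 'k \<Rightarrow> 'r) set set \<Rightarrow> ('f \<times> 'k1 \<Rightarrow> 'r) set set"
  where
  "tor_map R F d N' g i =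
     quot_map (tensor R (F i) N') (tor_boundaries R F d N' i) (tensor_map R (F i) N' id g)"

text \<open>The connecting homomorphism \<open>Tor\<^sub>1(M, C) \<rightarrow> M \<otimes> A\<close> of a short exact sequence
  \<open>0 \<rightarrow> A \<rightarrow> B \<rightarrow> C \<rightarrow> 0\<close> with maps \<open>\<iota>\<close> and \<open>\<pi>\<close>, by the usual diagram chase: lift a cycle
  to \<open>F\<^sub>1 \<otimes> B\<close>, apply the differential, pull the result back to \<open>F\<^sub>0 \<otimes> A\<close> and pass to
  \<open>H\<^sub>0(F \<otimes> A) = M \<otimes> A\<close> by \<open>\<epsilon>\<close>.\<close>

definition tor_connecting ::
    "('r, 'x) ring_scheme \<Rightarrow> ('r, 'm, 'y) module_scheme \<Rightarrow> (nat \<Rightarrow> ('r, 'f) module)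
      \<Rightarrow> (nat \<Rightarrow> 'f \<Rightarrow> 'f) \<Rightarrow> ('f \<Rightarrow> 'm)
      \<Rightarrow> ('r, 'a, 'z) module_scheme \<Rightarrow> ('a \<Rightarrow> 'b) \<Rightarrow> ('r, 'b, 'u) module_scheme \<Rightarrow> ('b \<Rightarrow> 'c)
      \<Rightarrow> ('r, 'c, 'v) module_scheme
      \<Rightarrow> ('f \<times> 'c \<Rightarrow> 'r) set set \<Rightarrow> ('m \<times> 'a \<Rightarrow> 'r) set"
  where
  "tor_connecting R M F d \<epsilon> A \<iota> B \<pi> C Z =
     (THE y. \<exists>b \<in> carrier (tensor R (F 1) B). \<exists>a \<in> carrier (tensor R (F 0) A).
        tensor_map R (F 1) C id \<pi> b \<in> Z \<and>
        tensor_map R (F 0) B id \<iota> a = tensor_map R (F 0) B (d 0) id b \<and>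
        y = tensor_map R M A \<epsilon> id a)"

text \<open>\<open>J/I\<close> for ideals \<open>I \<subseteq> J\<close>, and the map \<open>r + I \<mapsto> f r + I'\<close> into a quotient by \<open>I'\<close>.\<close>

definition ideal_quot :: "('r, 'x) ring_scheme \<Rightarrow> 'r set \<Rightarrow> 'r set \<Rightarrow> ('r, 'r set) module" where
  "ideal_quot R J I = quot_module (ideal_module R J) I"

abbreviation cyclic_module :: "('r, 'x) ring_scheme \<Rightarrow> 'r set \<Rightarrow> ('r, 'r set) module" where
  "cyclic_module R I \<equiv> ideal_quot R (carrier R) I"

definition coset_map :: "('r, 'x) ring_scheme \<Rightarrow> 'r set \<Rightarrow> ('r \<Rightarrow> 'r) \<Rightarrow> 'r set \<Rightarrow> 'r set" where
  "coset_map R I' f = quot_map (reg_module R) I' f"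

definition Q_ideal :: "int^'n^'d \<Rightarrow> complex^'n \<Rightarrow> 'n set set \<Rightarrow> ('n mps) set" where
  "Q_ideal A v \<N> =
     (linear_ideal A \<cdot>\<^bsub>mps_ring\<^esub> family_ideal \<N>) <+>\<^bsub>mps_ring\<^esub> complement_ideal A v \<N>"

definition e_monom :: "complex^'n \<Rightarrow> 'n set set \<Rightarrow> 'n mps" where
  "e_monom v \<N> = mps_monom (nsupp v - \<Inter>\<N>)"

definition D_module ::
    "int^'n^'d \<Rightarrow> complex^'n \<Rightarrow> 'n set set \<Rightarrow> ('n mps, 'n mps set) module" where
  "D_module A v \<N> = ideal_quot mps_ring
     (colon mps_ring (linear_ideal A <+>\<^bsub>mps_ring\<^esub> complement_ideal A v \<N>) (e_monom v \<N>))
     (colon mps_ring (Q_ideal A v \<N>) (e_monom v \<N>))"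

definition T_module ::
    "int^'n^'d \<Rightarrow> complex^'n \<Rightarrow> 'n set set \<Rightarrow> ('n mps, 'n mps set) module" where
  "T_module A v \<N> = ideal_quot mps_ring
     ((linear_ideal A \<inter> family_ideal \<N>) <+>\<^bsub>mps_ring\<^esub> complement_ideal A v \<N>)
     (Q_ideal A v \<N>)"

end

theory Submission
  imports Defs
begin

text \<open>Tensoring a short exact sequence \<open>0 \<rightarrow> A \<rightarrow> B \<rightarrow> C \<rightarrow> 0\<close> with a free resolution of \<open>R/I\<close>
  gives the exact sequence \<open>Tor\<^sub>1(R/I, B) \<rightarrow> Tor\<^sub>1(R/I, C) \<rightarrow> R/I \<otimes> A \<rightarrow> R/I \<otimes> B\<close>.

  For (1) take \<open>0 \<rightarrow> M \<rightarrow> R \<rightarrow> R/M \<rightarrow> 0\<close> and \<open>I = U\<close>: as \<open>Tor\<^sub>1(R/U, R) = 0\<close>, the connecting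
  map identifies \<open>Tor\<^sub>1(R/U, R/M)\<close> with the classes \<open>1 \<otimes> m\<close>, \<open>m \<in> U \<inter> M\<close>, and \<open>1 \<otimes> m \<mapsto> m + Q\<close>
  maps onto \<open>(U \<inter> M + P)/Q\<close>. If \<open>m = x + p\<close> with \<open>x \<in> UM\<close> and \<open>p \<in> P\<close>, then
  \<open>1 \<otimes> m = 1 \<otimes> p\<close> with \<open>p \<in> U \<inter> P\<close>, so the kernel comes from \<open>Tor\<^sub>1(R/U, R/P)\<close> by naturality.

  For (2) take \<open>0 \<rightarrow> S/Q \<rightarrow> R/Q \<rightarrow> R/S \<rightarrow> 0\<close> with \<open>S = U + P\<close>, and \<open>I = \<langle>e\<rangle>\<close>: since \<open>e \<in> M\<close> kills
  \<open>S/Q\<close>, the connecting map takes values in \<open>R/\<langle>e\<rangle> \<otimes> S/Q = S/Q\<close>, and its image is the kernel of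
  \<open>S/Q \<rightarrow> R/(Q + \<langle>e\<rangle>)\<close>, that is, the set of classes of multiples of \<open>e\<close> lying in \<open>S\<close>. By the
  modular law \<open>S \<inter> M \<subseteq> U \<inter> M + P\<close> these are also the classes of multiples of \<open>e\<close> in the target
  of (1).\<close>

section \<open>Modules and quotient modules\<close>

text \<open>The connecting map is a definite description over all lifts of a cycle, so it can be
  computed only once its independence of the lift is known. This is where the freeness of the
  resolution is spent: tensoring with \<open>F i\<close> must keep \<open>\<iota>\<close> injective
  and the short exact sequence exact in the middle. Both facts are read off from the coordinates of
  a tensor with respect to a basis. Classes in Tor are hard to compare directly, while the tensors
  \<open>1 \<otimes> m\<close> are given by single ring elements. Since the connecting map for
  \<open>R/M\<close> is injective, an identity between such tensors lifts back to Tor. The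
  combinatorics of negative supports is condensed into two facts: P \<subseteq> M, as each generator
  of P is a monomial multiple of a generator of M, and e \<in> M, as the support of v belongs to the
  family. Both sequences are then proved over an arbitrary commutative ring.\<close>

lemma (in module) submodule_intro:
  assumes "H \<subseteq> carrier M" "\<zero>\<^bsub>M\<^esub> \<in> H"
    and "\<And>x y. x \<in> H \<Longrightarrow> y \<in> H \<Longrightarrow> x \<oplus>\<^bsub>M\<^esub> y \<in> H"
    and "\<And>a x. a \<in> carrier R \<Longrightarrow> x \<in> H \<Longrightarrow> a \<odot>\<^bsub>M\<^esub> x \<in> H"
  shows "submodule H R M"
proof (rule submoduleI)
  fix a assume "a \<in> H"
  then have "\<ominus>\<^bsub>M\<^esub> a = (\<ominus> \<one>) \<odot>\<^bsub>M\<^esub> a"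
    using assms(1) smult_l_minus[of "\<one>" a] by auto
  then show "\<ominus>\<^bsub>M\<^esub> a \<in> H"
    using assms(4) \<open>a \<in> H\<close> by auto
qed (use assms in auto)

lemma (in module) submodule_zero: "submodule H R M \<Longrightarrow> \<zero>\<^bsub>M\<^esub> \<in> H"
  using subgroup.one_closed[OF submodule.axioms(1), of H R M] by simp

text \<open>Homology is formed as a quotient of the cycles, a module with a restricted carrier. The
  boundaries, known to be a submodule of the whole tensor product, must be one of that smaller
  module.\<close>

lemma (in module) submodule_submodule:
  assumes "submodule H R M" "submodule N R M" "N \<subseteq> H"
  shows "submodule N R (M\<lparr>carrier := H\<rparr>)"
proof -
  interpret H: module R "M\<lparr>carrier := H\<rparr>"
    using submodule.submodule_is_module[OF assms(1)] module_axioms by blast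
  show ?thesis
    by (rule H.submodule_intro) (use assms submodule_zero submoduleE in auto)
qed

lemma mod_homI:
  assumes "\<And>x. x \<in> carrier M \<Longrightarrow> f x \<in> carrier N"
    and "\<And>x y. x \<in> carrier M \<Longrightarrow> y \<in> carrier M \<Longrightarrow> f (x \<oplus>\<^bsub>M\<^esub> y) = f x \<oplus>\<^bsub>N\<^esub> f y"
    and "\<And>r x. r \<in> carrier R \<Longrightarrow> x \<in> carrier M \<Longrightarrow> f (r \<odot>\<^bsub>M\<^esub> x) = r \<odot>\<^bsub>N\<^esub> f x"
  shows "f \<in> mod_hom R M N"
  using assms unfolding mod_hom_def by auto

lemma
  assumes "f \<in> mod_hom R M N"
  shows mod_hom_closed: "x \<in> carrier M \<Longrightarrow> f x \<in> carrier N"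
    and mod_hom_add: "x \<in> carrier M \<Longrightarrow> y \<in> carrier M \<Longrightarrow> f (x \<oplus>\<^bsub>M\<^esub> y) = f x \<oplus>\<^bsub>N\<^esub> f y"
    and mod_hom_smult: "r \<in> carrier R \<Longrightarrow> x \<in> carrier M \<Longrightarrow> f (r \<odot>\<^bsub>M\<^esub> x) = r \<odot>\<^bsub>N\<^esub> f x"
  using assms unfolding mod_hom_def by auto

text \<open>\<open>mod_hom\<close> demands additivity and linearity but no value at zero; it follows
  because zero is the multiple of itself by the zero of the ring.\<close>

lemma mod_hom_zero:
  assumes "module R M" "module R N" "f \<in> mod_hom R M N"
  shows "f \<zero>\<^bsub>M\<^esub> = \<zero>\<^bsub>N\<^esub>"
proof -
  interpret M: module R M by fact
  interpret N: module R N by fact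
  have "f \<zero>\<^bsub>M\<^esub> = f (\<zero>\<^bsub>R\<^esub> \<odot>\<^bsub>M\<^esub> \<zero>\<^bsub>M\<^esub>)" by simp
  also have "\<dots> = \<zero>\<^bsub>R\<^esub> \<odot>\<^bsub>N\<^esub> f \<zero>\<^bsub>M\<^esub>" by (rule mod_hom_smult[OF assms(3)]) auto
  also have "\<dots> = \<zero>\<^bsub>N\<^esub>" using mod_hom_closed[OF assms(3)] by auto
  finally show ?thesis .
qed

lemma mod_hom_a_inv:
  assumes "module R M" "module R N" "f \<in> mod_hom R M N" "x \<in> carrier M"
  shows "f (\<ominus>\<^bsub>M\<^esub> x) = \<ominus>\<^bsub>N\<^esub> f x"
proof -
  interpret M: module R M by fact
  interpret N: module R N by fact
  have "f x \<in> carrier N" using mod_hom_closed assms by metis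
  moreover have "f (\<ominus>\<^bsub>M\<^esub> x) = f ((\<ominus>\<^bsub>R\<^esub> \<one>\<^bsub>R\<^esub>) \<odot>\<^bsub>M\<^esub> x)"
    using assms(4) M.smult_l_minus[of "\<one>\<^bsub>R\<^esub>" x] by simp
  ultimately show ?thesis
    using N.smult_l_minus[of "\<one>\<^bsub>R\<^esub>" "f x"] mod_hom_smult[OF assms(3), of "\<ominus>\<^bsub>R\<^esub> \<one>\<^bsub>R\<^esub>" x] assms(4)
    by simp
qed

lemma mod_hom_minus:
  assumes "module R M" "module R N" "f \<in> mod_hom R M N" "x \<in> carrier M" "y \<in> carrier M"
  shows "f (x \<ominus>\<^bsub>M\<^esub> y) = f x \<ominus>\<^bsub>N\<^esub> f y"
proof -
  interpret M: module R M by fact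
  show ?thesis
    using assms by (simp add: a_minus_def mod_hom_add mod_hom_a_inv)
qed

lemma mod_hom_comp:
  "f \<in> mod_hom R M N \<Longrightarrow> g \<in> mod_hom R N K \<Longrightarrow> (\<lambda>x. g (f x)) \<in> mod_hom R M K"
  by (rule mod_homI) (simp_all add: mod_hom_closed mod_hom_add mod_hom_smult)

lemma id_mod_hom: "id \<in> mod_hom R M M"
  by (rule mod_homI) auto

lemma mod_ker_submodule:
  assumes "module R M" "module R N" "f \<in> mod_hom R M N"
  shows "submodule (mod_ker M N f) R M"
proof -
  interpret M: module R M by fact
  interpret N: module R N by fact
  show ?thesis
    by (rule M.submodule_intro)
      (use assms in \<open>auto simp: mod_ker_def mod_hom_zero mod_hom_add mod_hom_smult\<close>)
qed

lemma image_submodule: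
  assumes "module R M" "module R N" "f \<in> mod_hom R M N"
  shows "submodule (f ` carrier M) R N"
proof -
  interpret M: module R M by fact
  interpret N: module R N by fact
  show ?thesis
  proof (rule N.submodule_intro)
    show "\<zero>\<^bsub>N\<^esub> \<in> f ` carrier M"
      using mod_hom_zero[OF assms] by (metis M.zero_closed imageI)
  qed (use mod_hom_closed[OF assms(3)] in
      \<open>auto simp flip: mod_hom_add[OF assms(3)] mod_hom_smult[OF assms(3)]\<close>)
qed

lemma (in module) eq_iff_minus:
  "x \<in> carrier M \<Longrightarrow> y \<in> carrier M \<Longrightarrow> x \<ominus>\<^bsub>M\<^esub> y = \<zero>\<^bsub>M\<^esub> \<longleftrightarrow> x = y"
  using M.minus_equality M.minus_minus unfolding a_minus_def by (metis M.a_inv_closed M.r_neg)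

section \<open>Quotients by a submodule\<close>

locale quotient_module = module R M for R (structure) and M (structure) +
  fixes N assumes N: "submodule N R M"
begin

lemma N_subset: "N \<subseteq> carrier M" and N_zero: "\<zero>\<^bsub>M\<^esub> \<in> N"
  using N submoduleE submodule_zero by auto

sublocale N: abelian_subgroup N M
  by (rule abelian_subgroupI3)
    (auto simp: additive_subgroup_def submodule.axioms[OF N] M.abelian_group_axioms)

lemma coset_self: "x \<in> carrier M \<Longrightarrow> x \<in> N +>\<^bsub>M\<^esub> x"
  by (rule N.a_rcos_self)

lemma coset_eq_iff:
  assumes "x \<in> carrier M" "y \<in> carrier M"
  shows "N +>\<^bsub>M\<^esub> x = N +>\<^bsub>M\<^esub> y \<longleftrightarrow> x \<ominus>\<^bsub>M\<^esub> y \<in> N"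
  using assms N.a_rcos_module[of y x] coset_self[OF assms(1)] N.a_repr_independence'[of x y]
  unfolding a_minus_def by auto

lemma coset_zero_iff: "x \<in> carrier M \<Longrightarrow> N +>\<^bsub>M\<^esub> x = N \<longleftrightarrow> x \<in> N"
  using N.a_rcos_const coset_self by auto

lemma quot_carrier: "carrier (quot_module M N) = (\<lambda>x. N +>\<^bsub>M\<^esub> x) ` carrier M"
  by (auto simp: quot_module_def A_RCOSETS_def')

lemma quot_zero: "\<zero>\<^bsub>quot_module M N\<^esub> = N"
  by (simp add: quot_module_def)

lemma quot_add:
  "x \<in> carrier M \<Longrightarrow> y \<in> carrier M \<Longrightarrow>
    (N +>\<^bsub>M\<^esub> x) \<oplus>\<^bsub>quot_module M N\<^esub> (N +>\<^bsub>M\<^esub> y) = N +>\<^bsub>M\<^esub> (x \<oplus>\<^bsub>M\<^esub> y)"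
  by (simp add: quot_module_def N.a_rcos_sum)

lemma coset_memD: "x \<in> carrier M \<Longrightarrow> y \<in> N +>\<^bsub>M\<^esub> x \<Longrightarrow> y \<in> carrier M \<and> y \<ominus>\<^bsub>M\<^esub> x \<in> N"
  using N.a_elemrcos_carrier N.a_rcos_module_imp unfolding a_minus_def by blast

text \<open>The scalar multiple in \<open>quot_module\<close> is a union over all representatives
  \<open>y\<close> of the class. Any two of them give the same coset because
  \<open>r y - r x = r (y - x)\<close> stays in \<open>N\<close>, so the union collapses.\<close>

lemma quot_smult:
  assumes "r \<in> carrier R" "x \<in> carrier M"
  shows "r \<odot>\<^bsub>quot_module M N\<^esub> (N +>\<^bsub>M\<^esub> x) = N +>\<^bsub>M\<^esub> (r \<odot>\<^bsub>M\<^esub> x)"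
proof -
  have "N +>\<^bsub>M\<^esub> (r \<odot>\<^bsub>M\<^esub> y) = N +>\<^bsub>M\<^esub> (r \<odot>\<^bsub>M\<^esub> x)" if "y \<in> N +>\<^bsub>M\<^esub> x" for y
  proof -
    have y: "y \<in> carrier M" "y \<ominus>\<^bsub>M\<^esub> x \<in> N" using coset_memD that assms by auto
    have "r \<odot>\<^bsub>M\<^esub> y \<ominus>\<^bsub>M\<^esub> r \<odot>\<^bsub>M\<^esub> x = r \<odot>\<^bsub>M\<^esub> (y \<ominus>\<^bsub>M\<^esub> x)"
      using y assms by (simp add: a_minus_def smult_r_distr smult_r_minus)
    then show ?thesis
      using y assms N by (simp add: coset_eq_iff submoduleE)
  qed
  then have "(\<Union>y \<in> N +>\<^bsub>M\<^esub> x. N +>\<^bsub>M\<^esub> (r \<odot>\<^bsub>M\<^esub> y)) = (\<Union>y \<in> N +>\<^bsub>M\<^esub> x. N +>\<^bsub>M\<^esub> (r \<odot>\<^bsub>M\<^esub> x))"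
    by (rule SUP_cong[OF refl])
  also have "\<dots> = N +>\<^bsub>M\<^esub> (r \<odot>\<^bsub>M\<^esub> x)"
    using coset_self[OF assms(2)] by blast
  finally show ?thesis
    by (simp add: quot_module_def)
qed

lemma quot_is_module: "module R (quot_module M N)"
proof (rule moduleI)
  have zero: "\<zero>\<^bsub>quot_module M N\<^esub> = N +>\<^bsub>M\<^esub> \<zero>\<^bsub>M\<^esub>"
    using coset_zero_iff[of "\<zero>\<^bsub>M\<^esub>"] N_zero quot_zero by simp
  show "abelian_group (quot_module M N)"
  proof (rule abelian_groupI)
    fix Z assume "Z \<in> carrier (quot_module M N)"
    then obtain x where "x \<in> carrier M" "Z = N +>\<^bsub>M\<^esub> x" by (auto simp: quot_carrier)
    then show "\<exists>Y\<in>carrier (quot_module M N). Y \<oplus>\<^bsub>quot_module M N\<^esub> Z = \<zero>\<^bsub>quot_module M N\<^esub>"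
      by (intro bexI[of _ "N +>\<^bsub>M\<^esub> (\<ominus>\<^bsub>M\<^esub> x)"])
        (auto simp: quot_carrier quot_add zero M.l_neg)
  next
    fix Z assume "Z \<in> carrier (quot_module M N)"
    then obtain x where "x \<in> carrier M" "Z = N +>\<^bsub>M\<^esub> x" by (auto simp: quot_carrier)
    then show "\<zero>\<^bsub>quot_module M N\<^esub> \<oplus>\<^bsub>quot_module M N\<^esub> Z = Z"
      by (simp add: zero quot_add)
  qed (auto simp: quot_carrier zero quot_add M.a_assoc M.a_comm M.a_lcomm)
qed (auto simp: quot_carrier quot_add quot_smult smult_l_distr smult_r_distr smult_assoc1 R.is_cring)

lemma quot_proj_hom: "(\<lambda>x. N +>\<^bsub>M\<^esub> x) \<in> mod_hom R M (quot_module M N)"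
  by (rule mod_homI) (auto simp: quot_carrier quot_add quot_smult)

text \<open>Two representatives differ by an element of \<open>L\<close>, which \<open>f\<close>
  sends into \<open>N\<close>; hence all members of the union in \<open>quot_map\<close>
  coincide.\<close>

lemma quot_map_eq:
  assumes "module R K" "f \<in> mod_hom R K M" "submodule L R K" "f ` L \<subseteq> N" "x \<in> carrier K"
  shows "quot_map M N f (L +>\<^bsub>K\<^esub> x) = N +>\<^bsub>M\<^esub> f x"
proof -
  interpret K: quotient_module R K L
    by (intro quotient_module.intro quotient_module_axioms.intro assms)
  have "N +>\<^bsub>M\<^esub> f y = N +>\<^bsub>M\<^esub> f x" if "y \<in> L +>\<^bsub>K\<^esub> x" for y
  proof -
    have y: "y \<in> carrier K" "y \<ominus>\<^bsub>K\<^esub> x \<in> L" using K.coset_memD that assms by auto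
    have "f y \<ominus>\<^bsub>M\<^esub> f x = f (y \<ominus>\<^bsub>K\<^esub> x)"
      using y assms module_axioms by (simp add: mod_hom_minus)
    then show ?thesis
      using y assms mod_hom_closed[OF assms(2)] by (simp add: coset_eq_iff image_subset_iff)
  qed
  then have "(\<Union>y \<in> L +>\<^bsub>K\<^esub> x. N +>\<^bsub>M\<^esub> f y) = (\<Union>y \<in> L +>\<^bsub>K\<^esub> x. N +>\<^bsub>M\<^esub> f x)"
    by (rule SUP_cong[OF refl])
  also have "\<dots> = N +>\<^bsub>M\<^esub> f x"
    using K.coset_self[OF assms(5)] by blast
  finally show ?thesis
    by (simp add: quot_map_def)
qed

lemma quot_map_hom:
  assumes "module R K" "f \<in> mod_hom R K M" "submodule L R K" "f ` L \<subseteq> N"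
  shows "quot_map M N f \<in> mod_hom R (quot_module K L) (quot_module M N)"
proof -
  interpret K: quotient_module R K L
    by (intro quotient_module.intro quotient_module_axioms.intro assms)
  show ?thesis
    by (rule mod_homI)
      (use mod_hom_closed[OF assms(2)] in
       \<open>auto simp: K.quot_carrier quot_carrier quot_map_eq[OF assms] K.quot_add K.quot_smult
         quot_add quot_smult mod_hom_add[OF assms(2)] mod_hom_smult[OF assms(2)]\<close>)
qed

text \<open>Universal property of the quotient. The lift evaluates \<open>f\<close> at a chosen
  element of the coset, and the choice does not matter since \<open>f\<close> vanishes on
  \<open>N\<close>.\<close>

lemma quot_lift:
  assumes "module R K" "f \<in> mod_hom R M K" "\<And>x. x \<in> N \<Longrightarrow> f x = \<zero>\<^bsub>K\<^esub>"
  obtains h where "h \<in> mod_hom R (quot_module M N) K"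
    and "\<And>x. x \<in> carrier M \<Longrightarrow> h (N +>\<^bsub>M\<^esub> x) = f x"
proof -
  interpret K: module R K by fact
  define h where "h Z = f (SOME x. x \<in> Z)" for Z
  have h: "h (N +>\<^bsub>M\<^esub> x) = f x" if x: "x \<in> carrier M" for x
  proof -
    have "(SOME y. y \<in> N +>\<^bsub>M\<^esub> x) \<in> N +>\<^bsub>M\<^esub> x" (is "?y \<in> _")
      by (rule someI, rule coset_self[OF x])
    then have y: "?y \<in> carrier M" "?y \<ominus>\<^bsub>M\<^esub> x \<in> N" using coset_memD x by auto
    then have "f ?y \<ominus>\<^bsub>K\<^esub> f x = \<zero>\<^bsub>K\<^esub>"
      using assms x mod_hom_minus[OF module_axioms assms(1,2), of ?y x] by simp
    then show ?thesis
      unfolding h_def using K.eq_iff_minus y x mod_hom_closed[OF assms(2)] by metis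
  qed
  have "h \<in> mod_hom R (quot_module M N) K"
    by (rule mod_homI)
      (auto simp: quot_carrier quot_add quot_smult h mod_hom_closed[OF assms(2)]
        mod_hom_add[OF assms(2)] mod_hom_smult[OF assms(2)])
  then show ?thesis using h that by blast
qed

end

lemma quotient_moduleI: "module R M \<Longrightarrow> submodule N R M \<Longrightarrow> quotient_module R M N"
  by (intro quotient_module.intro quotient_module_axioms.intro)

text \<open>Cosets depend on the addition alone. Thus Tor classes, defined inside the module of
  cycles, can be written as cosets in the whole tensor product.\<close>

lemma coset_carrier_update [simp]: "N +>\<^bsub>M\<lparr>carrier := H\<rparr>\<^esub> x = N +>\<^bsub>M\<^esub> x"
  by (simp add: a_r_coset_def r_coset_def)

section \<open>Free modules\<close>

lemma free_module_carrier:
  "\<phi> \<in> carrier (free_module R B) \<longleftrightarrow>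
    (\<forall>b. \<phi> b \<in> carrier R) \<and> finite {b. \<phi> b \<noteq> \<zero>\<^bsub>R\<^esub>} \<and> (\<forall>b. \<phi> b \<noteq> \<zero>\<^bsub>R\<^esub> \<longrightarrow> b \<in> B)"
  by (auto simp: free_module_def)

lemma free_moduleD:
  assumes "\<phi> \<in> carrier (free_module R B)"
  shows "\<phi> b \<in> carrier R" "finite {b. \<phi> b \<noteq> \<zero>\<^bsub>R\<^esub>}" "\<phi> b \<noteq> \<zero>\<^bsub>R\<^esub> \<Longrightarrow> b \<in> B"
  using assms unfolding free_module_carrier by blast+

lemma free_module_simps [simp]:
  "\<zero>\<^bsub>free_module R B\<^esub> = (\<lambda>b. \<zero>\<^bsub>R\<^esub>)"
  "\<phi> \<oplus>\<^bsub>free_module R B\<^esub> \<psi> = (\<lambda>b. \<phi> b \<oplus>\<^bsub>R\<^esub> \<psi> b)"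
  "r \<odot>\<^bsub>free_module R B\<^esub> \<phi> = (\<lambda>b. r \<otimes>\<^bsub>R\<^esub> \<phi> b)"
  by (simp_all add: free_module_def)

context cring
begin

lemma free_module_closed:
  assumes "\<And>b. f b \<in> carrier R" "finite S" "\<And>b. f b \<noteq> \<zero> \<Longrightarrow> b \<in> S" "S \<subseteq> B"
  shows "f \<in> carrier (free_module R B)"
proof -
  have "{b. f b \<noteq> \<zero>} \<subseteq> S" using assms(3) by blast
  then show ?thesis
    unfolding free_module_carrier using assms finite_subset[OF _ assms(2)] by blast
qed

lemma free_module_is_module: "module R (free_module R B)"
proof (rule moduleI)
  let ?F = "free_module R B"
  show "abelian_group ?F"
  proof (rule abelian_groupI)
    fix \<phi> \<psi> assume *: "\<phi> \<in> carrier ?F" "\<psi> \<in> carrier ?F"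
    note D = free_moduleD[OF *(1)] free_moduleD[OF *(2)]
    have "(\<lambda>b. \<phi> b \<oplus> \<psi> b) \<in> carrier ?F"
    proof (rule free_module_closed)
      show "finite ({b. \<phi> b \<noteq> \<zero>} \<union> {b. \<psi> b \<noteq> \<zero>})" using D(2,5) by simp
      show "{b. \<phi> b \<noteq> \<zero>} \<union> {b. \<psi> b \<noteq> \<zero>} \<subseteq> B" using D(3,6) by blast
    qed (use D(1,4) in \<open>simp, metis (mono_tags) UnI1 UnI2 mem_Collect_eq r_zero zero_closed\<close>)
    then show "\<phi> \<oplus>\<^bsub>?F\<^esub> \<psi> \<in> carrier ?F" by simp
  next
    fix \<phi> assume *: "\<phi> \<in> carrier ?F"
    note D = free_moduleD[OF *]
    have "(\<lambda>b. \<ominus> \<phi> b) \<in> carrier ?F"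
    proof (rule free_module_closed)
      show "{b. \<phi> b \<noteq> \<zero>} \<subseteq> B" using D(3) by blast
    qed (use D(1,2) in auto)
    then show "\<exists>\<psi>\<in>carrier ?F. \<psi> \<oplus>\<^bsub>?F\<^esub> \<phi> = \<zero>\<^bsub>?F\<^esub>"
      by (rule bexI[rotated]) (simp add: D(1) l_neg)
  next
    fix \<phi> \<psi> \<rho> assume "\<phi> \<in> carrier ?F" "\<psi> \<in> carrier ?F" "\<rho> \<in> carrier ?F"
    then show "\<phi> \<oplus>\<^bsub>?F\<^esub> \<psi> \<oplus>\<^bsub>?F\<^esub> \<rho> = \<phi> \<oplus>\<^bsub>?F\<^esub> (\<psi> \<oplus>\<^bsub>?F\<^esub> \<rho>)"
      by (simp add: free_moduleD(1) a_assoc)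
  next
    fix \<phi> \<psi> assume "\<phi> \<in> carrier ?F" "\<psi> \<in> carrier ?F"
    then show "\<phi> \<oplus>\<^bsub>?F\<^esub> \<psi> = \<psi> \<oplus>\<^bsub>?F\<^esub> \<phi>"
      by (simp add: free_moduleD(1) a_comm)
  next
    show "\<zero>\<^bsub>?F\<^esub> \<in> carrier ?F" by (simp add: free_module_carrier)
  qed (simp add: free_moduleD(1))
next
  let ?F = "free_module R B"
  fix r \<phi> assume *: "r \<in> carrier R" "\<phi> \<in> carrier ?F"
  note D = free_moduleD[OF *(2)]
  have "(\<lambda>b. r \<otimes> \<phi> b) \<in> carrier ?F"
  proof (rule free_module_closed)
    show "{b. \<phi> b \<noteq> \<zero>} \<subseteq> B" using D(3) by blast
  qed (use D(1,2) *(1) in auto)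
  then show "r \<odot>\<^bsub>?F\<^esub> \<phi> \<in> carrier ?F" by simp
qed (simp_all add: free_moduleD(1) l_distr r_distr m_assoc is_cring)

lemma free_gen_carrier: "b \<in> B \<Longrightarrow> free_gen R b \<in> carrier (free_module R B)"
  by (rule free_module_closed[of _ "{b}"]) (auto simp: free_gen_def split: if_splits)

text \<open>Induction on the size of the support. Only sums and multiples of basis elements have to
  be treated, since one coefficient can be split off at a time.\<close>

lemma free_module_induct [consumes 1, case_names zero add gen]:
  assumes "\<phi> \<in> carrier (free_module R B)"
    and zero: "P (\<lambda>b. \<zero>)"
    and add: "\<And>\<phi> \<psi>. \<phi> \<in> carrier (free_module R B) \<Longrightarrow> \<psi> \<in> carrier (free_module R B) \<Longrightarrow>
      P \<phi> \<Longrightarrow> P \<psi> \<Longrightarrow> P (\<phi> \<oplus>\<^bsub>free_module R B\<^esub> \<psi>)"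
    and gen: "\<And>r b. r \<in> carrier R \<Longrightarrow> b \<in> B \<Longrightarrow> P (r \<odot>\<^bsub>free_module R B\<^esub> free_gen R b)"
  shows "P \<phi>"
proof -
  let ?F = "free_module R B"
  interpret F: module R ?F by (rule free_module_is_module)
  have "finite S \<Longrightarrow> \<phi> \<in> carrier (?F) \<Longrightarrow> {b. \<phi> b \<noteq> \<zero>} = S \<Longrightarrow> P \<phi>" for S \<phi>
  proof (induction S arbitrary: \<phi> rule: finite_induct)
    case empty
    then have "\<phi> = (\<lambda>b. \<zero>)" by auto
    then show ?case using zero by simp
  next
    case (insert b S)
    let ?\<psi> = "\<phi>(b := \<zero>)"
    have 1: "?\<psi> \<in> carrier (?F)"
      by (rule free_module_closed[OF _ insert.hyps(1)])
        (use insert.prems free_moduleD[OF insert.prems(1)] in \<open>auto split: if_splits\<close>)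
    have 2: "{c. ?\<psi> c \<noteq> \<zero>} = S" using insert.prems insert.hyps by auto
    have b: "\<phi> b \<in> carrier R" "b \<in> B" using insert.prems free_moduleD[OF insert.prems(1)] by auto
    have eq: "\<phi> = ?\<psi> \<oplus>\<^bsub>?F\<^esub> (\<phi> b \<odot>\<^bsub>?F\<^esub> free_gen R b)"
    proof
      fix c
      have "\<phi> c \<in> carrier R" using insert.prems(1) by (simp add: free_module_carrier)
      then show "\<phi> c = (?\<psi> \<oplus>\<^bsub>?F\<^esub> (\<phi> b \<odot>\<^bsub>?F\<^esub> free_gen R b)) c"
        using b by (simp add: free_gen_def)
    qed
    have "P (?\<psi> \<oplus>\<^bsub>?F\<^esub> (\<phi> b \<odot>\<^bsub>?F\<^esub> free_gen R b))"
      by (rule add[OF 1 _ insert.IH[OF 1 2] gen[OF b]]) (rule F.smult_closed[OF b(1) free_gen_carrier[OF b(2)]])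
    then show ?case by (rule ssubst[OF eq])
  qed
  moreover have "finite {b. \<phi> b \<noteq> \<zero>}" using assms(1) unfolding free_module_carrier by blast
  ultimately show ?thesis using assms(1) by blast
qed

text \<open>\<open>free_map\<close> sums over the support of its argument, which varies with the
  argument. A larger finite set \<open>S\<close> only adds zeros, so two vectors can be summed over
  a common set when additivity is proved.\<close>

lemma free_map_alt:
  assumes "\<phi> \<in> carrier (free_module R B)" "finite S" "{b. \<phi> b \<noteq> \<zero>} \<subseteq> S"
  shows "free_map R h \<phi> c = (\<Oplus>b\<in>{b\<in>S. h b = c}. \<phi> b)"
  unfolding free_map_def
proof (rule add.finprod_mono_neutral_cong_left)
  show "{b. \<phi> b \<noteq> \<zero> \<and> h b = c} \<subseteq> {b \<in> S. h b = c}" using assms(3) by blast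
qed (use assms(2) in \<open>auto simp: free_moduleD(1)[OF assms(1)]\<close>)

lemma free_map_hom:
  assumes "\<And>b. b \<in> B \<Longrightarrow> h b \<in> C"
  shows "free_map R h \<in> mod_hom R (free_module R B) (free_module R C)"
proof (rule mod_homI)
  let ?F = "free_module R B" and ?C = "free_module R C"
  interpret F: module R ?F by (rule free_module_is_module)
  fix \<phi> assume \<phi>: "\<phi> \<in> carrier ?F"
  note D = free_moduleD[OF \<phi>]
  have "free_map R h \<phi> c = \<zero>" if "c \<notin> h ` {b. \<phi> b \<noteq> \<zero>}" for c
  proof -
    have "{b. \<phi> b \<noteq> \<zero> \<and> h b = c} = {}" using that by blast
    then show ?thesis by (simp only: free_map_def finsum_empty)
  qed
  then have 1: "{c. free_map R h \<phi> c \<noteq> \<zero>} \<subseteq> h ` {b. \<phi> b \<noteq> \<zero>}" by blast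
  have 2: "finite (h ` {b. \<phi> b \<noteq> \<zero>})"
    by (rule finite_imageI[OF D(2)])
  have 3: "h ` {b. \<phi> b \<noteq> \<zero>} \<subseteq> C"
    using D(3) assms by blast
  have 4: "free_map R h \<phi> c \<in> carrier R" for c
    unfolding free_map_def by (rule finsum_closed) (simp add: D)
  show "free_map R h \<phi> \<in> carrier (free_module R C)"
    unfolding free_module_carrier using 1 3 4 finite_subset[OF 1 2] by blast
  show "free_map R h (r \<odot>\<^bsub>?F\<^esub> \<phi>) = r \<odot>\<^bsub>?C\<^esub> free_map R h \<phi>" if r: "r \<in> carrier R" for r
  proof
    fix c
    have "(r \<odot>\<^bsub>?F\<^esub> \<phi>) \<in> carrier ?F" by (rule F.smult_closed[OF r \<phi>])
    moreover have "{b. (r \<odot>\<^bsub>?F\<^esub> \<phi>) b \<noteq> \<zero>} \<subseteq> {b. \<phi> b \<noteq> \<zero>}" using r by (simp add: subset_iff) (metis r_null)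
    ultimately have "free_map R h (r \<odot>\<^bsub>?F\<^esub> \<phi>) c = (\<Oplus>b\<in>{b\<in>{b. \<phi> b \<noteq> \<zero>}. h b = c}. (r \<odot>\<^bsub>?F\<^esub> \<phi>) b)"
      by (rule free_map_alt[OF _ D(2)])
    also have "\<dots> = (\<Oplus>b\<in>{b\<in>{b. \<phi> b \<noteq> \<zero>}. h b = c}. r \<otimes> \<phi> b)" by simp
    also have "\<dots> = r \<otimes> (\<Oplus>b\<in>{b\<in>{b. \<phi> b \<noteq> \<zero>}. h b = c}. \<phi> b)"
      by (rule finsum_rdistr[symmetric]) (use D r in simp_all)
    also have "\<dots> = r \<otimes> free_map R h \<phi> c"
      by (simp add: free_map_alt[OF \<phi> D(2) subset_refl])
    finally show "free_map R h (r \<odot>\<^bsub>?F\<^esub> \<phi>) c = (r \<odot>\<^bsub>?C\<^esub> free_map R h \<phi>) c" by simp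
  qed
  fix \<psi> assume \<psi>: "\<psi> \<in> carrier ?F"
  note D' = free_moduleD[OF \<psi>]
  show "free_map R h (\<phi> \<oplus>\<^bsub>?F\<^esub> \<psi>) = free_map R h \<phi> \<oplus>\<^bsub>?C\<^esub> free_map R h \<psi>"
  proof
    fix c
    define S where "S = {b. \<phi> b \<noteq> \<zero>} \<union> {b. \<psi> b \<noteq> \<zero>}"
    have S: "finite S" "{b. \<phi> b \<noteq> \<zero>} \<subseteq> S" "{b. \<psi> b \<noteq> \<zero>} \<subseteq> S" using D(2) D'(2) by (auto simp: S_def)
    have "{b. (\<phi> \<oplus>\<^bsub>?F\<^esub> \<psi>) b \<noteq> \<zero>} \<subseteq> S" by (simp add: S_def subset_iff) (metis r_zero zero_closed)
    then have "free_map R h (\<phi> \<oplus>\<^bsub>?F\<^esub> \<psi>) c = (\<Oplus>b\<in>{b\<in>S. h b = c}. (\<phi> \<oplus>\<^bsub>?F\<^esub> \<psi>) b)"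
      by (rule free_map_alt[OF F.a_closed[OF \<phi> \<psi>] S(1)])
    also have "\<dots> = (\<Oplus>b\<in>{b\<in>S. h b = c}. \<phi> b) \<oplus> (\<Oplus>b\<in>{b\<in>S. h b = c}. \<psi> b)"
      by (simp add: finsum_addf D D')
    also have "\<dots> = free_map R h \<phi> c \<oplus> free_map R h \<psi> c"
      by (simp only: free_map_alt[OF \<phi> S(1,2), of h c] free_map_alt[OF \<psi> S(1,3), of h c])
    finally show "free_map R h (\<phi> \<oplus>\<^bsub>?F\<^esub> \<psi>) c
        = (free_map R h \<phi> \<oplus>\<^bsub>?C\<^esub> free_map R h \<psi>) c" by simp
  qed
qed

lemma free_map_gen: "free_map R h (free_gen R b) = free_gen R (h b)"
proof
  fix c
  have "free_gen R b \<in> carrier (free_module R UNIV)" by (rule free_gen_carrier) simp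
  then have "free_map R h (free_gen R b) c = (\<Oplus>a\<in>{a\<in>{b}. h a = c}. free_gen R b a)"
    by (rule free_map_alt) (auto simp: free_gen_def)
  also have "{a\<in>{b}. h a = c} = (if h b = c then {b} else {})" by auto
  finally show "free_map R h (free_gen R b) c = free_gen R (h b) c"
    by (auto simp: free_gen_def)
qed

end

text \<open>Universal property of the free module, by linear extension. The inner fact
  \<open>alt\<close> replaces the support by any finite subset of the basis containing it, again to
  compare vectors with different supports.\<close>

lemma (in module) free_module_lift:
  assumes f: "\<And>b. b \<in> B \<Longrightarrow> f b \<in> carrier M"
  obtains h where "h \<in> mod_hom R (free_module R B) M"
    and "\<And>b. b \<in> B \<Longrightarrow> h (free_gen R b) = f b"
proof
  let ?F = "free_module R B"
  interpret F: module R ?F by (rule free_module_is_module)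
  define h where "h \<phi> = (\<Oplus>\<^bsub>M\<^esub> b\<in>{b. \<phi> b \<noteq> \<zero>}. \<phi> b \<odot>\<^bsub>M\<^esub> f b)" for \<phi>
  have closed: "(\<lambda>b. \<phi> b \<odot>\<^bsub>M\<^esub> f b) \<in> S \<rightarrow> carrier M" if "\<phi> \<in> carrier ?F" "S \<subseteq> B" for \<phi> S
    using that(2) f free_moduleD(1)[OF that(1)] by (simp add: Pi_iff subset_iff)
  have alt: "h \<phi> = (\<Oplus>\<^bsub>M\<^esub> b\<in>S. \<phi> b \<odot>\<^bsub>M\<^esub> f b)"
    if "\<phi> \<in> carrier ?F" "finite S" "{b. \<phi> b \<noteq> \<zero>} \<subseteq> S" "S \<subseteq> B" for \<phi> S
    unfolding h_def
    by (rule M.add.finprod_mono_neutral_cong_left)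
      (use that f closed in \<open>simp_all add: subset_iff\<close>)
  show "h \<in> mod_hom R ?F M"
  proof (rule mod_homI)
    fix \<phi> assume \<phi>: "\<phi> \<in> carrier ?F"
    note D = free_moduleD[OF \<phi>]
    have supp: "{b. \<phi> b \<noteq> \<zero>} \<subseteq> B" using D(3) by blast
    show "h \<phi> \<in> carrier M"
      unfolding h_def by (rule M.finsum_closed[OF closed[OF \<phi> supp]])
    show "h (r \<odot>\<^bsub>?F\<^esub> \<phi>) = r \<odot>\<^bsub>M\<^esub> h \<phi>" if r: "r \<in> carrier R" for r
    proof -
      have "{b. (r \<odot>\<^bsub>?F\<^esub> \<phi>) b \<noteq> \<zero>} \<subseteq> {b. \<phi> b \<noteq> \<zero>}"
        using r by (simp add: subset_iff) (metis R.r_null)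
      then have "h (r \<odot>\<^bsub>?F\<^esub> \<phi>) = (\<Oplus>\<^bsub>M\<^esub> b\<in>{b. \<phi> b \<noteq> \<zero>}. (r \<odot>\<^bsub>?F\<^esub> \<phi>) b \<odot>\<^bsub>M\<^esub> f b)"
        by (rule alt[OF F.smult_closed[OF r \<phi>] D(2) _ supp])
      also have "\<dots> = (\<Oplus>\<^bsub>M\<^esub> b\<in>{b. \<phi> b \<noteq> \<zero>}. r \<odot>\<^bsub>M\<^esub> (\<phi> b \<odot>\<^bsub>M\<^esub> f b))"
        by (rule M.finsum_cong')
          (use r D f in \<open>simp_all add: smult_assoc1 Pi_iff\<close>)
      also have "\<dots> = r \<odot>\<^bsub>M\<^esub> h \<phi>"
        unfolding h_def by (rule finsum_smult_ldistr[OF D(2) r closed[OF \<phi> supp], symmetric])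
      finally show ?thesis .
    qed
    fix \<psi> assume \<psi>: "\<psi> \<in> carrier ?F"
    note D' = free_moduleD[OF \<psi>]
    define S where "S = {b. \<phi> b \<noteq> \<zero>} \<union> {b. \<psi> b \<noteq> \<zero>}"
    have S: "finite S" "{b. \<phi> b \<noteq> \<zero>} \<subseteq> S" "{b. \<psi> b \<noteq> \<zero>} \<subseteq> S" "S \<subseteq> B"
      using D(2,3) D'(2,3) by (auto simp: S_def)
    have "{b. (\<phi> \<oplus>\<^bsub>?F\<^esub> \<psi>) b \<noteq> \<zero>} \<subseteq> S"
      by (simp add: S_def subset_iff) (metis R.r_zero R.zero_closed)
    then have "h (\<phi> \<oplus>\<^bsub>?F\<^esub> \<psi>) = (\<Oplus>\<^bsub>M\<^esub> b\<in>S. (\<phi> \<oplus>\<^bsub>?F\<^esub> \<psi>) b \<odot>\<^bsub>M\<^esub> f b)"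
      by (rule alt[OF F.a_closed[OF \<phi> \<psi>] S(1) _ S(4)])
    also have "\<dots> = (\<Oplus>\<^bsub>M\<^esub> b\<in>S. \<phi> b \<odot>\<^bsub>M\<^esub> f b \<oplus>\<^bsub>M\<^esub> \<psi> b \<odot>\<^bsub>M\<^esub> f b)"
      by (rule M.finsum_cong')
        (use S(4) f D(1) D'(1) in \<open>simp_all add: smult_l_distr Pi_iff subset_iff\<close>)
    also have "\<dots> = (\<Oplus>\<^bsub>M\<^esub> b\<in>S. \<phi> b \<odot>\<^bsub>M\<^esub> f b) \<oplus>\<^bsub>M\<^esub> (\<Oplus>\<^bsub>M\<^esub> b\<in>S. \<psi> b \<odot>\<^bsub>M\<^esub> f b)"
      by (rule M.finsum_addf[OF closed[OF \<phi> S(4)] closed[OF \<psi> S(4)]])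
    also have "\<dots> = h \<phi> \<oplus>\<^bsub>M\<^esub> h \<psi>"
      by (simp only: alt[OF \<phi> S(1,2,4)] alt[OF \<psi> S(1,3,4)])
    finally show "h (\<phi> \<oplus>\<^bsub>?F\<^esub> \<psi>) = h \<phi> \<oplus>\<^bsub>M\<^esub> h \<psi>" .
  qed
  show "h (free_gen R b) = f b" if b: "b \<in> B" for b
  proof -
    have "{c. free_gen R b c \<noteq> \<zero>} \<subseteq> {b}" by (auto simp: free_gen_def)
    from alt[OF free_gen_carrier[OF b] _ this] have "h (free_gen R b) = (\<Oplus>\<^bsub>M\<^esub> c\<in>{b}. free_gen R b c \<odot>\<^bsub>M\<^esub> f c)"
      by (simp add: b)
    also have "\<dots> = f b" using f[OF b] by (simp add: free_gen_def)
    finally show ?thesis .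
  qed
qed

lemma (in module)
  assumes "S \<subseteq> carrier M"
  shows submodule_span_submodule: "submodule (submodule_span R M S) R M"
    and submodule_span_superset: "S \<subseteq> submodule_span R M S"
proof -
  have "carrier M \<in> {H. submodule H R M \<and> S \<subseteq> H}"
    using assms carrier_is_submodule by simp
  then have "submodule_span R M S \<subseteq> carrier M"
    unfolding submodule_span_def by blast
  then show "submodule (submodule_span R M S) R M"
  proof (rule submodule_intro)
    show "\<zero>\<^bsub>M\<^esub> \<in> submodule_span R M S"
      using submodule_zero unfolding submodule_span_def by blast
  next
    fix x y assume "x \<in> submodule_span R M S" "y \<in> submodule_span R M S"
    then show "x \<oplus>\<^bsub>M\<^esub> y \<in> submodule_span R M S"
      unfolding submodule_span_def by (simp add: submoduleE(5))
  next
    fix a x assume "a \<in> carrier R" "x \<in> submodule_span R M S"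
    then show "a \<odot>\<^bsub>M\<^esub> x \<in> submodule_span R M S"
      unfolding submodule_span_def by (simp add: submoduleE(4))
  qed
  show "S \<subseteq> submodule_span R M S"
    unfolding submodule_span_def by blast
qed

lemma submodule_span_least: "submodule H R M \<Longrightarrow> S \<subseteq> H \<Longrightarrow> submodule_span R M S \<subseteq> H"
  unfolding submodule_span_def by blast

section \<open>Tensor products\<close>

text \<open>The generating set inside \<open>tensor_rel\<close>, given a name so that membership of
  a relator and minimality of the span can be used separately.\<close>

definition tensor_relators ::
    "('r, 'x) ring_scheme \<Rightarrow> ('r, 'm, 'y) module_scheme \<Rightarrow> ('r, 'k, 'z) module_scheme
      \<Rightarrow> ('m \<times> 'k \<Rightarrow> 'r) set"
  where
  "tensor_relators R M N = (let T = tensor_free R M N; g = free_gen R in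
       ({g (x \<oplus>\<^bsub>M\<^esub> x', y) \<ominus>\<^bsub>T\<^esub> (g (x, y) \<oplus>\<^bsub>T\<^esub> g (x', y)) | x x' y.
           x \<in> carrier M \<and> x' \<in> carrier M \<and> y \<in> carrier N} \<union>
        {g (x, y \<oplus>\<^bsub>N\<^esub> y') \<ominus>\<^bsub>T\<^esub> (g (x, y) \<oplus>\<^bsub>T\<^esub> g (x, y')) | x y y'.
           x \<in> carrier M \<and> y \<in> carrier N \<and> y' \<in> carrier N} \<union>
        {g (r \<odot>\<^bsub>M\<^esub> x, y) \<ominus>\<^bsub>T\<^esub> (r \<odot>\<^bsub>T\<^esub> g (x, y)) | r x y.
           r \<in> carrier R \<and> x \<in> carrier M \<and> y \<in> carrier N} \<union>
        {g (x, r \<odot>\<^bsub>N\<^esub> y) \<ominus>\<^bsub>T\<^esub> (r \<odot>\<^bsub>T\<^esub> g (x, y)) | r x y.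
           r \<in> carrier R \<and> x \<in> carrier M \<and> y \<in> carrier N}))"

lemma tensor_rel_span: "tensor_rel R M N = submodule_span R (tensor_free R M N) (tensor_relators R M N)"
  unfolding tensor_rel_def tensor_relators_def Let_def ..

locale module_pair = M: module R M + N: module R N for R (structure) and M and N
begin

abbreviation "T \<equiv> tensor_free R M N"
abbreviation "K \<equiv> tensor_rel R M N"
abbreviation "gen \<equiv> free_gen R :: 'c \<times> 'e \<Rightarrow> 'c \<times> 'e \<Rightarrow> 'a"
abbreviation "ten x y \<equiv> pure_tensor R M N x y"

sublocale T: module R T
  unfolding tensor_free_def by (rule M.free_module_is_module)

lemma gen_closed: "x \<in> carrier M \<Longrightarrow> y \<in> carrier N \<Longrightarrow> gen (x, y) \<in> carrier T"
  unfolding tensor_free_def by (rule M.free_gen_carrier) simp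

lemma relators_subset: "tensor_relators R M N \<subseteq> carrier T"
  unfolding tensor_relators_def Let_def
  by (auto intro!: gen_closed T.minus_closed T.M.a_closed T.smult_closed M.M.a_closed N.M.a_closed
      M.smult_closed N.smult_closed simp del: free_module_simps)

lemma K_submodule: "submodule K R T"
  unfolding tensor_rel_span by (rule T.submodule_span_submodule[OF relators_subset])

sublocale Q: quotient_module R T K
  by (rule quotient_moduleI[OF T.module_axioms K_submodule])

lemma relator_in_K: "z \<in> tensor_relators R M N \<Longrightarrow> z \<in> K"
  unfolding tensor_rel_span using T.submodule_span_superset[OF relators_subset] by blast

lemma tensor_is_module: "module R (tensor R M N)"
  unfolding tensor_def by (rule Q.quot_is_module)

lemma ten_eq: "ten x y = K +>\<^bsub>T\<^esub> gen (x, y)"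
  by (simp add: pure_tensor_def)

lemma ten_closed: "x \<in> carrier M \<Longrightarrow> y \<in> carrier N \<Longrightarrow> ten x y \<in> carrier (tensor R M N)"
  unfolding tensor_def ten_eq Q.quot_carrier using gen_closed by blast

text \<open>Every relator is a basis element minus the expression it is to be identified with, so
  that lying in \<open>K\<close> amounts to an equality of cosets. The four laws of bilinearity
  below are instances.\<close>

lemma relator_coset_eq:
  assumes "gen b \<ominus>\<^bsub>T\<^esub> t \<in> tensor_relators R M N" "gen b \<in> carrier T" "t \<in> carrier T"
  shows "K +>\<^bsub>T\<^esub> gen b = K +>\<^bsub>T\<^esub> t"
  using relator_in_K[OF assms(1)] assms(2,3) by (simp add: Q.coset_eq_iff)

lemma ten_add_left:
  assumes "x \<in> carrier M" "x' \<in> carrier M" "y \<in> carrier N"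
  shows "ten (x \<oplus>\<^bsub>M\<^esub> x') y = ten x y \<oplus>\<^bsub>tensor R M N\<^esub> ten x' y"
  unfolding ten_eq tensor_def using assms gen_closed
  by (subst relator_coset_eq[of _ "gen (x, y) \<oplus>\<^bsub>T\<^esub> gen (x', y)"])
    (simp_all add: Q.quot_add, unfold tensor_relators_def Let_def, blast)

lemma ten_add_right:
  assumes "x \<in> carrier M" "y \<in> carrier N" "y' \<in> carrier N"
  shows "ten x (y \<oplus>\<^bsub>N\<^esub> y') = ten x y \<oplus>\<^bsub>tensor R M N\<^esub> ten x y'"
  unfolding ten_eq tensor_def using assms gen_closed
  by (subst relator_coset_eq[of _ "gen (x, y) \<oplus>\<^bsub>T\<^esub> gen (x, y')"])
    (simp_all add: Q.quot_add, unfold tensor_relators_def Let_def, blast)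

lemma ten_smult_left:
  assumes "r \<in> carrier R" "x \<in> carrier M" "y \<in> carrier N"
  shows "ten (r \<odot>\<^bsub>M\<^esub> x) y = r \<odot>\<^bsub>tensor R M N\<^esub> ten x y"
  unfolding ten_eq tensor_def using assms gen_closed
  by (subst relator_coset_eq[of _ "r \<odot>\<^bsub>T\<^esub> gen (x, y)"])
    (simp_all add: Q.quot_smult, unfold tensor_relators_def Let_def, blast)

lemma ten_smult_right:
  assumes "r \<in> carrier R" "x \<in> carrier M" "y \<in> carrier N"
  shows "ten x (r \<odot>\<^bsub>N\<^esub> y) = r \<odot>\<^bsub>tensor R M N\<^esub> ten x y"
  unfolding ten_eq tensor_def using assms gen_closed
  by (subst relator_coset_eq[of _ "r \<odot>\<^bsub>T\<^esub> gen (x, y)"])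
    (simp_all add: Q.quot_smult, unfold tensor_relators_def Let_def, blast)

lemma ten_smult_swap:
  "r \<in> carrier R \<Longrightarrow> x \<in> carrier M \<Longrightarrow> y \<in> carrier N \<Longrightarrow> ten (r \<odot>\<^bsub>M\<^esub> x) y = ten x (r \<odot>\<^bsub>N\<^esub> y)"
  by (simp add: ten_smult_left ten_smult_right)

lemma ten_zero_right: "x \<in> carrier M \<Longrightarrow> ten x \<zero>\<^bsub>N\<^esub> = \<zero>\<^bsub>tensor R M N\<^esub>"
proof -
  interpret TT: module R "tensor R M N" by (rule tensor_is_module)
  assume x: "x \<in> carrier M"
  have "ten x \<zero>\<^bsub>N\<^esub> = ten x (\<zero> \<odot>\<^bsub>N\<^esub> \<zero>\<^bsub>N\<^esub>)" by simp
  also have "\<dots> = \<zero> \<odot>\<^bsub>tensor R M N\<^esub> ten x \<zero>\<^bsub>N\<^esub>" by (rule ten_smult_right) (simp_all add: x)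
  also have "\<dots> = \<zero>\<^bsub>tensor R M N\<^esub>" by (rule TT.smult_l_null, rule ten_closed) (simp_all add: x)
  finally show ?thesis .
qed

lemma ten_zero_left: "y \<in> carrier N \<Longrightarrow> ten \<zero>\<^bsub>M\<^esub> y = \<zero>\<^bsub>tensor R M N\<^esub>"
proof -
  assume y: "y \<in> carrier N"
  have "ten \<zero>\<^bsub>M\<^esub> y = ten (\<zero> \<odot>\<^bsub>M\<^esub> \<zero>\<^bsub>M\<^esub>) y" by simp
  also have "\<dots> = ten \<zero>\<^bsub>M\<^esub> (\<zero> \<odot>\<^bsub>N\<^esub> y)" by (rule ten_smult_swap) (simp_all add: y)
  also have "\<dots> = \<zero>\<^bsub>tensor R M N\<^esub>" using y by (simp add: ten_zero_right)
  finally show ?thesis .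
qed

lemma ten_neg_left:
  assumes "x \<in> carrier M" "y \<in> carrier N"
  shows "ten (\<ominus>\<^bsub>M\<^esub> x) y = \<ominus>\<^bsub>tensor R M N\<^esub> ten x y"
proof -
  interpret TT: module R "tensor R M N" by (rule tensor_is_module)
  have "ten (\<ominus>\<^bsub>M\<^esub> x) y = ten ((\<ominus> \<one>) \<odot>\<^bsub>M\<^esub> x) y"
    using assms by (simp add: M.smult_l_minus)
  also have "\<dots> = (\<ominus> \<one>) \<odot>\<^bsub>tensor R M N\<^esub> ten x y" using assms by (simp add: ten_smult_left)
  also have "\<dots> = \<ominus>\<^bsub>tensor R M N\<^esub> ten x y"
    using ten_closed[OF assms] by (simp add: TT.smult_l_minus)
  finally show ?thesis .
qed

lemma ten_minus_left:
  assumes "x \<in> carrier M" "x' \<in> carrier M" "y \<in> carrier N"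
  shows "ten (x \<ominus>\<^bsub>M\<^esub> x') y = ten x y \<ominus>\<^bsub>tensor R M N\<^esub> ten x' y"
  using assms by (simp add: a_minus_def ten_add_left ten_neg_left)

text \<open>There is no case for scalars: in a multiple of a pure tensor by \<open>r\<close> the
  scalar can be absorbed into the left factor, so sums of pure tensors exhaust the tensor
  product.\<close>

lemma tensor_induct [consumes 1, case_names zero add ten]:
  assumes "z \<in> carrier (tensor R M N)"
    and zero: "P \<zero>\<^bsub>tensor R M N\<^esub>"
    and add: "\<And>z z'. z \<in> carrier (tensor R M N) \<Longrightarrow> z' \<in> carrier (tensor R M N) \<Longrightarrow>
      P z \<Longrightarrow> P z' \<Longrightarrow> P (z \<oplus>\<^bsub>tensor R M N\<^esub> z')"
    and ten: "\<And>x y. x \<in> carrier M \<Longrightarrow> y \<in> carrier N \<Longrightarrow> P (ten x y)"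
  shows "P z"
proof -
  obtain \<phi> where \<phi>: "\<phi> \<in> carrier T" "z = K +>\<^bsub>T\<^esub> \<phi>"
    using assms(1) unfolding tensor_def Q.quot_carrier by blast
  from \<phi>(1) have "P (K +>\<^bsub>T\<^esub> \<phi>)"
  proof (induction rule: M.free_module_induct[where B = "carrier M \<times> carrier N", folded tensor_free_def[of R M N], consumes 1, case_names zero add gen])
    case zero
    have "K +>\<^bsub>T\<^esub> \<zero>\<^bsub>T\<^esub> = K" using Q.coset_zero_iff Q.N_zero by simp
    moreover have "\<zero>\<^bsub>T\<^esub> = (\<lambda>b. \<zero>)" by (simp add: tensor_free_def)
    ultimately show ?case using assms(2) by (simp add: tensor_def Q.quot_zero)
  next
    case (add \<phi> \<psi>)
    then show ?case
      using assms(3)[of "K +>\<^bsub>T\<^esub> \<phi>" "K +>\<^bsub>T\<^esub> \<psi>"]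
      unfolding tensor_def Q.quot_carrier
      by (simp only: Q.quot_add image_eqI[OF refl])
  next
    case (gen r b)
    obtain x y where b: "b = (x, y)" "x \<in> carrier M" "y \<in> carrier N" using gen by auto
    have "K +>\<^bsub>T\<^esub> (r \<odot>\<^bsub>T\<^esub> gen b) = ten (r \<odot>\<^bsub>M\<^esub> x) y"
      using b gen gen_closed by (simp only: ten_smult_left) (simp only: ten_eq tensor_def Q.quot_smult)
    then show ?case using assms(4)[of "r \<odot>\<^bsub>M\<^esub> x" y] b gen by simp
  qed
  then show ?thesis using \<phi> by simp
qed

lemma tensor_hom_eqI:
  assumes "module R L" "f \<in> mod_hom R (tensor R M N) L" "g \<in> mod_hom R (tensor R M N) L"
    and "\<And>x y. x \<in> carrier M \<Longrightarrow> y \<in> carrier N \<Longrightarrow> f (ten x y) = g (ten x y)"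
    and "z \<in> carrier (tensor R M N)"
  shows "f z = g z"
  using assms(5)
proof (induction rule: tensor_induct)
  case zero
  show ?case using mod_hom_zero[OF tensor_is_module assms(1)] assms(2,3) by metis
next
  case (add z z')
  then show ?case using assms by (simp add: mod_hom_add)
qed (rule assms(4))

text \<open>The preimage of \<open>H\<close> is a submodule, so it contains the span as soon as it
  contains the relators. It is used with \<open>H\<close> zero to descend a bilinear map, and with
  \<open>H\<close> the relations of another tensor product to obtain functoriality.\<close>

lemma K_least:
  assumes "module R L" "h \<in> mod_hom R T L" "submodule H R L"
    and "\<And>x x' y. x \<in> carrier M \<Longrightarrow> x' \<in> carrier M \<Longrightarrow> y \<in> carrier N \<Longrightarrow>
      h (gen (x \<oplus>\<^bsub>M\<^esub> x', y)) \<ominus>\<^bsub>L\<^esub> (h (gen (x, y)) \<oplus>\<^bsub>L\<^esub> h (gen (x', y))) \<in> H"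
    and "\<And>x y y'. x \<in> carrier M \<Longrightarrow> y \<in> carrier N \<Longrightarrow> y' \<in> carrier N \<Longrightarrow>
      h (gen (x, y \<oplus>\<^bsub>N\<^esub> y')) \<ominus>\<^bsub>L\<^esub> (h (gen (x, y)) \<oplus>\<^bsub>L\<^esub> h (gen (x, y'))) \<in> H"
    and "\<And>r x y. r \<in> carrier R \<Longrightarrow> x \<in> carrier M \<Longrightarrow> y \<in> carrier N \<Longrightarrow>
      h (gen (r \<odot>\<^bsub>M\<^esub> x, y)) \<ominus>\<^bsub>L\<^esub> (r \<odot>\<^bsub>L\<^esub> h (gen (x, y))) \<in> H"
    and "\<And>r x y. r \<in> carrier R \<Longrightarrow> x \<in> carrier M \<Longrightarrow> y \<in> carrier N \<Longrightarrow>
      h (gen (x, r \<odot>\<^bsub>N\<^esub> y)) \<ominus>\<^bsub>L\<^esub> (r \<odot>\<^bsub>L\<^esub> h (gen (x, y))) \<in> H"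
  shows "h ` K \<subseteq> H"
proof -
  interpret L: module R L by fact
  let ?H = "{z \<in> carrier T. h z \<in> H}"
  have sub: "submodule ?H R T"
    by (rule T.submodule_intro)
      (use assms(1-3) L.submodule_zero[OF assms(3)] L.submoduleE[OF assms(3)] T.module_axioms in
       \<open>simp_all add: mod_hom_zero mod_hom_add mod_hom_smult subset_iff\<close>)
  have "tensor_relators R M N \<subseteq> ?H"
  proof
    fix z assume z: "z \<in> tensor_relators R M N"
    then have "z \<in> carrier T" using relators_subset by blast
    moreover have "h z \<in> H"
      using z assms(4-7) T.module_axioms assms(1,2) gen_closed
      unfolding tensor_relators_def Let_def Un_iff mem_Collect_eq
      by (elim disjE exE conjE)
        (simp_all add: mod_hom_minus mod_hom_add mod_hom_smult)
    ultimately show "z \<in> ?H" by simp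
  qed
  from submodule_span_least[OF sub this] show ?thesis unfolding tensor_rel_span by blast
qed

text \<open>Universal property of the tensor product. The linear extension of \<open>f\<close> to
  the free module on all pairs kills the four families of relators precisely because
  \<open>f\<close> is bilinear.\<close>

lemma tensor_lift:
  assumes "module R L"
    and closed: "\<And>x y. x \<in> carrier M \<Longrightarrow> y \<in> carrier N \<Longrightarrow> f x y \<in> carrier L"
    and "\<And>x x' y. x \<in> carrier M \<Longrightarrow> x' \<in> carrier M \<Longrightarrow> y \<in> carrier N \<Longrightarrow>
      f (x \<oplus>\<^bsub>M\<^esub> x') y = f x y \<oplus>\<^bsub>L\<^esub> f x' y"
    and "\<And>x y y'. x \<in> carrier M \<Longrightarrow> y \<in> carrier N \<Longrightarrow> y' \<in> carrier N \<Longrightarrow>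
      f x (y \<oplus>\<^bsub>N\<^esub> y') = f x y \<oplus>\<^bsub>L\<^esub> f x y'"
    and "\<And>r x y. r \<in> carrier R \<Longrightarrow> x \<in> carrier M \<Longrightarrow> y \<in> carrier N \<Longrightarrow>
      f (r \<odot>\<^bsub>M\<^esub> x) y = r \<odot>\<^bsub>L\<^esub> f x y"
    and "\<And>r x y. r \<in> carrier R \<Longrightarrow> x \<in> carrier M \<Longrightarrow> y \<in> carrier N \<Longrightarrow>
      f x (r \<odot>\<^bsub>N\<^esub> y) = r \<odot>\<^bsub>L\<^esub> f x y"
  obtains h where "h \<in> mod_hom R (tensor R M N) L"
    and "\<And>x y. x \<in> carrier M \<Longrightarrow> y \<in> carrier N \<Longrightarrow> h (ten x y) = f x y"
proof -
  interpret L: module R L by fact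
  obtain k where k: "k \<in> mod_hom R T L"
    and k_gen: "\<And>b. b \<in> carrier M \<times> carrier N \<Longrightarrow> k (gen b) = (case b of (x, y) \<Rightarrow> f x y)"
    using L.free_module_lift[of "carrier M \<times> carrier N" "\<lambda>(x, y). f x y"] closed
    unfolding tensor_free_def by auto
  have "k ` K \<subseteq> {\<zero>\<^bsub>L\<^esub>}"
  proof (rule K_least[OF assms(1) k])
    show "submodule {\<zero>\<^bsub>L\<^esub>} R L" by (rule L.submodule_intro) auto
  qed (use assms closed in \<open>simp_all add: k_gen a_minus_def L.M.r_neg\<close>)
  then have "\<And>z. z \<in> K \<Longrightarrow> k z = \<zero>\<^bsub>L\<^esub>" by blast
  from Q.quot_lift[OF assms(1) k this] obtain h
    where h: "h \<in> mod_hom R (quot_module T K) L" "\<And>z. z \<in> carrier T \<Longrightarrow> h (K +>\<^bsub>T\<^esub> z) = k z"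
    by blast
  show thesis
    by (rule that[of h]) (use h k_gen gen_closed in \<open>simp_all add: tensor_def ten_eq\<close>)
qed

end

lemma module_pairI: "module R M \<Longrightarrow> module R N \<Longrightarrow> module_pair R M N"
  by (rule module_pair.intro)

section \<open>Functoriality and right exactness of the tensor product\<close>

context
  fixes R :: "('r, 'x) ring_scheme" and M :: "('r, 'm, 'y) module_scheme" and N :: "('r, 'k, 'z) module_scheme"
    and M' :: "('r, 'm1, 'y1) module_scheme" and N' :: "('r, 'k1, 'z1) module_scheme" and f g
  assumes mods: "module R M" "module R N" "module R M'" "module R N'"
    and f: "f \<in> mod_hom R M M'" and g: "g \<in> mod_hom R N N'"
begin

interpretation A: module_pair R M N by (rule module_pairI[OF mods(1,2)])
interpretation B: module_pair R M' N' by (rule module_pairI[OF mods(3,4)])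

lemma free_map_tensor_hom: "free_map R (map_prod f g) \<in> mod_hom R (tensor_free R M N) (tensor_free R M' N')"
  unfolding tensor_free_def
  by (rule A.M.free_map_hom) (auto simp: mod_hom_closed[OF f] mod_hom_closed[OF g])

text \<open>\<open>free_map\<close> sends a basis element to a basis element, hence a relator to the
  relator of the same family formed from the images; linearity of \<open>f\<close> and
  \<open>g\<close> is what makes the shapes match.\<close>

lemma free_map_tensor_rel: "free_map R (map_prod f g) ` tensor_rel R M N \<subseteq> tensor_rel R M' N'"
  by (rule A.K_least[OF B.T.module_axioms free_map_tensor_hom B.K_submodule];
      simp add: A.M.free_map_gen mod_hom_add[OF f] mod_hom_add[OF g] mod_hom_smult[OF f] mod_hom_smult[OF g];
      rule B.relator_in_K; use mod_hom_closed[OF f] mod_hom_closed[OF g] in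
      \<open>unfold tensor_relators_def Let_def, blast\<close>)

lemma tensor_map_hom: "tensor_map R M' N' f g \<in> mod_hom R (tensor R M N) (tensor R M' N')"
  unfolding tensor_map_def tensor_def
  by (rule B.Q.quot_map_hom[OF A.T.module_axioms free_map_tensor_hom A.K_submodule free_map_tensor_rel])

lemma tensor_map_pure:
  assumes "x \<in> carrier M" "y \<in> carrier N"
  shows "tensor_map R M' N' f g (pure_tensor R M N x y) = pure_tensor R M' N' (f x) (g y)"
  unfolding tensor_map_def pure_tensor_def
  using B.Q.quot_map_eq[OF A.T.module_axioms free_map_tensor_hom A.K_submodule free_map_tensor_rel
      A.gen_closed[OF assms]]
  by (simp add: A.M.free_map_gen)

text \<open>The image is a submodule, and it contains every pure tensor because both factors can be
  lifted.\<close>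

lemma tensor_map_surj:
  assumes "f ` carrier M = carrier M'" "g ` carrier N = carrier N'"
  shows "tensor_map R M' N' f g ` carrier (tensor R M N) = carrier (tensor R M' N')"
proof -
  interpret TT: module R "tensor R M' N'" by (rule B.tensor_is_module)
  have sub: "submodule (tensor_map R M' N' f g ` carrier (tensor R M N)) R (tensor R M' N')"
    by (rule image_submodule[OF A.tensor_is_module B.tensor_is_module tensor_map_hom])
  have "z \<in> tensor_map R M' N' f g ` carrier (tensor R M N)" if "z \<in> carrier (tensor R M' N')" for z
    using that
  proof (induction rule: B.tensor_induct)
    case zero
    then show ?case by (rule TT.submodule_zero[OF sub])
  next
    case (add z z')
    show ?case by (rule TT.submoduleE(5)[OF sub add.IH])
  next
    case (ten x y)
    then obtain x0 y0 where "x0 \<in> carrier M" "x = f x0" "y0 \<in> carrier N" "y = g y0"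
      using assms by blast
    then show ?case using tensor_map_pure[of x0 y0] A.ten_closed[of x0 y0] by (metis imageI)
  qed
  then show ?thesis using TT.submoduleE(1)[OF sub] by blast
qed

end

lemma tensor_map_comp:
  assumes "module R M" "module R N" "module R M'" "module R N'" "module R M''" "module R N''"
    and f: "f \<in> mod_hom R M M'" "f' \<in> mod_hom R M' M''"
    and g: "g \<in> mod_hom R N N'" "g' \<in> mod_hom R N' N''"
    and z: "z \<in> carrier (tensor R M N)"
  shows "tensor_map R M'' N'' f' g' (tensor_map R M' N' f g z) = tensor_map R M'' N'' (f' \<circ> f) (g' \<circ> g) z"
proof -
  interpret A: module_pair R M N by (intro module_pairI assms)
  interpret C: module_pair R M'' N'' by (intro module_pairI assms)
  note mf = mod_hom_comp[OF f, folded comp_def] and mg = mod_hom_comp[OF g, folded comp_def]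
  show ?thesis
  proof (rule A.tensor_hom_eqI[OF C.tensor_is_module _ _ _ z, of "\<lambda>z. tensor_map R M'' N'' f' g' (tensor_map R M' N' f g z)"])
    show "(\<lambda>z. tensor_map R M'' N'' f' g' (tensor_map R M' N' f g z)) \<in> mod_hom R (tensor R M N) (tensor R M'' N'')"
      by (rule mod_hom_comp[of _ R _ "tensor R M' N'"]) (intro tensor_map_hom assms)+
    show "tensor_map R M'' N'' (f' \<circ> f) (g' \<circ> g) \<in> mod_hom R (tensor R M N) (tensor R M'' N'')"
      by (intro tensor_map_hom assms mf mg)
    fix x y assume "x \<in> carrier M" "y \<in> carrier N"
    then show "tensor_map R M'' N'' f' g' (tensor_map R M' N' f g (pure_tensor R M N x y))
        = tensor_map R M'' N'' (f' \<circ> f) (g' \<circ> g) (pure_tensor R M N x y)"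
      using assms mf mg mod_hom_closed[OF f(1)] mod_hom_closed[OF g(1)]
      by (simp add: tensor_map_pure)
  qed
qed

text \<open>Both composites are \<open>f \<otimes> g\<close>. This is the commuting square behind
  the naturality of the differentials and of the augmentation.\<close>

lemma tensor_map_commute:
  assumes "module R M" "module R N" "module R M'" "module R N'"
    and "f \<in> mod_hom R M M'" "g \<in> mod_hom R N N'" "z \<in> carrier (tensor R M N)"
  shows "tensor_map R M' N' id g (tensor_map R M' N f id z) = tensor_map R M' N' f id (tensor_map R M N' id g z)"
  using tensor_map_comp[of R M N M' N M' N' f id id g z]
    tensor_map_comp[of R M N M N' M' N' id f g id z] assms
    id_mod_hom[of R M] id_mod_hom[of R N] id_mod_hom[of R M'] id_mod_hom[of R N']
  by simp

lemma tensor_map_zero: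
  assumes "module R M" "module R N" "module R M'" "module R N'"
    and f: "f \<in> mod_hom R M M'" and g: "g \<in> mod_hom R N N'"
    and z: "z \<in> carrier (tensor R M N)"
    and zero: "(\<forall>x\<in>carrier M. f x = \<zero>\<^bsub>M'\<^esub>) \<or> (\<forall>y\<in>carrier N. g y = \<zero>\<^bsub>N'\<^esub>)"
  shows "tensor_map R M' N' f g z = \<zero>\<^bsub>tensor R M' N'\<^esub>"
proof -
  interpret A: module_pair R M N by (intro module_pairI assms)
  interpret C: module_pair R M' N' by (intro module_pairI assms)
  interpret CT: module R "tensor R M' N'" by (rule C.tensor_is_module)
  note hom = tensor_map_hom[OF assms(1-4) f g]
  from z show ?thesis
  proof (induction rule: A.tensor_induct)
    case zero
    show ?case by (rule mod_hom_zero[OF A.tensor_is_module C.tensor_is_module hom])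
  next
    case (add z z')
    then show ?case by (simp add: mod_hom_add[OF hom])
  next
    case (ten x y)
    then show ?case
      using zero mod_hom_closed[OF f, of x] mod_hom_closed[OF g, of y]
      by (simp add: tensor_map_pure[OF assms(1-4) f g])
        (metis C.ten_zero_left C.ten_zero_right)
  qed
qed

text \<open>The substantial inclusion is that the kernel lies in the image of
  \<open>f \<otimes> id\<close>. A map from \<open>L \<otimes> N\<close> to the cokernel of
  \<open>f \<otimes> id\<close> is built such that its composite with \<open>g \<otimes> id\<close>
  is the projection; anything killed by \<open>g \<otimes> id\<close> is then zero in the
  cokernel.\<close>

lemma tensor_right_exact:
  assumes mods: "module R K" "module R M" "module R L" "module R N"
    and ex: "mod_exact R K f M g L" and surj: "g ` carrier M = carrier L"
  shows "mod_ker (tensor R M N) (tensor R L N) (tensor_map R L N g id)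
    = tensor_map R M N f id ` carrier (tensor R K N)"
proof -
  let ?T = "tensor R M N" and ?f = "tensor_map R M N f id" and ?g = "tensor_map R L N g id"
  interpret K: module_pair R K N by (intro module_pairI mods)
  interpret M: module_pair R M N by (intro module_pairI mods)
  interpret L: module_pair R L N by (intro module_pairI mods)
  interpret MT: module R ?T by (rule M.tensor_is_module)
  have f: "f \<in> mod_hom R K M" and g: "g \<in> mod_hom R M L"
    and im: "f ` carrier K = mod_ker M L g"
    using ex unfolding mod_exact_def by auto
  have fhom: "?f \<in> mod_hom R (tensor R K N) ?T"
    by (intro tensor_map_hom mods f id_mod_hom)
  have ghom: "?g \<in> mod_hom R ?T (tensor R L N)"
    by (intro tensor_map_hom mods g id_mod_hom)
  let ?I = "?f ` carrier (tensor R K N)"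
  have I: "submodule ?I R ?T"
    by (rule image_submodule[OF K.tensor_is_module M.tensor_is_module fhom])
  interpret Q: quotient_module R ?T ?I
    by (rule quotient_moduleI[OF M.tensor_is_module I])
  let ?Q = "quot_module ?T ?I"
  interpret QM: module R ?Q by (rule Q.quot_is_module)
  let ?t = "\<lambda>m y. pure_tensor R M N m y"
  \<comment> \<open>\<open>s\<close> is a set-theoretic section of \<open>g\<close>, in general not
    linear. The map \<open>c\<close> is nevertheless bilinear, as its values are taken modulo the
    image of \<open>f \<otimes> id\<close>.\<close>
  define s where "s l = (SOME m. m \<in> carrier M \<and> g m = l)" for l
  define c where "c l y = ?I +>\<^bsub>?T\<^esub> ?t (s l) y" for l y
  have ker: "?t m y \<in> ?I" if "m \<in> carrier M" "g m = \<zero>\<^bsub>L\<^esub>" "y \<in> carrier N" for m y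
  proof -
    have "m \<in> f ` carrier K" unfolding im mod_ker_def using that by simp
    then obtain k where "k \<in> carrier K" "m = f k" by blast
    then have "?t m y = ?f (pure_tensor R K N k y)"
      using that by (simp add: tensor_map_pure[OF mods(1,4,2,4) f id_mod_hom])
    then show ?thesis using K.ten_closed[OF \<open>k \<in> carrier K\<close> that(3)] by blast
  qed
  have s: "s l \<in> carrier M" "g (s l) = l" if "l \<in> carrier L" for l
  proof -
    have "\<exists>m. m \<in> carrier M \<and> g m = l" using that surj by (metis imageE)
    from someI_ex[OF this] show "s l \<in> carrier M" "g (s l) = l" by (simp_all add: s_def)
  qed
  \<comment> \<open>Two preimages of \<open>g m\<close> differ by an element of the kernel of
    \<open>g\<close>, whose tensors lie in the image; so \<open>c\<close> may be computed from any
    preimage.\<close>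
  have c: "c (g m) y = ?I +>\<^bsub>?T\<^esub> ?t m y" if "m \<in> carrier M" "y \<in> carrier N" for m y
  proof -
    have gm: "g m \<in> carrier L" using that g mod_hom_closed by metis
    have "g (s (g m) \<ominus>\<^bsub>M\<^esub> m) = \<zero>\<^bsub>L\<^esub>"
      using s[OF gm] that gm by (simp add: mod_hom_minus[OF mods(2,3) g] L.M.eq_iff_minus)
    then have "?t (s (g m) \<ominus>\<^bsub>M\<^esub> m) y \<in> ?I"
      using s[OF gm] that by (intro ker) simp_all
    then show ?thesis
      using s[OF gm] that by (simp add: c_def Q.coset_eq_iff M.ten_closed M.ten_minus_left)
  qed
  have g_add: "s l \<oplus>\<^bsub>M\<^esub> s l' \<in> carrier M" "g (s l \<oplus>\<^bsub>M\<^esub> s l') = l \<oplus>\<^bsub>L\<^esub> l'"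
    if "l \<in> carrier L" "l' \<in> carrier L" for l l'
    using s that by (simp_all add: mod_hom_add[OF g])
  have g_smult: "r \<odot>\<^bsub>M\<^esub> s l \<in> carrier M" "g (r \<odot>\<^bsub>M\<^esub> s l) = r \<odot>\<^bsub>L\<^esub> l"
    if "r \<in> carrier R" "l \<in> carrier L" for r l
    using s that by (simp_all add: mod_hom_smult[OF g])
  obtain h where h: "h \<in> mod_hom R (tensor R L N) ?Q"
    and h_ten: "\<And>l y. l \<in> carrier L \<Longrightarrow> y \<in> carrier N \<Longrightarrow> h (pure_tensor R L N l y) = c l y"
  proof (rule L.tensor_lift[OF Q.quot_is_module, of c])
    fix l y assume "l \<in> carrier L" "y \<in> carrier N"
    then show "c l y \<in> carrier ?Q"
      using s M.ten_closed unfolding c_def Q.quot_carrier by blast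
  next
    fix l l' y assume a: "l \<in> carrier L" "l' \<in> carrier L" "y \<in> carrier N"
    show "c (l \<oplus>\<^bsub>L\<^esub> l') y = c l y \<oplus>\<^bsub>?Q\<^esub> c l' y"
      using c[OF g_add(1)[OF a(1,2)] a(3)] s[OF a(1)] s[OF a(2)] a
      by (simp add: g_add c_def Q.quot_add M.ten_closed M.ten_add_left)
  next
    fix l y y' assume "l \<in> carrier L" "y \<in> carrier N" "y' \<in> carrier N"
    then show "c l (y \<oplus>\<^bsub>N\<^esub> y') = c l y \<oplus>\<^bsub>?Q\<^esub> c l y'"
      using s by (simp add: c_def Q.quot_add M.ten_closed M.ten_add_right)
  next
    fix r l y assume a: "r \<in> carrier R" "l \<in> carrier L" "y \<in> carrier N"
    show "c (r \<odot>\<^bsub>L\<^esub> l) y = r \<odot>\<^bsub>?Q\<^esub> c l y"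
      using c[OF g_smult(1)[OF a(1,2)] a(3)] s[OF a(2)] a
      by (simp add: g_smult c_def Q.quot_smult M.ten_closed M.ten_smult_left)
    show "c l (r \<odot>\<^bsub>N\<^esub> y) = r \<odot>\<^bsub>?Q\<^esub> c l y"
      using s[OF a(2)] a by (simp add: c_def Q.quot_smult M.ten_closed M.ten_smult_right)
  qed blast
  have hg: "h (?g z) = ?I +>\<^bsub>?T\<^esub> z" if "z \<in> carrier ?T" for z
  proof (rule M.tensor_hom_eqI[OF Q.quot_is_module mod_hom_comp[OF ghom h] Q.quot_proj_hom _ that])
    fix x y assume "x \<in> carrier M" "y \<in> carrier N"
    then show "h (?g (?t x y)) = ?I +>\<^bsub>?T\<^esub> ?t x y"
      using mod_hom_closed[OF g] by (simp add: tensor_map_pure[OF mods(2,4,3,4) g id_mod_hom] h_ten c)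
  qed
  show ?thesis
  proof (intro subset_antisym subsetI)
    fix z assume "z \<in> mod_ker ?T (tensor R L N) (?g)"
    then have z: "z \<in> carrier ?T" "?g z = \<zero>\<^bsub>tensor R L N\<^esub>"
      by (simp_all add: mod_ker_def)
    then have "?I +>\<^bsub>?T\<^esub> z = ?I"
      using hg[OF z(1)] mod_hom_zero[OF L.tensor_is_module Q.quot_is_module h] by (simp add: Q.quot_zero)
    then show "z \<in> ?I" using Q.coset_zero_iff[OF z(1)] by simp
  next
    fix z assume "z \<in> ?I"
    then obtain k where k: "k \<in> carrier (tensor R K N)" "z = ?f k" by blast
    have gf: "g \<circ> f \<in> mod_hom R K L" using mod_hom_comp[OF f g] by (simp add: comp_def)
    have "?g z = tensor_map R L N (g \<circ> f) id k"
      using tensor_map_comp[OF mods(1,4,2,4,3,4) f g id_mod_hom id_mod_hom k(1)] k(2) by simp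
    also have "\<dots> = \<zero>\<^bsub>tensor R L N\<^esub>"
    proof (rule tensor_map_zero[OF mods(1,4,3,4) gf id_mod_hom k(1)], rule disjI1, rule ballI)
      fix x assume "x \<in> carrier K"
      then have "f x \<in> mod_ker M L g" using im by blast
      then show "(g \<circ> f) x = \<zero>\<^bsub>L\<^esub>" by (simp add: mod_ker_def)
    qed
    finally show "z \<in> mod_ker ?T (tensor R L N) (?g)"
      using k mod_hom_closed[OF fhom] by (simp add: mod_ker_def)
  qed
qed

section \<open>Tensoring with a free module\<close>

locale based_module = F: module R F for R (structure) and F +
  fixes B \<phi> assumes \<phi>: "\<phi> \<in> mod_iso R (free_module R B) F"
begin

definition "coord b x = inv_into (carrier (free_module R B)) \<phi> x b"
abbreviation "base b \<equiv> \<phi> (free_gen R b)"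

lemma phi_hom: "\<phi> \<in> mod_hom R (free_module R B) F"
  and phi_bij: "bij_betw \<phi> (carrier (free_module R B)) (carrier F)"
  using \<phi> by (auto simp: mod_iso_def)

lemma coord_phi: "\<psi> \<in> carrier (free_module R B) \<Longrightarrow> coord b (\<phi> \<psi>) = \<psi> b"
  unfolding coord_def using bij_betw_inv_into_left[OF phi_bij] by simp

lemma phiE:
  assumes "x \<in> carrier F" obtains \<psi> where "\<psi> \<in> carrier (free_module R B)" "x = \<phi> \<psi>"
  using assms phi_bij by (metis bij_betw_imp_surj_on imageE)

lemma coord_closed: "x \<in> carrier F \<Longrightarrow> coord b x \<in> carrier R"
  by (elim phiE) (simp add: coord_phi free_moduleD(1))

lemma coord_add:
  "x \<in> carrier F \<Longrightarrow> y \<in> carrier F \<Longrightarrow> coord b (x \<oplus>\<^bsub>F\<^esub> y) = coord b x \<oplus> coord b y"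
proof (elim phiE)
  interpret FR: module R "free_module R B" by (rule F.free_module_is_module)
  fix \<psi> \<rho> assume "\<psi> \<in> carrier (free_module R B)" "\<rho> \<in> carrier (free_module R B)" "x = \<phi> \<psi>" "y = \<phi> \<rho>"
  then show ?thesis
    using coord_phi[of "\<psi> \<oplus>\<^bsub>free_module R B\<^esub> \<rho>" b] FR.a_closed[of \<psi> \<rho>]
    by (simp add: coord_phi mod_hom_add[OF phi_hom] del: free_module_simps)
      (simp add: coord_phi)
qed

lemma coord_smult:
  "r \<in> carrier R \<Longrightarrow> x \<in> carrier F \<Longrightarrow> coord b (r \<odot>\<^bsub>F\<^esub> x) = r \<otimes> coord b x"
proof (elim phiE)
  interpret FR: module R "free_module R B" by (rule F.free_module_is_module)
  fix \<psi> assume "r \<in> carrier R" "\<psi> \<in> carrier (free_module R B)" "x = \<phi> \<psi>"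
  then show ?thesis
    using coord_phi[of "r \<odot>\<^bsub>free_module R B\<^esub> \<psi>" b] FR.smult_closed[of r \<psi>]
    by (simp add: coord_phi mod_hom_smult[OF phi_hom] del: free_module_simps)
      (simp add: coord_phi)
qed

lemma base_closed: "b \<in> B \<Longrightarrow> base b \<in> carrier F"
  by (rule mod_hom_closed[OF phi_hom F.free_gen_carrier])

lemma coord_base: "b \<in> B \<Longrightarrow> coord c (base b) = (if c = b then \<one> else \<zero>)"
  by (simp add: coord_phi F.free_gen_carrier) (simp add: free_gen_def)

text \<open>Tensors with a basis element on the left suffice: a scalar coefficient there is moved to
  \<open>y\<close>. This refines the induction on pure tensors by an induction on the left
  factor.\<close>

lemma base_tensor_induct [consumes 2, case_names zero add base]:
  assumes "module R N" "z \<in> carrier (tensor R F N)"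
    and zero: "P \<zero>\<^bsub>tensor R F N\<^esub>"
    and add: "\<And>z z'. z \<in> carrier (tensor R F N) \<Longrightarrow> z' \<in> carrier (tensor R F N) \<Longrightarrow>
      P z \<Longrightarrow> P z' \<Longrightarrow> P (z \<oplus>\<^bsub>tensor R F N\<^esub> z')"
    and base: "\<And>b y. b \<in> B \<Longrightarrow> y \<in> carrier N \<Longrightarrow> P (pure_tensor R F N (base b) y)"
  shows "P z"
proof -
  interpret T: module_pair R F N by (intro module_pairI F.module_axioms assms)
  interpret FR: module R "free_module R B" by (rule F.free_module_is_module)
  show ?thesis
    using assms(2)
  proof (induction rule: T.tensor_induct)
    case (ten x y)
    obtain \<psi> where \<psi>: "\<psi> \<in> carrier (free_module R B)" "x = \<phi> \<psi>" using ten(1) by (rule phiE)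
    from \<psi>(1) have "P (pure_tensor R F N (\<phi> \<psi>) y)"
    proof (induction rule: F.free_module_induct)
      case zero
      have "\<phi> (\<lambda>b. \<zero>) = \<zero>\<^bsub>F\<^esub>"
        using mod_hom_zero[OF FR.module_axioms F.module_axioms phi_hom] by simp
      then show ?case using assms(3) ten by (simp add: T.ten_zero_left)
    next
      case (add \<psi> \<rho>)
      then show ?case
        using mod_hom_closed[OF phi_hom] ten assms(4) T.ten_closed
        by (simp only: mod_hom_add[OF phi_hom] T.ten_add_left)
    next
      case (gen r b)
      have "pure_tensor R F N (r \<odot>\<^bsub>F\<^esub> base b) y = pure_tensor R F N (base b) (r \<odot>\<^bsub>N\<^esub> y)"
        using gen ten base_closed by (intro T.ten_smult_swap) simp_all
      then show ?case
        using gen ten F.free_gen_carrier[OF gen(2)] assms(5)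
        by (simp only: mod_hom_smult[OF phi_hom]) simp
    qed
    then show ?case using \<psi> by simp
  qed (use assms in blast)+
qed

text \<open>For \<open>b\<close> in the basis, \<open>\<kappa> b\<close> is the projection of
  \<open>F \<otimes> N\<close>, seen as a direct sum of copies of \<open>N\<close> indexed by the
  basis, to the copy of index \<open>b\<close>. It comes from the universal property applied to the
  product of \<open>coord b x\<close> and \<open>y\<close>.\<close>

lemma coords_exist:
  assumes N: "module R N"
  obtains \<kappa> where "\<And>b. \<kappa> b \<in> mod_hom R (tensor R F N) N"
    and "\<And>b x y. x \<in> carrier F \<Longrightarrow> y \<in> carrier N \<Longrightarrow> \<kappa> b (pure_tensor R F N x y) = coord b x \<odot>\<^bsub>N\<^esub> y"
proof -
  interpret N: module R N by fact
  interpret T: module_pair R F N by (intro module_pairI F.module_axioms assms)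
  have "\<exists>h. h \<in> mod_hom R (tensor R F N) N \<and>
      (\<forall>x y. x \<in> carrier F \<longrightarrow> y \<in> carrier N \<longrightarrow> h (pure_tensor R F N x y) = coord b x \<odot>\<^bsub>N\<^esub> y)" for b
  proof (rule T.tensor_lift[OF N, of "\<lambda>x y. coord b x \<odot>\<^bsub>N\<^esub> y"])
    fix r x y assume a: "r \<in> carrier R" "x \<in> carrier F" "y \<in> carrier N"
    then show "coord b x \<odot>\<^bsub>N\<^esub> (r \<odot>\<^bsub>N\<^esub> y) = r \<odot>\<^bsub>N\<^esub> (coord b x \<odot>\<^bsub>N\<^esub> y)"
      using N.smult_assoc1[of r "coord b x" y] N.smult_assoc1[of "coord b x" r y] F.m_comm[of r "coord b x"]
      by (simp add: coord_closed)
  qed (auto simp: coord_closed coord_add coord_smult N.smult_l_distr N.smult_r_distr N.smult_assoc1)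
  then show thesis using that by metis
qed

text \<open>A tensor is determined by its coordinates; this is how freeness (instead of flatness) enters.\<close>

lemma coords_decomp:
  assumes N: "module R N"
    and \<kappa>: "\<And>b. \<kappa> b \<in> mod_hom R (tensor R F N) N"
      "\<And>b x y. x \<in> carrier F \<Longrightarrow> y \<in> carrier N \<Longrightarrow> \<kappa> b (pure_tensor R F N x y) = coord b x \<odot>\<^bsub>N\<^esub> y"
    and z: "z \<in> carrier (tensor R F N)"
  shows "\<exists>S. finite S \<and> S \<subseteq> B \<and>
    z = (\<Oplus>\<^bsub>tensor R F N\<^esub> b\<in>S. pure_tensor R F N (base b) (\<kappa> b z))"
proof -
  let ?T = "tensor R F N"
  interpret N: module R N by fact
  interpret T: module_pair R F N by (intro module_pairI F.module_axioms assms)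
  interpret TT: module R "tensor R F N" by (rule T.tensor_is_module)
  have closed: "(\<lambda>b. T.ten (base b) (\<kappa> b z)) \<in> S \<rightarrow> carrier ?T"
    if "S \<subseteq> B" "z \<in> carrier ?T" for S z
    using that mod_hom_closed[OF \<kappa>(1)] base_closed by (auto intro!: T.ten_closed)
  \<comment> \<open>The claim is strengthened from \<open>S\<close> to all finite \<open>S'\<close>
    between \<open>S\<close> and the basis, so that in the sum case the sets of the two summands can
    be replaced by their union.\<close>
  have "\<exists>S. finite S \<and> S \<subseteq> B \<and> (\<forall>S'. finite S' \<longrightarrow> S \<subseteq> S' \<longrightarrow> S' \<subseteq> B \<longrightarrow>
    z = (\<Oplus>\<^bsub>?T\<^esub> b\<in>S'. T.ten (base b) (\<kappa> b z)))"
    using N z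
  proof (induction rule: base_tensor_induct)
    case zero
    have "\<zero>\<^bsub>?T\<^esub> = (\<Oplus>\<^bsub>?T\<^esub> b\<in>S'. T.ten (base b) (\<kappa> b \<zero>\<^bsub>?T\<^esub>))"
      if "S' \<subseteq> B" for S'
      by (rule TT.add.finprod_one_eqI[symmetric])
        (use that base_closed mod_hom_zero[OF T.tensor_is_module N \<kappa>(1)] in \<open>auto simp: T.ten_zero_right\<close>)
    then show ?case by (intro exI[of _ "{}"] conjI allI impI) simp_all
  next
    case (add z z')
    obtain S1 where S1: "finite S1" "S1 \<subseteq> B" "\<And>S'. finite S' \<Longrightarrow> S1 \<subseteq> S' \<Longrightarrow> S' \<subseteq> B \<Longrightarrow>
      z = (\<Oplus>\<^bsub>?T\<^esub> b\<in>S'. T.ten (base b) (\<kappa> b z))"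
      using add.IH(1) by (elim exE conjE) simp
    obtain S2 where S2: "finite S2" "S2 \<subseteq> B" "\<And>S'. finite S' \<Longrightarrow> S2 \<subseteq> S' \<Longrightarrow> S' \<subseteq> B \<Longrightarrow>
      z' = (\<Oplus>\<^bsub>?T\<^esub> b\<in>S'. T.ten (base b) (\<kappa> b z'))"
      using add.IH(2) by (elim exE conjE) simp
    have "z \<oplus>\<^bsub>?T\<^esub> z' = (\<Oplus>\<^bsub>?T\<^esub> b\<in>S'. T.ten (base b) (\<kappa> b (z \<oplus>\<^bsub>?T\<^esub> z')))"
      if S': "finite S'" "S1 \<union> S2 \<subseteq> S'" "S' \<subseteq> B" for S'
    proof -
      have "(\<Oplus>\<^bsub>?T\<^esub> b\<in>S'. T.ten (base b) (\<kappa> b (z \<oplus>\<^bsub>?T\<^esub> z')))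
        = (\<Oplus>\<^bsub>?T\<^esub> b\<in>S'. T.ten (base b) (\<kappa> b z) \<oplus>\<^bsub>?T\<^esub> T.ten (base b) (\<kappa> b z'))"
      proof (rule TT.finsum_cong'[OF refl])
        show "(\<lambda>b. T.ten (base b) (\<kappa> b z) \<oplus>\<^bsub>?T\<^esub> T.ten (base b) (\<kappa> b z'))
          \<in> S' \<rightarrow> carrier ?T"
          using closed[OF S'(3) add.hyps(1)] closed[OF S'(3) add.hyps(2)] by (simp add: Pi_iff)
      next
        fix b assume "b \<in> S'"
        then have "b \<in> B" using S' by blast
        then show "T.ten (base b) (\<kappa> b (z \<oplus>\<^bsub>?T\<^esub> z'))
          = T.ten (base b) (\<kappa> b z) \<oplus>\<^bsub>?T\<^esub> T.ten (base b) (\<kappa> b z')"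
          using add.hyps base_closed mod_hom_closed[OF \<kappa>(1)]
          by (simp add: mod_hom_add[OF \<kappa>(1)] T.ten_add_right)
      qed
      also have "\<dots> = (\<Oplus>\<^bsub>?T\<^esub> b\<in>S'. T.ten (base b) (\<kappa> b z)) \<oplus>\<^bsub>?T\<^esub>
        (\<Oplus>\<^bsub>?T\<^esub> b\<in>S'. T.ten (base b) (\<kappa> b z'))"
        by (rule TT.finsum_addf[OF closed[OF S'(3) add.hyps(1)] closed[OF S'(3) add.hyps(2)]])
      also have "\<dots> = z \<oplus>\<^bsub>?T\<^esub> z'"
        using S1(3)[OF S'(1) _ S'(3)] S2(3)[OF S'(1) _ S'(3)] S'(2) by simp
      finally show ?thesis by simp
    qed
    then show ?case using S1(1,2) S2(1,2) by (intro exI[of _ "S1 \<union> S2"] conjI allI impI) simp_all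
  next
    case (base b y)
    have "T.ten (base b) y = (\<Oplus>\<^bsub>?T\<^esub> c\<in>S'. T.ten (base c) (\<kappa> c (T.ten (base b) y)))"
      if S': "finite S'" "{b} \<subseteq> S'" "S' \<subseteq> B" for S'
    proof -
      have "(\<Oplus>\<^bsub>?T\<^esub> c\<in>S'. T.ten (base c) (\<kappa> c (T.ten (base b) y)))
        = (\<Oplus>\<^bsub>?T\<^esub> c\<in>S'. if b = c then T.ten (base c) y else \<zero>\<^bsub>?T\<^esub>)"
      proof (rule TT.finsum_cong'[OF refl])
        show "(\<lambda>c. if b = c then T.ten (base c) y else \<zero>\<^bsub>?T\<^esub>) \<in> S' \<rightarrow> carrier ?T"
          using base base_closed by (auto simp: Pi_iff intro!: T.ten_closed)
      next
        fix c assume "c \<in> S'"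
        then have "c \<in> B" using S' by blast
        then show "T.ten (base c) (\<kappa> c (T.ten (base b) y))
          = (if b = c then T.ten (base c) y else \<zero>\<^bsub>?T\<^esub>)"
          using base base_closed by (simp add: \<kappa>(2) coord_base T.ten_zero_right)
      qed
      also have "\<dots> = T.ten (base b) y"
        using S' base base_closed by (intro TT.finsum_singleton) (auto intro!: T.ten_closed)
      finally show ?thesis by simp
    qed
    then show ?case using base(1) by (intro exI[of _ "{b}"] conjI allI impI) simp_all
  qed
  then show ?thesis by (elim exE conjE) (intro exI conjI, assumption+, simp)
qed

text \<open>A check on pure tensors. Statements about \<open>id \<otimes> h\<close> thereby reduce
  to statements about \<open>h\<close> itself, one coordinate at a time.\<close>

lemma coords_natural:
  assumes "module R A" "module R C" "h \<in> mod_hom R A C"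
    and \<kappa>: "\<kappa> \<in> mod_hom R (tensor R F A) A"
      "\<And>x y. x \<in> carrier F \<Longrightarrow> y \<in> carrier A \<Longrightarrow> \<kappa> (pure_tensor R F A x y) = coord b x \<odot>\<^bsub>A\<^esub> y"
    and \<kappa>': "\<kappa>' \<in> mod_hom R (tensor R F C) C"
      "\<And>x y. x \<in> carrier F \<Longrightarrow> y \<in> carrier C \<Longrightarrow> \<kappa>' (pure_tensor R F C x y) = coord b x \<odot>\<^bsub>C\<^esub> y"
    and z: "z \<in> carrier (tensor R F A)"
  shows "\<kappa>' (tensor_map R F C id h z) = h (\<kappa> z)"
proof -
  interpret T: module_pair R F A by (intro module_pairI F.module_axioms assms)
  note m = F.module_axioms
  show ?thesis
  proof (rule T.tensor_hom_eqI[OF assms(2) mod_hom_comp[OF tensor_map_hom \<kappa>'(1)] mod_hom_comp[OF \<kappa>(1) assms(3)] _ z])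
    fix x y assume "x \<in> carrier F" "y \<in> carrier A"
    then show "\<kappa>' (tensor_map R F C id h (pure_tensor R F A x y)) = h (\<kappa> (pure_tensor R F A x y))"
      using mod_hom_closed[OF assms(3)]
      by (simp add: tensor_map_pure[OF m assms(1) m assms(2) id_mod_hom assms(3)] \<kappa> \<kappa>' coord_closed
          mod_hom_smult[OF assms(3)])
  qed (intro m assms id_mod_hom)+
qed

end

lemma is_freeE:
  fixes F :: "('r, 'm, 'y) module_scheme"
  assumes "is_free R F"
  obtains B :: "'m set" and \<phi> where "based_module R F B \<phi>"
  using assms unfolding is_free_def based_module_def based_module_axioms_def by blast

text \<open>\<open>h\<close> maps each coordinate of \<open>z\<close> to the corresponding
  coordinate of the image of \<open>z\<close>, that is, to zero. So all coordinates vanish and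
  \<open>z\<close> is a sum of zero tensors.\<close>

lemma free_tensor_injective:
  fixes F :: "('r, 'm, 'y) module_scheme"
  assumes F: "is_free R F" and mods: "module R A" "module R B"
    and h: "h \<in> mod_hom R A B" and inj: "\<And>x. x \<in> carrier A \<Longrightarrow> h x = \<zero>\<^bsub>B\<^esub> \<Longrightarrow> x = \<zero>\<^bsub>A\<^esub>"
    and z: "z \<in> carrier (tensor R F A)" "tensor_map R F B id h z = \<zero>\<^bsub>tensor R F B\<^esub>"
  shows "z = \<zero>\<^bsub>tensor R F A\<^esub>"
proof -
  let ?T = "tensor R F A"
  obtain Bs :: "'m set" and \<phi> where "based_module R F Bs \<phi>" using F by (rule is_freeE)
  then interpret F: based_module R F Bs \<phi> .
  interpret T: module_pair R F A by (intro module_pairI F.F.module_axioms assms)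
  interpret T': module_pair R F B by (intro module_pairI F.F.module_axioms assms)
  interpret TT: module R "tensor R F A" by (rule T.tensor_is_module)
  obtain \<kappa> where \<kappa>: "\<And>b. \<kappa> b \<in> mod_hom R (tensor R F A) A"
    "\<And>b x y. x \<in> carrier F \<Longrightarrow> y \<in> carrier A \<Longrightarrow> \<kappa> b (pure_tensor R F A x y) = F.coord b x \<odot>\<^bsub>A\<^esub> y"
    using F.coords_exist[OF mods(1)] by blast
  obtain \<kappa>' where \<kappa>': "\<And>b. \<kappa>' b \<in> mod_hom R (tensor R F B) B"
    "\<And>b x y. x \<in> carrier F \<Longrightarrow> y \<in> carrier B \<Longrightarrow> \<kappa>' b (pure_tensor R F B x y) = F.coord b x \<odot>\<^bsub>B\<^esub> y"
    using F.coords_exist[OF mods(2)] by blast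
  have zero: "\<kappa> b z = \<zero>\<^bsub>A\<^esub>" for b
  proof (rule inj)
    show "\<kappa> b z \<in> carrier A" by (rule mod_hom_closed[OF \<kappa>(1) z(1)])
    have "h (\<kappa> b z) = \<kappa>' b (tensor_map R F B id h z)"
      by (rule F.coords_natural[OF mods h \<kappa> \<kappa>' z(1), symmetric])
    also have "\<dots> = \<zero>\<^bsub>B\<^esub>"
      unfolding z(2) by (rule mod_hom_zero[OF T'.tensor_is_module mods(2) \<kappa>'(1)])
    finally show "h (\<kappa> b z) = \<zero>\<^bsub>B\<^esub>" .
  qed
  obtain S where S: "finite S" "S \<subseteq> Bs"
    "z = (\<Oplus>\<^bsub>?T\<^esub> b\<in>S. T.ten (F.base b) (\<kappa> b z))"
    using F.coords_decomp[OF mods(1) \<kappa> z(1)] by blast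
  note S(3)
  also have "(\<Oplus>\<^bsub>?T\<^esub> b\<in>S. T.ten (F.base b) (\<kappa> b z)) = \<zero>\<^bsub>?T\<^esub>"
    by (rule TT.add.finprod_one_eqI) (use S(2) F.base_closed in \<open>auto simp: zero T.ten_zero_right\<close>)
  finally show ?thesis .
qed

text \<open>Each coordinate of \<open>z\<close> is killed by \<open>\<pi>\<close>, hence of the form
  \<open>\<iota> a\<close>, and its contribution to \<open>z\<close> is the image of
  \<open>base b \<otimes> a\<close>. The decomposition of \<open>z\<close> is a finite sum of such
  terms.\<close>

lemma free_tensor_exact:
  fixes F :: "('r, 'm, 'y) module_scheme"
  assumes F: "is_free R F" and mods: "module R A" "module R B" "module R C"
    and \<iota>: "\<iota> \<in> mod_hom R A B" and \<pi>: "\<pi> \<in> mod_hom R B C"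
    and ker: "\<And>x. x \<in> carrier B \<Longrightarrow> \<pi> x = \<zero>\<^bsub>C\<^esub> \<Longrightarrow> x \<in> \<iota> ` carrier A"
    and z: "z \<in> carrier (tensor R F B)" "tensor_map R F C id \<pi> z = \<zero>\<^bsub>tensor R F C\<^esub>"
  shows "z \<in> tensor_map R F B id \<iota> ` carrier (tensor R F A)"
proof -
  let ?T = "tensor R F B"
  obtain Bs :: "'m set" and \<phi> where "based_module R F Bs \<phi>" using F by (rule is_freeE)
  then interpret F: based_module R F Bs \<phi> .
  note m = F.F.module_axioms
  interpret TA: module_pair R F A by (intro module_pairI m assms)
  interpret T: module_pair R F B by (intro module_pairI m assms)
  interpret T': module_pair R F C by (intro module_pairI m assms)
  interpret TT: module R "tensor R F B" by (rule T.tensor_is_module)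
  obtain \<kappa> where \<kappa>: "\<And>b. \<kappa> b \<in> mod_hom R (tensor R F B) B"
    "\<And>b x y. x \<in> carrier F \<Longrightarrow> y \<in> carrier B \<Longrightarrow> \<kappa> b (pure_tensor R F B x y) = F.coord b x \<odot>\<^bsub>B\<^esub> y"
    using F.coords_exist[OF mods(2)] by blast
  obtain \<kappa>' where \<kappa>': "\<And>b. \<kappa>' b \<in> mod_hom R (tensor R F C) C"
    "\<And>b x y. x \<in> carrier F \<Longrightarrow> y \<in> carrier C \<Longrightarrow> \<kappa>' b (pure_tensor R F C x y) = F.coord b x \<odot>\<^bsub>C\<^esub> y"
    using F.coords_exist[OF mods(3)] by blast
  let ?I = "tensor_map R F B id \<iota> ` carrier (tensor R F A)"
  have I: "submodule ?I R (tensor R F B)"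
    by (intro image_submodule TA.tensor_is_module T.tensor_is_module tensor_map_hom m mods id_mod_hom \<iota>)
  have mem: "pure_tensor R F B (F.base b) (\<kappa> b z) \<in> ?I" if "b \<in> Bs" for b
  proof -
    have "\<pi> (\<kappa> b z) = \<kappa>' b (tensor_map R F C id \<pi> z)"
      by (rule F.coords_natural[OF mods(2,3) \<pi> \<kappa> \<kappa>' z(1), symmetric])
    also have "\<dots> = \<zero>\<^bsub>C\<^esub>"
      unfolding z(2) by (rule mod_hom_zero[OF T'.tensor_is_module mods(3) \<kappa>'(1)])
    finally have "\<kappa> b z \<in> \<iota> ` carrier A" by (intro ker mod_hom_closed[OF \<kappa>(1) z(1)])
    then obtain a where a: "a \<in> carrier A" "\<kappa> b z = \<iota> a" by blast
    then have "pure_tensor R F B (F.base b) (\<kappa> b z) = tensor_map R F B id \<iota> (pure_tensor R F A (F.base b) a)"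
      using F.base_closed[OF that] by (simp add: tensor_map_pure[OF m mods(1) m mods(2) id_mod_hom \<iota>])
    then show ?thesis using TA.ten_closed[OF F.base_closed[OF that] a(1)] by blast
  qed
  obtain S where S: "finite S" "S \<subseteq> Bs"
    "z = (\<Oplus>\<^bsub>?T\<^esub> b\<in>S. T.ten (F.base b) (\<kappa> b z))"
    using F.coords_decomp[OF mods(2) \<kappa> z(1)] by blast
  have "(\<Oplus>\<^bsub>?T\<^esub> b\<in>S. T.ten (F.base b) (\<kappa> b z)) \<in> ?I"
    using S(1,2)
  proof (induction S rule: finite_induct)
    case empty
    show ?case unfolding TT.finsum_empty by (rule TT.submodule_zero[OF I])
  next
    case (insert b S)
    have "(\<lambda>b. T.ten (F.base b) (\<kappa> b z)) \<in> insert b S \<rightarrow> carrier ?T"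
      using mem TT.submoduleE(1)[OF I] insert.prems by blast
    then have "(\<Oplus>\<^bsub>?T\<^esub> b\<in>insert b S. T.ten (F.base b) (\<kappa> b z))
      = T.ten (F.base b) (\<kappa> b z) \<oplus>\<^bsub>?T\<^esub> (\<Oplus>\<^bsub>?T\<^esub> b\<in>S. T.ten (F.base b) (\<kappa> b z))"
      using insert.hyps by (intro TT.finsum_insert) (auto simp: Pi_iff)
    moreover have "T.ten (F.base b) (\<kappa> b z) \<in> ?I" using insert.prems by (intro mem) simp
    moreover have "(\<Oplus>\<^bsub>?T\<^esub> b\<in>S. T.ten (F.base b) (\<kappa> b z)) \<in> ?I"
      using insert.prems by (intro insert.IH) simp
    ultimately show ?case
      using TT.submoduleE(5)[OF I] by (simp only:)
  qed
  then show ?thesis using S(3) by simp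
qed

section \<open>The exact sequence of Tor\<close>

locale resolved_module = L: module R L for R (structure) and L +
  fixes F :: "nat \<Rightarrow> ('a, 'f) module" and d :: "nat \<Rightarrow> 'f \<Rightarrow> 'f" and \<epsilon> :: "'f \<Rightarrow> 'c"
  assumes res: "free_resolution R L F d \<epsilon>"
begin

lemma free: "is_free R (F i)"
  using res unfolding free_resolution_def by blast

lemma F_module: "module R (F i)"
  using free[of i] unfolding is_free_def by blast

lemma d_hom: "d i \<in> mod_hom R (F (Suc i)) (F i)"
  using res unfolding free_resolution_def mod_exact_def by (cases i) auto

lemma eps_hom: "\<epsilon> \<in> mod_hom R (F 0) L"
  and eps_surj: "\<epsilon> ` carrier (F 0) = carrier L"
  and exact_0: "mod_exact R (F (Suc 0)) (d 0) (F 0) \<epsilon> L"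
  and exact_Suc: "mod_exact R (F (Suc (Suc i))) (d (Suc i)) (F (Suc i)) (d i) (F i)"
  using res unfolding free_resolution_def mod_exact_def by auto

abbreviation "dN N i \<equiv> tensor_map R (F i) N (d i) id"
abbreviation "eN N \<equiv> tensor_map R L N \<epsilon> id"
abbreviation "Cyc N \<equiv> tor_cycles R F d N (Suc 0)"
abbreviation "Bd N \<equiv> tor_boundaries R F d N (Suc 0)"
abbreviation "FT0 N \<equiv> tensor R (F 0) N"
abbreviation "FT1 N \<equiv> tensor R (F (Suc 0)) N"
abbreviation "FT2 N \<equiv> tensor R (F (Suc (Suc 0))) N"
abbreviation "tor1 N \<equiv> tor R F d N (Suc 0)"
abbreviation "cls N z \<equiv> Bd N +>\<^bsub>FT1 N\<^esub> z"

context
  fixes N assumes N: "module R N"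
begin

lemma FN_module: "module R (tensor R (F i) N)"
  by (intro module_pair.tensor_is_module module_pairI F_module N)

lemma LN_module: "module R (tensor R L N)"
  by (intro module_pair.tensor_is_module module_pairI L.module_axioms N)

lemma dN_hom: "dN N i \<in> mod_hom R (tensor R (F (Suc i)) N) (tensor R (F i) N)"
  by (intro tensor_map_hom F_module N d_hom id_mod_hom)

lemma eN_hom: "eN N \<in> mod_hom R (FT0 N) (tensor R L N)"
  by (intro tensor_map_hom F_module L.module_axioms N eps_hom id_mod_hom)

lemma eN_surj: "eN N ` carrier (FT0 N) = carrier (tensor R L N)"
  by (intro tensor_map_surj F_module L.module_axioms N eps_hom id_mod_hom eps_surj) simp

text \<open>By right exactness, the zeroth homology of the tensored resolution is
  \<open>L \<otimes> N\<close>. This is why the connecting map, whose values are classes in degree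
  zero, can take values in \<open>L \<otimes> A\<close>.\<close>

lemma eN_exact: "mod_ker (FT0 N) (tensor R L N) (eN N) = dN N 0 ` carrier (FT1 N)"
  by (rule tensor_right_exact[OF F_module F_module L.module_axioms N exact_0 eps_surj])

lemma eN_dN: "z \<in> carrier (FT1 N) \<Longrightarrow> eN N (dN N 0 z) = \<zero>\<^bsub>tensor R L N\<^esub>"
  using eN_exact unfolding mod_ker_def by blast

lemma dN_dN:
  assumes "z \<in> carrier (tensor R (F (Suc (Suc i))) N)"
  shows "dN N i (dN N (Suc i) z) = \<zero>\<^bsub>tensor R (F i) N\<^esub>"
proof -
  have "dN N i (dN N (Suc i) z) = tensor_map R (F i) N (d i \<circ> d (Suc i)) (id \<circ> id) z"
    by (rule tensor_map_comp[OF F_module N F_module N F_module N d_hom d_hom id_mod_hom id_mod_hom assms])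
  also have "\<dots> = \<zero>\<^bsub>tensor R (F i) N\<^esub>"
  proof (rule tensor_map_zero[OF F_module N F_module N _ _ assms])
    show "d i \<circ> d (Suc i) \<in> mod_hom R (F (Suc (Suc i))) (F i)"
      using mod_hom_comp[OF d_hom d_hom] by (simp add: comp_def)
    show "id \<circ> id \<in> mod_hom R N N" using id_mod_hom[of R N] by simp
    have "d (Suc i) x \<in> mod_ker (F (Suc i)) (F i) (d i)" if "x \<in> carrier (F (Suc (Suc i)))" for x
      using exact_Suc[of i] that unfolding mod_exact_def by blast
    then show "(\<forall>x\<in>carrier (F (Suc (Suc i))). (d i \<circ> d (Suc i)) x = \<zero>\<^bsub>F i\<^esub>) \<or>
        (\<forall>y\<in>carrier N. (id \<circ> id) y = \<zero>\<^bsub>N\<^esub>)"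
      by (simp add: mod_ker_def)
  qed
  finally show ?thesis .
qed

lemma Cyc_submodule: "submodule (Cyc N) R (FT1 N)"
  unfolding tor_cycles.simps by (rule mod_ker_submodule[OF FN_module FN_module dN_hom])

lemma Cyc_iff: "z \<in> Cyc N \<longleftrightarrow> z \<in> carrier (FT1 N) \<and> dN N 0 z = \<zero>\<^bsub>FT0 N\<^esub>"
  by (simp add: mod_ker_def)

lemma Bd_submodule: "submodule (Bd N) R (FT1 N)"
  unfolding tor_boundaries_def by (rule image_submodule[OF FN_module FN_module dN_hom])

lemma BdI: "z \<in> carrier (FT2 N) \<Longrightarrow> dN N (Suc 0) z \<in> Bd N"
  unfolding tor_boundaries_def by blast

lemma Bd_subset_Cyc: "Bd N \<subseteq> Cyc N"
  unfolding tor_boundaries_def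
  using mod_hom_closed[OF dN_hom] dN_dN by (auto simp: Cyc_iff simp del: tor_cycles.simps)

lemma tor_eq: "tor1 N = quot_module ((FT1 N)\<lparr>carrier := Cyc N\<rparr>) (Bd N)"
  by (simp add: tor_def)

lemma tor_quotient: "quotient_module R ((FT1 N)\<lparr>carrier := Cyc N\<rparr>) (Bd N)"
  by (intro quotient_moduleI submodule.submodule_is_module Cyc_submodule FN_module
      module.submodule_submodule[OF FN_module] Bd_submodule Bd_subset_Cyc)

text \<open>\<open>tor_map\<close> and \<open>tor_connecting\<close> are phrased with the whole
  degree-one term rather than with its cycles, so the quotient of that larger module by the
  boundaries is needed as well.\<close>

lemma Bd_quotient: "quotient_module R (FT1 N) (Bd N)"
  by (intro quotient_moduleI FN_module Bd_submodule)

lemma tor_is_module: "module R (tor1 N)"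
  unfolding tor_eq by (rule quotient_module.quot_is_module[OF tor_quotient])

lemma tor_carrier: "carrier (tor1 N) = (\<lambda>z. cls N z) ` Cyc N"
  unfolding tor_eq quotient_module.quot_carrier[OF tor_quotient] by simp

lemma tor_add: "z \<in> Cyc N \<Longrightarrow> z' \<in> Cyc N \<Longrightarrow>
    cls N z \<oplus>\<^bsub>tor1 N\<^esub> cls N z' = cls N (z \<oplus>\<^bsub>FT1 N\<^esub> z')"
  using quotient_module.quot_add[OF tor_quotient, of z z'] unfolding tor_eq by simp

lemma tor_smult: "r \<in> carrier R \<Longrightarrow> z \<in> Cyc N \<Longrightarrow>
    r \<odot>\<^bsub>tor1 N\<^esub> cls N z = cls N (r \<odot>\<^bsub>FT1 N\<^esub> z)"
  using quotient_module.quot_smult[OF tor_quotient, of r z] unfolding tor_eq by simp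

lemma tor_zero: "\<zero>\<^bsub>tor1 N\<^esub> = Bd N"
  unfolding tor_eq by (rule quotient_module.quot_zero[OF tor_quotient])

lemma Cyc_closed: "z \<in> Cyc N \<Longrightarrow> z \<in> carrier (FT1 N)"
  by (simp only: Cyc_iff)

end

section \<open>Functoriality of Tor in its second argument\<close>

lemma id_tensor_hom:
  assumes "module R N" "module R N'" "g \<in> mod_hom R N N'"
  shows "tensor_map R (F i) N' id g \<in> mod_hom R (tensor R (F i) N) (tensor R (F i) N')"
    and "tensor_map R L N' id g \<in> mod_hom R (tensor R L N) (tensor R L N')"
  by (intro tensor_map_hom F_module L.module_axioms assms id_mod_hom)+

lemma dN_natural:
  assumes "module R N" "module R N'" "g \<in> mod_hom R N N'" "z \<in> carrier (tensor R (F (Suc i)) N)"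
  shows "dN N' i (tensor_map R (F (Suc i)) N' id g z) = tensor_map R (F i) N' id g (dN N i z)"
  by (rule tensor_map_commute[symmetric]) (intro F_module assms d_hom)+

lemma eN_natural:
  assumes "module R N" "module R N'" "g \<in> mod_hom R N N'" "z \<in> carrier (FT0 N)"
  shows "eN N' (tensor_map R (F 0) N' id g z) = tensor_map R L N' id g (eN N z)"
  by (rule tensor_map_commute[symmetric]) (intro F_module L.module_axioms assms eps_hom)+

lemma id_tensor_Cyc:
  assumes "module R N" "module R N'" "g \<in> mod_hom R N N'" "z \<in> Cyc N"
  shows "tensor_map R (F (Suc 0)) N' id g z \<in> Cyc N'"
proof -
  have z: "z \<in> carrier (FT1 N)" "dN N 0 z = \<zero>\<^bsub>FT0 N\<^esub>"
    using assms(4) by (simp_all only: Cyc_iff[OF assms(1)])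
  show ?thesis
    unfolding Cyc_iff[OF assms(2)] dN_natural[OF assms(1-3) z(1)] z(2)
    using mod_hom_closed[OF id_tensor_hom(1)[OF assms(1-3)] z(1)]
      mod_hom_zero[OF FN_module[OF assms(1)] FN_module[OF assms(2)] id_tensor_hom(1)[OF assms(1-3)]]
    by blast
qed

text \<open>The induced maps commute with the differentials, so boundaries go to boundaries and the
  map passes to classes.\<close>

lemma tor_map_cls:
  assumes "module R N" "module R N'" "g \<in> mod_hom R N N'" "z \<in> carrier (FT1 N)"
  shows "tor_map R F d N' g (Suc 0) (cls N z)
    = cls N' (tensor_map R (F (Suc 0)) N' id g z)"
  unfolding tor_map_def
proof (rule quotient_module.quot_map_eq[OF Bd_quotient[OF assms(2)] FN_module[OF assms(1)]
      id_tensor_hom(1)[OF assms(1-3)] Bd_submodule[OF assms(1)] _ assms(4)])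
  show "tensor_map R (F (Suc 0)) N' id g ` Bd N \<subseteq> Bd N'"
  proof
    fix y assume "y \<in> tensor_map R (F (Suc 0)) N' id g ` Bd N"
    then obtain x where x: "x \<in> carrier (FT2 N)"
      "y = tensor_map R (F (Suc 0)) N' id g (dN N (Suc 0) x)"
      unfolding tor_boundaries_def by blast
    then have "y = dN N' (Suc 0) (tensor_map R (F (Suc (Suc 0))) N' id g x)"
      using dN_natural[OF assms(1-3) x(1)] by simp
    then show "y \<in> Bd N'"
      using BdI[OF assms(2) mod_hom_closed[OF id_tensor_hom(1)[OF assms(1-3)] x(1)]] by simp
  qed
qed

lemma tor_map_hom:
  assumes "module R N" "module R N'" "g \<in> mod_hom R N N'"
  shows "tor_map R F d N' g (Suc 0) \<in> mod_hom R (tor1 N) (tor1 N')"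
proof (rule mod_homI)
  note hom = id_tensor_hom(1)[OF assms, of "Suc 0"]
  note C = Cyc_closed[OF assms(1)] and cyc = id_tensor_Cyc[OF assms]
  note sub = module.submoduleE[OF FN_module[OF assms(1)] Cyc_submodule[OF assms(1)]]
  {
    fix Z assume "Z \<in> carrier (tor1 N)"
    then show "tor_map R F d N' g (Suc 0) Z \<in> carrier (tor1 N')"
      unfolding tor_carrier[OF assms(1)] tor_carrier[OF assms(2)]
      by (elim imageE) (simp only: tor_map_cls[OF assms C], rule imageI, rule cyc)
  next
    fix Z Z' assume "Z \<in> carrier (tor1 N)" "Z' \<in> carrier (tor1 N)"
    then obtain z z' where "z \<in> Cyc N" "z' \<in> Cyc N" and Z: "Z = cls N z"
      "Z' = cls N z'"
      unfolding tor_carrier[OF assms(1)] by blast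
    then show "tor_map R F d N' g (Suc 0) (Z \<oplus>\<^bsub>tor1 N\<^esub> Z')
      = tor_map R F d N' g (Suc 0) Z \<oplus>\<^bsub>tor1 N'\<^esub> tor_map R F d N' g (Suc 0) Z'"
      unfolding Z
      by (simp only: tor_add[OF assms(1)] tor_map_cls[OF assms C] sub(5) tor_add[OF assms(2)] cyc
          mod_hom_add[OF hom] C)
  next
    fix r Z assume "r \<in> carrier R" "Z \<in> carrier (tor1 N)"
    then obtain z where "r \<in> carrier R" "z \<in> Cyc N" and Z: "Z = cls N z"
      unfolding tor_carrier[OF assms(1)] by blast
    then show "tor_map R F d N' g (Suc 0) (r \<odot>\<^bsub>tor1 N\<^esub> Z)
      = r \<odot>\<^bsub>tor1 N'\<^esub> tor_map R F d N' g (Suc 0) Z"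
      unfolding Z
      by (simp only: tor_smult[OF assms(1)] tor_map_cls[OF assms C] sub(4) tor_smult[OF assms(2)] cyc
          mod_hom_smult[OF hom] C)
  }
qed

end

section \<open>The connecting homomorphism and exactness on both sides of it\<close>

locale tor_sequence = resolved_module R L F d \<epsilon>
    for R (structure) and L :: "('a, 'c, 'e) module_scheme" and F :: "nat \<Rightarrow> ('a, 'f) module" and d \<epsilon> +
  fixes A :: "('a, 'p, 'p1) module_scheme" and B :: "('a, 'q, 'q1) module_scheme"
    and C :: "('a, 's, 's1) module_scheme" and \<iota> \<pi>
  assumes A: "module R A" and B: "module R B" and C: "module R C"
    and \<iota>: "\<iota> \<in> mod_hom R A B" and \<pi>: "\<pi> \<in> mod_hom R B C"
    and inj: "inj_on \<iota> (carrier A)" and surj: "\<pi> ` carrier B = carrier C"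
    and ker: "\<iota> ` carrier A = mod_ker B C \<pi>"
begin

interpretation A: module R A by (rule A)
interpretation B: module R B by (rule B)
interpretation C: module R C by (rule C)

abbreviation "iN i \<equiv> tensor_map R (F i) B id \<iota>"
abbreviation "pN i \<equiv> tensor_map R (F i) C id \<pi>"
abbreviation "conn \<equiv> tor_connecting R L F d \<epsilon> A \<iota> B \<pi> C"

lemma iN_hom: "iN i \<in> mod_hom R (tensor R (F i) A) (tensor R (F i) B)"
  and pN_hom: "pN i \<in> mod_hom R (tensor R (F i) B) (tensor R (F i) C)"
  by (rule id_tensor_hom(1)[OF A B \<iota>], rule id_tensor_hom(1)[OF B C \<pi>])

lemma pi_iota: "x \<in> carrier A \<Longrightarrow> \<pi> (\<iota> x) = \<zero>\<^bsub>C\<^esub>"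
  using ker unfolding mod_ker_def by blast

lemma iN_inj:
  assumes "z \<in> carrier (tensor R (F i) A)" "iN i z = \<zero>\<^bsub>tensor R (F i) B\<^esub>"
  shows "z = \<zero>\<^bsub>tensor R (F i) A\<^esub>"
proof (rule free_tensor_injective[OF free A B \<iota> _ assms])
  fix x assume "x \<in> carrier A" "\<iota> x = \<zero>\<^bsub>B\<^esub>"
  then show "x = \<zero>\<^bsub>A\<^esub>"
    using mod_hom_zero[OF A B \<iota>] inj_onD[OF inj, of x "\<zero>\<^bsub>A\<^esub>"] by simp
qed

lemma pN_exact:
  assumes "z \<in> carrier (tensor R (F i) B)" "pN i z = \<zero>\<^bsub>tensor R (F i) C\<^esub>"
  obtains a where "a \<in> carrier (tensor R (F i) A)" "z = iN i a"
proof -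
  have "z \<in> iN i ` carrier (tensor R (F i) A)"
    by (rule free_tensor_exact[OF free A B C \<iota> \<pi> _ assms]) (simp add: ker mod_ker_def)
  then show thesis using that by blast
qed

lemma pN_iN:
  assumes "z \<in> carrier (tensor R (F i) A)"
  shows "pN i (iN i z) = \<zero>\<^bsub>tensor R (F i) C\<^esub>"
proof -
  have hom: "\<pi> \<circ> \<iota> \<in> mod_hom R A C" using mod_hom_comp[OF \<iota> \<pi>] by (simp add: comp_def)
  have "pN i (iN i z) = tensor_map R (F i) C (id \<circ> id) (\<pi> \<circ> \<iota>) z"
    by (rule tensor_map_comp[OF F_module A F_module B F_module C id_mod_hom id_mod_hom \<iota> \<pi> assms])
  also have "\<dots> = tensor_map R (F i) C id (\<pi> \<circ> \<iota>) z" by simp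
  also have "\<dots> = \<zero>\<^bsub>tensor R (F i) C\<^esub>"
    by (rule tensor_map_zero[OF F_module A F_module C id_mod_hom hom assms])
      (simp add: pi_iota)
  finally show ?thesis .
qed

lemma pN_surj:
  assumes "z \<in> carrier (tensor R (F i) C)"
  obtains b where "b \<in> carrier (tensor R (F i) B)" "z = pN i b"
proof -
  have "pN i ` carrier (tensor R (F i) B) = carrier (tensor R (F i) C)"
    by (intro tensor_map_surj F_module B C id_mod_hom \<pi> surj) simp
  then show thesis using that assms by blast
qed

text \<open>The data of the diagram chase: \<open>b\<close> lifts the cycle \<open>z\<close>, and \<open>a\<close> is the pull-back of the
  boundary of \<open>b\<close>.\<close>

definition lift_of :: "('f \<times> 'q \<Rightarrow> 'a) set \<Rightarrow> ('f \<times> 'p \<Rightarrow> 'a) set \<Rightarrow> ('f \<times> 's \<Rightarrow> 'a) set \<Rightarrow> bool" where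
  "lift_of b a z \<longleftrightarrow> b \<in> carrier (FT1 B) \<and> a \<in> carrier (FT0 A) \<and>
     pN (Suc 0) b = z \<and> iN 0 a = dN B 0 b"

text \<open>\<open>b\<close> exists because \<open>id \<otimes> \<pi>\<close> is onto. The boundary
  of \<open>b\<close> lies over that of the cycle \<open>z\<close>, which is zero, so exactness in
  the middle provides \<open>a\<close>.\<close>

lemma lift_exists:
  assumes "z \<in> Cyc C"
  obtains b a where "lift_of b a z"
proof -
  have z: "z \<in> carrier (FT1 C)" "dN C 0 z = \<zero>\<^bsub>FT0 C\<^esub>"
    using assms by (simp_all only: Cyc_iff[OF C])
  obtain b where b: "b \<in> carrier (FT1 B)" "z = pN (Suc 0) b"
    using pN_surj[OF z(1)] .
  have "pN 0 (dN B 0 b) = \<zero>\<^bsub>FT0 C\<^esub>"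
    using dN_natural[OF B C \<pi> b(1)] z(2) b(2) by simp
  then obtain a where "a \<in> carrier (FT0 A)" "dN B 0 b = iN 0 a"
    using pN_exact[OF mod_hom_closed[OF dN_hom[OF B] b(1)]] by metis
  then have "lift_of b a z" using b by (simp add: lift_of_def)
  then show thesis by (rule that)
qed

text \<open>The boundary of \<open>z\<close> is the image of \<open>a\<close> in
  \<open>F 0 \<otimes> C\<close>, which vanishes because \<open>\<pi>\<close> after
  \<open>\<iota>\<close> is zero. So no separate cycle condition has to be carried along with
  \<open>lift_of\<close>.\<close>

lemma lift_cycle:
  assumes "lift_of b a z" shows "z \<in> Cyc C"
proof -
  have b: "b \<in> carrier (FT1 B)" "z = pN (Suc 0) b"
    and a: "a \<in> carrier (FT0 A)" "dN B 0 b = iN 0 a"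
    using assms by (simp_all add: lift_of_def)
  show ?thesis
    unfolding Cyc_iff[OF C] b(2) dN_natural[OF B C \<pi> b(1)] a(2)
    using pN_iN[OF a(1)] mod_hom_closed[OF pN_hom b(1)] by blast
qed

lemma lift_add:
  assumes "lift_of b a z" "lift_of b' a' z'"
  shows "lift_of (b \<oplus>\<^bsub>FT1 B\<^esub> b') (a \<oplus>\<^bsub>FT0 A\<^esub> a') (z \<oplus>\<^bsub>FT1 C\<^esub> z')"
proof -
  interpret FB: module R "FT1 B" by (rule FN_module[OF B])
  interpret FA: module R "FT0 A" by (rule FN_module[OF A])
  show ?thesis
    using assms unfolding lift_of_def
    by (simp add: mod_hom_add[OF pN_hom] mod_hom_add[OF iN_hom] mod_hom_add[OF dN_hom[OF B]])
qed

lemma lift_smult: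
  assumes "lift_of b a z" "r \<in> carrier R"
  shows "lift_of (r \<odot>\<^bsub>FT1 B\<^esub> b) (r \<odot>\<^bsub>FT0 A\<^esub> a) (r \<odot>\<^bsub>FT1 C\<^esub> z)"
proof -
  interpret FB: module R "FT1 B" by (rule FN_module[OF B])
  interpret FA: module R "FT0 A" by (rule FN_module[OF A])
  show ?thesis
    using assms unfolding lift_of_def
    by (simp add: mod_hom_smult[OF pN_hom] mod_hom_smult[OF iN_hom] mod_hom_smult[OF dN_hom[OF B]])
qed

text \<open>Independence of all choices in the diagram chase. If \<open>z' - z\<close> is the
  boundary of \<open>c\<close>, lift \<open>c\<close> to \<open>b2\<close>; then
  \<open>b' - b\<close> minus the boundary of \<open>b2\<close> lies over zero and comes from some
  \<open>a1\<close>. Applying the differential removes the term from \<open>b2\<close>, so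
  injectivity of \<open>iN 0\<close> identifies \<open>a' - a\<close> with the boundary of
  \<open>a1\<close>, which the augmentation kills.\<close>

lemma lift_unique:
  assumes "lift_of b a z" "lift_of b' a' z'" "z' \<ominus>\<^bsub>FT1 C\<^esub> z \<in> Bd C"
  shows "eN A a' = eN A a"
proof -
  interpret FB: module R "FT1 B" by (rule FN_module[OF B])
  interpret FB0: module R "FT0 B" by (rule FN_module[OF B])
  interpret FA: module R "FT0 A" by (rule FN_module[OF A])
  interpret FC: module R "FT1 C" by (rule FN_module[OF C])
  interpret LA: module R "tensor R L A" by (rule LN_module[OF A])
  note pN_minus = mod_hom_minus[OF FN_module[OF B] FN_module[OF C] pN_hom]
    and iN_minus = mod_hom_minus[OF FN_module[OF A] FN_module[OF B] iN_hom]
    and dN_minus = mod_hom_minus[OF FN_module[OF B] FN_module[OF B] dN_hom[OF B]]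
  let ?m = "\<lambda>x y. x \<ominus>\<^bsub>FT1 B\<^esub> y"
  note b = assms(1)[unfolded lift_of_def] and b' = assms(2)[unfolded lift_of_def]
  obtain c where c: "c \<in> carrier (FT2 C)"
    "z' \<ominus>\<^bsub>FT1 C\<^esub> z = dN C (Suc 0) c"
    using assms(3) unfolding tor_boundaries_def by blast
  obtain b2 where b2: "b2 \<in> carrier (FT2 B)" "c = pN (Suc (Suc 0)) b2"
    using pN_surj[OF c(1)] .
  let ?t = "dN B (Suc 0) b2"
  have t: "?t \<in> carrier (FT1 B)" by (rule mod_hom_closed[OF dN_hom[OF B] b2(1)])
  have pt: "pN (Suc 0) ?t = z' \<ominus>\<^bsub>FT1 C\<^esub> z"
    using dN_natural[OF B C \<pi> b2(1)] c(2) b2(2) by simp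
  let ?b = "?m (?m b' b) ?t"
  have bb: "?b \<in> carrier (FT1 B)" using b b' t by simp
  have "pN (Suc 0) (?m b' b) = z' \<ominus>\<^bsub>FT1 C\<^esub> z"
    using b b' by (simp add: pN_minus)
  then have "pN (Suc 0) ?b = \<zero>\<^bsub>FT1 C\<^esub>"
    using b b' t pt mod_hom_closed[OF pN_hom t] FC.eq_iff_minus[OF mod_hom_closed[OF pN_hom t] mod_hom_closed[OF pN_hom t]]
    by (simp add: pN_minus)
  then obtain a1 where a1: "a1 \<in> carrier (FT1 A)" "?b = iN (Suc 0) a1"
    using pN_exact[OF bb] by metis
  let ?a = "a' \<ominus>\<^bsub>FT0 A\<^esub> a"
  let ?d = "dN A 0 a1"
  have aa: "?a \<in> carrier (FT0 A)" using b b' by simp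
  have dd: "?d \<in> carrier (FT0 A)" by (rule mod_hom_closed[OF dN_hom[OF A] a1(1)])
  have "iN 0 ?d = dN B 0 ?b"
    using dN_natural[OF A B \<iota> a1(1)] a1(2) by simp
  also have "\<dots> = dN B 0 b' \<ominus>\<^bsub>FT0 B\<^esub> dN B 0 b \<ominus>\<^bsub>FT0 B\<^esub> \<zero>\<^bsub>FT0 B\<^esub>"
    using b b' t dN_dN[OF B b2(1)] by (simp add: dN_minus)
  also have "\<dots> = iN 0 a' \<ominus>\<^bsub>FT0 B\<^esub> iN 0 a"
    using b b' mod_hom_closed[OF dN_hom[OF B], of b] mod_hom_closed[OF dN_hom[OF B], of b']
    by (simp add: a_minus_def)
  also have "\<dots> = iN 0 ?a"
    using b b' by (simp add: iN_minus)
  finally have eq: "iN 0 ?d = iN 0 ?a" .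
  have "iN 0 (?a \<ominus>\<^bsub>FT0 A\<^esub> ?d) = \<zero>\<^bsub>FT0 B\<^esub>"
    using aa dd eq mod_hom_closed[OF iN_hom aa] by (simp add: iN_minus FB0.eq_iff_minus)
  then have "?a \<ominus>\<^bsub>FT0 A\<^esub> ?d = \<zero>\<^bsub>FT0 A\<^esub>"
    by (intro iN_inj) (use aa dd in simp_all)
  then have "?a = ?d" using FA.eq_iff_minus[OF aa dd] by simp
  then have "eN A ?a = \<zero>\<^bsub>tensor R L A\<^esub>" using eN_dN[OF A a1(1)] by simp
  then have "eN A a' \<ominus>\<^bsub>tensor R L A\<^esub> eN A a = \<zero>\<^bsub>tensor R L A\<^esub>"
    using b b' by (simp add: mod_hom_minus[OF FN_module[OF A] LN_module[OF A] eN_hom[OF A]])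
  then show ?thesis
    using b b' mod_hom_closed[OF eN_hom[OF A]] LA.eq_iff_minus by metis
qed

text \<open>By the independence of the lift, the definite description in
  \<open>tor_connecting\<close> has exactly one solution. The later facts about the connecting map
  rest on this formula.\<close>

lemma conn_eq:
  assumes "lift_of b a z"
  shows "conn (cls C z) = eN A a"
proof -
  interpret Q: quotient_module R "FT1 C" "Bd C" by (rule Bd_quotient[OF C])
  have z: "z \<in> carrier (FT1 C)" using Cyc_closed[OF C lift_cycle[OF assms]] .
  show ?thesis
    unfolding tor_connecting_def One_nat_def
  proof (rule the_equality)
    show "\<exists>b\<in>carrier (FT1 B). \<exists>a'\<in>carrier (FT0 A).
       pN (Suc 0) b \<in> cls C z \<and> iN 0 a' = dN B 0 b \<and> eN A a = eN A a'"
      using assms Q.coset_self[OF z] unfolding lift_of_def by blast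
  next
    fix y assume "\<exists>b\<in>carrier (FT1 B). \<exists>a'\<in>carrier (FT0 A).
       pN (Suc 0) b \<in> cls C z \<and> iN 0 a' = dN B 0 b \<and> y = eN A a'"
    then obtain b' a' where *: "lift_of b' a' (pN (Suc 0) b')" "y = eN A a'"
      "pN (Suc 0) b' \<in> cls C z"
      unfolding lift_of_def by blast
    then show "y = eN A a"
      using lift_unique[OF assms *(1)] Q.coset_memD[OF z *(3)] by blast
  qed
qed

lemma tor_class_lift:
  assumes "Z \<in> carrier (tor1 C)"
  obtains b a z where "Z = cls C z" "lift_of b a z"
  using assms lift_exists unfolding tor_carrier[OF C] by blast

lemma conn_hom: "conn \<in> mod_hom R (tor1 C) (tensor R L A)"
proof (rule mod_homI)
  fix Z assume "Z \<in> carrier (tor1 C)"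
  then obtain b a z where Z: "Z = cls C z" "lift_of b a z" by (rule tor_class_lift)
  then show "conn Z \<in> carrier (tensor R L A)"
    using conn_eq[OF Z(2)] mod_hom_closed[OF eN_hom[OF A]] unfolding lift_of_def by simp
  fix Z' assume "Z' \<in> carrier (tor1 C)"
  then obtain b' a' z' where Z': "Z' = cls C z'" "lift_of b' a' z'" by (rule tor_class_lift)
  show "conn (Z \<oplus>\<^bsub>tor1 C\<^esub> Z') = conn Z \<oplus>\<^bsub>tensor R L A\<^esub> conn Z'"
    unfolding Z(1) Z'(1) tor_add[OF C lift_cycle[OF Z(2)] lift_cycle[OF Z'(2)]]
      conn_eq[OF lift_add[OF Z(2) Z'(2)]] conn_eq[OF Z(2)] conn_eq[OF Z'(2)]
    using Z(2) Z'(2) unfolding lift_of_def by (intro mod_hom_add[OF eN_hom[OF A]]) simp_all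
next
  fix r Z assume r: "r \<in> carrier R" and "Z \<in> carrier (tor1 C)"
  then obtain b a z where Z: "Z = cls C z" "lift_of b a z" by (elim tor_class_lift)
  show "conn (r \<odot>\<^bsub>tor1 C\<^esub> Z) = r \<odot>\<^bsub>tensor R L A\<^esub> conn Z"
    unfolding Z(1) tor_smult[OF C r lift_cycle[OF Z(2)]]
      conn_eq[OF lift_smult[OF Z(2) r]] conn_eq[OF Z(2)]
    using Z(2) r unfolding lift_of_def by (intro mod_hom_smult[OF eN_hom[OF A]]) simp_all
qed

text \<open>If the augmentation kills \<open>a\<close>, then \<open>a\<close> is the boundary of
  some \<open>a1\<close>. Subtracting the image of \<open>a1\<close> turns the lift \<open>b\<close>
  into a cycle without changing what it lies over. Conversely, a cycle \<open>b\<close> allows the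
  lift with \<open>a\<close> zero.\<close>

lemma conn_kernel:
  "mod_ker (tor1 C) (tensor R L A) conn
    = tor_map R F d C \<pi> (Suc 0) ` carrier (tor1 B)"
proof (intro subset_antisym subsetI)
  fix Z assume "Z \<in> mod_ker (tor1 C) (tensor R L A) conn"
  then have Z0: "Z \<in> carrier (tor1 C)" "conn Z = \<zero>\<^bsub>tensor R L A\<^esub>" by (simp_all add: mod_ker_def)
  obtain b a z where Z: "Z = cls C z" "lift_of b a z"
    using tor_class_lift[OF Z0(1)] .
  note b = Z(2)[unfolded lift_of_def]
  have "a \<in> mod_ker (FT0 A) (tensor R L A) (eN A)"
    using b Z0(2) conn_eq[OF Z(2)] Z(1) by (simp add: mod_ker_def)
  then obtain a1 where a1: "a1 \<in> carrier (FT1 A)" "a = dN A 0 a1"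
    unfolding eN_exact[OF A] by blast
  interpret FB: module R "FT1 B" by (rule FN_module[OF B])
  interpret FB0: module R "FT0 B" by (rule FN_module[OF B])
  interpret FC: module R "FT1 C" by (rule FN_module[OF C])
  let ?b = "b \<ominus>\<^bsub>FT1 B\<^esub> iN (Suc 0) a1"
  have i: "iN (Suc 0) a1 \<in> carrier (FT1 B)" by (rule mod_hom_closed[OF iN_hom a1(1)])
  have bc: "?b \<in> carrier (FT1 B)" using b i by simp
  have db: "dN B 0 b \<in> carrier (FT0 B)" using mod_hom_closed[OF dN_hom[OF B]] b by blast
  have "dN B 0 ?b = dN B 0 b \<ominus>\<^bsub>FT0 B\<^esub> iN 0 (dN A 0 a1)"
    using b i dN_natural[OF A B \<iota> a1(1)] by (simp add: mod_hom_minus[OF FN_module[OF B] FN_module[OF B] dN_hom[OF B]])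
  also have "\<dots> = \<zero>\<^bsub>FT0 B\<^esub>"
    using b a1(2) db FB0.eq_iff_minus[OF db db] by simp
  finally have cyc: "?b \<in> Cyc B" unfolding Cyc_iff[OF B] using bc by blast
  have "pN (Suc 0) ?b = pN (Suc 0) b \<ominus>\<^bsub>FT1 C\<^esub> pN (Suc 0) (iN (Suc 0) a1)"
    using b i by (intro mod_hom_minus[OF FN_module[OF B] FN_module[OF C] pN_hom]) simp_all
  also have "\<dots> = z"
    using b pN_iN[OF a1(1)] mod_hom_closed[OF pN_hom, of b "Suc 0"] by (simp add: a_minus_def)
  finally have "pN (Suc 0) ?b = z" .
  then have "Z = tor_map R F d C \<pi> (Suc 0) (cls B ?b)"
    using tor_map_cls[OF B C \<pi> bc] Z(1) by simp
  then show "Z \<in> tor_map R F d C \<pi> (Suc 0) ` carrier (tor1 B)"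
    unfolding tor_carrier[OF B] using cyc by blast
next
  fix Z assume "Z \<in> tor_map R F d C \<pi> (Suc 0) ` carrier (tor1 B)"
  then obtain b where b: "b \<in> Cyc B" "Z = tor_map R F d C \<pi> (Suc 0) (cls B b)"
    unfolding tor_carrier[OF B] by blast
  have bc: "b \<in> carrier (FT1 B)" "dN B 0 b = \<zero>\<^bsub>FT0 B\<^esub>"
    using b(1) by (simp_all only: Cyc_iff[OF B])
  have Z: "Z = cls C (pN (Suc 0) b)"
    using b(2) tor_map_cls[OF B C \<pi> bc(1)] by simp
  have "lift_of b \<zero>\<^bsub>FT0 A\<^esub> (pN (Suc 0) b)"
    using bc module.axioms(2)[OF FN_module[OF A, of 0]] mod_hom_zero[OF FN_module[OF A] FN_module[OF B] iN_hom]
    by (simp add: lift_of_def abelian_group_def abelian_monoid.zero_closed)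
  then have "conn Z = \<zero>\<^bsub>tensor R L A\<^esub>" "pN (Suc 0) b \<in> Cyc C"
    using conn_eq Z mod_hom_zero[OF FN_module[OF A] LN_module[OF A] eN_hom[OF A]] lift_cycle
    by (simp_all del: tor_cycles.simps)
  then show "Z \<in> mod_ker (tor1 C) (tensor R L A) conn"
    unfolding mod_ker_def tor_carrier[OF C] Z by blast
qed

text \<open>For \<open>y\<close> in the kernel, a representative \<open>a\<close> in
  \<open>F 0 \<otimes> A\<close> becomes a boundary in \<open>F 0 \<otimes> B\<close>, by exactness
  at the augmentation. A chain \<open>b\<close> with this boundary, pushed to \<open>C\<close>, is a
  cycle whose class maps to \<open>y\<close>.\<close>

lemma conn_image:
  "conn ` carrier (tor1 C) = mod_ker (tensor R L A) (tensor R L B) (tensor_map R L B id \<iota>)"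
proof (intro subset_antisym subsetI)
  fix y assume "y \<in> conn ` carrier (tor1 C)"
  then obtain b a z where Z: "y = conn (cls C z)" "lift_of b a z"
    using tor_class_lift by blast
  note b = Z(2)[unfolded lift_of_def]
  have y: "y = eN A a" using Z conn_eq by simp
  have "tensor_map R L B id \<iota> (eN A a) = eN B (dN B 0 b)"
    using eN_natural[OF A B \<iota>, of a] b by simp
  then show "y \<in> mod_ker (tensor R L A) (tensor R L B) (tensor_map R L B id \<iota>)"
    using b y eN_dN[OF B] mod_hom_closed[OF eN_hom[OF A]] by (simp add: mod_ker_def)
next
  fix y assume "y \<in> mod_ker (tensor R L A) (tensor R L B) (tensor_map R L B id \<iota>)"
  then have y: "y \<in> carrier (tensor R L A)" "tensor_map R L B id \<iota> y = \<zero>\<^bsub>tensor R L B\<^esub>"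
    by (simp_all add: mod_ker_def)
  obtain a where a: "a \<in> carrier (FT0 A)" "y = eN A a"
    using y(1) eN_surj[OF A] by blast
  have "iN 0 a \<in> mod_ker (FT0 B) (tensor R L B) (eN B)"
    using eN_natural[OF A B \<iota> a(1)] a y mod_hom_closed[OF iN_hom a(1)] by (simp add: mod_ker_def)
  then obtain b where b: "b \<in> carrier (FT1 B)" "iN 0 a = dN B 0 b"
    unfolding eN_exact[OF B] by blast
  then have lift: "lift_of b a (pN (Suc 0) b)" using a by (simp add: lift_of_def)
  have "y = conn (cls C (pN (Suc 0) b))"
    using conn_eq[OF lift] a by simp
  then show "y \<in> conn ` carrier (tor1 C)"
    unfolding tor_carrier[OF C] using lift_cycle[OF lift] by blast
qed

end

section \<open>Quotients of ideals\<close>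

lemma reg_module_simps [simp]:
  "carrier (reg_module R) = carrier R" "\<zero>\<^bsub>reg_module R\<^esub> = \<zero>\<^bsub>R\<^esub>"
  "x \<oplus>\<^bsub>reg_module R\<^esub> y = x \<oplus>\<^bsub>R\<^esub> y" "r \<odot>\<^bsub>reg_module R\<^esub> x = r \<otimes>\<^bsub>R\<^esub> x"
  by (simp_all add: reg_module_def)

lemma ideal_module_carrier [simp]: "ideal_module R (carrier R) = reg_module R"
  by (simp add: reg_module_def)

lemma reg_module_coset [simp]: "I +>\<^bsub>reg_module R\<^esub> x = I +>\<^bsub>R\<^esub> x"
  by (simp add: a_r_coset_def r_coset_def)

text \<open>The operations mention \<open>I\<close> but not \<open>J\<close>. Hence calculations
  with cosets can be done in \<open>R/I\<close> and transferred to any \<open>J/I\<close>.\<close>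

lemma ideal_quot_simps:
  "carrier (ideal_quot R J I) = (\<lambda>x. I +>\<^bsub>R\<^esub> x) ` J"
  "\<zero>\<^bsub>ideal_quot R J I\<^esub> = I"
  "add (ideal_quot R J I) = set_add R"
  "smult (ideal_quot R J I) = (\<lambda>r Z. \<Union>x\<in>Z. I +>\<^bsub>R\<^esub> (r \<otimes>\<^bsub>R\<^esub> x))"
  by (auto simp: ideal_quot_def quot_module_def A_RCOSETS_def RCOSETS_def set_add_def set_mult_def
      fun_eq_iff a_r_coset_def r_coset_def)

section \<open>Ideals as modules and maps between their quotients\<close>

context cring
begin

lemma reg_module_is_module: "module R (reg_module R)"
proof (rule moduleI)
  show "abelian_group (reg_module R)"
    by (rule abelian_groupI) (use a_comm a_assoc l_neg in \<open>auto intro: a_inv_closed\<close>)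
qed (simp_all add: is_cring l_distr r_distr m_assoc)

lemma reg_a_minus [simp]: "x \<ominus>\<^bsub>reg_module R\<^esub> y = x \<ominus> y"
  by (simp add: a_minus_def a_inv_def m_inv_def)

lemma ideal_submodule:
  assumes "ideal J R" shows "submodule J R (reg_module R)"
proof -
  interpret J: ideal J R by fact
  interpret M: module R "reg_module R" by (rule reg_module_is_module)
  show ?thesis
    by (rule M.submodule_intro) (auto simp: J.I_l_closed)
qed

lemma ideal_quotient: "ideal I R \<Longrightarrow> quotient_module R (reg_module R) I"
  by (intro quotient_moduleI reg_module_is_module ideal_submodule)

lemma ideal_module_is_module: "ideal J R \<Longrightarrow> module R (ideal_module R J)"
  using submodule.submodule_is_module[OF ideal_submodule reg_module_is_module] by simp

lemma ideal_quotient_module: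
  assumes "ideal I R" "ideal J R" "I \<subseteq> J"
  shows "quotient_module R (ideal_module R J) I"
  by (intro quotient_moduleI ideal_module_is_module assms
      module.submodule_submodule[OF reg_module_is_module] ideal_submodule)

lemma ideal_quot_is_module:
  assumes "ideal I R" "ideal J R" "I \<subseteq> J"
  shows "module R (ideal_quot R J I)"
  unfolding ideal_quot_def by (rule quotient_module.quot_is_module[OF ideal_quotient_module[OF assms]])

lemma ideal_subset: "ideal I R \<Longrightarrow> I \<subseteq> carrier R"
  by (rule subsetI) (rule ideal.Icarr)

lemma cyclic_is_module: "ideal I R \<Longrightarrow> module R (cyclic_module R I)"
  by (intro ideal_quot_is_module oneideal ideal_subset)

lemma ideal_coset_eq_iff:
  "ideal I R \<Longrightarrow> x \<in> carrier R \<Longrightarrow> y \<in> carrier R \<Longrightarrow> I +> x = I +> y \<longleftrightarrow> x \<ominus> y \<in> I"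
  using quotient_module.coset_eq_iff[OF ideal_quotient, of I x y]
  by simp

lemma ideal_coset_zero_iff: "ideal I R \<Longrightarrow> x \<in> carrier R \<Longrightarrow> I +> x = I \<longleftrightarrow> x \<in> I"
  using quotient_module.coset_zero_iff[OF ideal_quotient, of I x]
  by simp

lemma ideal_coset_self: "ideal I R \<Longrightarrow> x \<in> carrier R \<Longrightarrow> x \<in> I +> x"
  using quotient_module.coset_self[OF ideal_quotient, of I x]
  by simp

lemma ideal_coset_memD:
  "ideal I R \<Longrightarrow> x \<in> carrier R \<Longrightarrow> y \<in> I +> x \<Longrightarrow> y \<in> carrier R \<and> y \<ominus> x \<in> I"
  using quotient_module.coset_memD[OF ideal_quotient, of I x y]
  by simp

lemma ideal_coset_add:
  assumes "ideal I R" "x \<in> carrier R" "y \<in> carrier R"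
  shows "(I +> x) \<oplus>\<^bsub>ideal_quot R J I\<^esub> (I +> y) = I +> (x \<oplus> y)"
proof -
  have "(I +> x) \<oplus>\<^bsub>cyclic_module R I\<^esub> (I +> y) = I +> (x \<oplus> y)"
    using quotient_module.quot_add[OF ideal_quotient_module[OF assms(1) oneideal ideal_subset], of x y] assms
    by (simp add: ideal_quot_def)
  then show ?thesis unfolding ideal_quot_simps .
qed

lemma ideal_coset_smult:
  assumes "ideal I R" "r \<in> carrier R" "x \<in> carrier R"
  shows "r \<odot>\<^bsub>ideal_quot R J I\<^esub> (I +> x) = I +> (r \<otimes> x)"
proof -
  have "r \<odot>\<^bsub>cyclic_module R I\<^esub> (I +> x) = I +> (r \<otimes> x)"
    using quotient_module.quot_smult[OF ideal_quotient_module[OF assms(1) oneideal ideal_subset], of r x] assms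
    by (simp add: ideal_quot_def)
  then show ?thesis unfolding ideal_quot_simps .
qed

lemma coset_map_coset:
  assumes "ideal I R" "ideal I' R" "f \<in> mod_hom R (reg_module R) (reg_module R)" "f ` I \<subseteq> I'" "x \<in> carrier R"
  shows "coset_map R I' f (I +> x) = I' +> f x"
  using quotient_module.quot_map_eq[OF ideal_quotient[OF assms(2)]
      reg_module_is_module assms(3) ideal_submodule[OF assms(1)] assms(4), of x] assms(5)
  by (simp add: coset_map_def)

lemma coset_map_hom:
  assumes "ideal I R" "ideal J R" "I \<subseteq> J" "ideal I' R" "ideal J' R" "I' \<subseteq> J'"
    and f: "f \<in> mod_hom R (reg_module R) (reg_module R)" "f ` I \<subseteq> I'" "f ` J \<subseteq> J'"
  shows "coset_map R I' f \<in> mod_hom R (ideal_quot R J I) (ideal_quot R J' I')"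
proof (rule mod_homI)
  note J = subsetD[OF ideal_subset[OF assms(2)]]
  note c = coset_map_coset[OF assms(1,4) f(1,2)]
  {
    fix Z assume "Z \<in> carrier (ideal_quot R J I)"
    then show "coset_map R I' f Z \<in> carrier (ideal_quot R J' I')"
      using f(3) J unfolding ideal_quot_simps(1) by (elim imageE) (simp add: c image_subset_iff)
  next
    fix Z Z' assume "Z \<in> carrier (ideal_quot R J I)" "Z' \<in> carrier (ideal_quot R J I)"
    then obtain x y where xy: "x \<in> carrier R" "y \<in> carrier R" "Z = I +> x" "Z' = I +> y"
      using J unfolding ideal_quot_simps(1) by blast
    then show "coset_map R I' f (Z \<oplus>\<^bsub>ideal_quot R J I\<^esub> Z')
      = coset_map R I' f Z \<oplus>\<^bsub>ideal_quot R J' I'\<^esub> coset_map R I' f Z'"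
      using mod_hom_closed[OF f(1)] mod_hom_add[OF f(1), of x y]
      by (simp add: ideal_coset_add assms(1,4) c)
  next
    fix r Z assume "r \<in> carrier R" "Z \<in> carrier (ideal_quot R J I)"
    then obtain x where x: "x \<in> carrier R" "Z = I +> x" "r \<in> carrier R"
      using J unfolding ideal_quot_simps(1) by blast
    then show "coset_map R I' f (r \<odot>\<^bsub>ideal_quot R J I\<^esub> Z) = r \<odot>\<^bsub>ideal_quot R J' I'\<^esub> coset_map R I' f Z"
      using mod_hom_closed[OF f(1)] mod_hom_smult[OF f(1), of r x]
      by (simp add: ideal_coset_smult assms(1,4) c)
  }
qed

lemma mult_right_hom: "c \<in> carrier R \<Longrightarrow> (\<lambda>r. r \<otimes> c) \<in> mod_hom R (reg_module R) (reg_module R)"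
  by (rule mod_homI) (simp_all add: l_distr m_assoc)

lemma coset_hom: "ideal I R \<Longrightarrow> (\<lambda>r. I +> r) \<in> mod_hom R (reg_module R) (cyclic_module R I)"
  by (rule mod_homI) (simp_all add: ideal_coset_add ideal_coset_smult, simp add: ideal_quot_simps)

end

section \<open>Vanishing of Tor for the ring itself, and naturality of the connecting map\<close>

context resolved_module
begin

text \<open>The identity between the maps is assumed on the carrier of \<open>N\<close> only, so the
  composite need not equal \<open>g''\<close> as a function; the tensor maps are compared on pure
  tensors instead. Commuting squares of modules are available in this form.\<close>

lemma id_tensor_comp:
  assumes "module R N" "module R K" "module R K'" "g \<in> mod_hom R N K" "g' \<in> mod_hom R K K'" "g'' \<in> mod_hom R N K'"
    "\<And>y. y \<in> carrier N \<Longrightarrow> g' (g y) = g'' y" "x \<in> carrier (tensor R (F i) N)"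
  shows "tensor_map R (F i) K' id g' (tensor_map R (F i) K id g x) = tensor_map R (F i) K' id g'' x"
proof -
  note Fm = F_module[of i]
  have c: "g' \<circ> g \<in> mod_hom R N K'" using mod_hom_comp[OF assms(4,5)] by (simp add: comp_def)
  have "tensor_map R (F i) K' id g' (tensor_map R (F i) K id g x) = tensor_map R (F i) K' (id \<circ> id) (g' \<circ> g) x"
    by (rule tensor_map_comp[OF Fm assms(1) Fm assms(2) Fm assms(3) id_mod_hom id_mod_hom assms(4,5,8)])
  also have "\<dots> = tensor_map R (F i) K' id g'' x"
  proof (rule module_pair.tensor_hom_eqI[OF module_pairI[OF Fm assms(1)] FN_module[OF assms(3)] _ _ _ assms(8)])
    show "tensor_map R (F i) K' (id \<circ> id) (g' \<circ> g) \<in> mod_hom R (tensor R (F i) N) (tensor R (F i) K')"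
      using id_tensor_hom(1)[OF assms(1,3) c] by simp
    show "tensor_map R (F i) K' id g'' \<in> mod_hom R (tensor R (F i) N) (tensor R (F i) K')"
      by (rule id_tensor_hom(1)[OF assms(1,3,6)])
    fix y z assume "y \<in> carrier (F i)" "z \<in> carrier N"
    then show "tensor_map R (F i) K' (id \<circ> id) (g' \<circ> g) (pure_tensor R (F i) N y z)
        = tensor_map R (F i) K' id g'' (pure_tensor R (F i) N y z)"
      using assms(7) tensor_map_pure[OF Fm assms(1) Fm assms(3) id_mod_hom c, of y z]
        tensor_map_pure[OF Fm assms(1) Fm assms(3) id_mod_hom assms(6), of y z] by simp
  qed
  finally show ?thesis .
qed

text \<open>Tensoring with the ring changes nothing: a chain has the form
  \<open>x \<otimes> 1\<close>, and if it is a cycle then \<open>d 0\<close> kills \<open>x\<close>,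
  so exactness of the resolution makes \<open>x\<close>, and with it the chain, a boundary.\<close>

lemma tor_reg_module:
  assumes "Z \<in> carrier (tor1 (reg_module R))"
  shows "Z = \<zero>\<^bsub>tor1 (reg_module R)\<^esub>"
proof -
  note reg = L.reg_module_is_module
  interpret F0: module R "F 0" by (rule F_module)
  interpret F1: module R "F (Suc 0)" by (rule F_module)
  interpret T: module_pair R "F (Suc 0)" "reg_module R" by (intro module_pairI F_module reg)
  interpret T0: module_pair R "F 0" "reg_module R" by (intro module_pairI F_module reg)
  interpret T2: module_pair R "F (Suc (Suc 0))" "reg_module R" by (intro module_pairI F_module reg)
  obtain z where z: "z \<in> Cyc (reg_module R)" "Z = cls (reg_module R) z"
    using assms unfolding tor_carrier[OF reg] by blast
  have zc: "z \<in> carrier (FT1 (reg_module R))"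
    and zz: "dN (reg_module R) 0 z = \<zero>\<^bsub>FT0 (reg_module R)\<^esub>"
    using z(1) by (simp_all only: Cyc_iff[OF reg])
  have "\<exists>x\<in>carrier (F (Suc 0)). z = T.ten x \<one>"
    using zc
  proof (induction rule: T.tensor_induct)
    case zero
    show ?case
      by (rule bexI[of _ "\<zero>\<^bsub>F (Suc 0)\<^esub>"]) (simp_all add: T.ten_zero_left)
  next
    case (add z z')
    then obtain x x' where "x \<in> carrier (F (Suc 0))" "z = T.ten x \<one>"
      "x' \<in> carrier (F (Suc 0))" "z' = T.ten x' \<one>" by blast
    then show ?case
      by (intro bexI[of _ "x \<oplus>\<^bsub>F (Suc 0)\<^esub> x'"]) (simp_all add: T.ten_add_left)
  next
    case (ten x r)
    then show ?case
      using T.ten_smult_swap[of r x \<one>] by (intro bexI[of _ "r \<odot>\<^bsub>F (Suc 0)\<^esub> x"]) simp_all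
  qed
  then obtain x where x: "x \<in> carrier (F (Suc 0))" "z = T.ten x \<one>" by blast
  \<comment> \<open>\<open>ev\<close> recovers \<open>d 0 x\<close> from the tensor
    \<open>d 0 x \<otimes> 1\<close>, so that vanishing of the tensor forces vanishing of
    \<open>d 0 x\<close>.\<close>
  obtain ev where ev: "ev \<in> mod_hom R (FT0 (reg_module R)) (F 0)"
    "\<And>x r. x \<in> carrier (F 0) \<Longrightarrow> r \<in> carrier (reg_module R) \<Longrightarrow> ev (T0.ten x r) = r \<odot>\<^bsub>F 0\<^esub> x"
  proof (rule T0.tensor_lift[OF F_module[of 0], of "\<lambda>x r. r \<odot>\<^bsub>F 0\<^esub> x"])
    fix r x y assume "r \<in> carrier R" "x \<in> carrier (F 0)" "y \<in> carrier (reg_module R)"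
    then show "y \<odot>\<^bsub>F 0\<^esub> (r \<odot>\<^bsub>F 0\<^esub> x) = r \<odot>\<^bsub>F 0\<^esub> (y \<odot>\<^bsub>F 0\<^esub> x)"
      using L.m_comm by (simp flip: F0.smult_assoc1)
  qed (simp_all add: F0.smult_l_distr F0.smult_r_distr F0.smult_assoc1)
  have dx: "d 0 x \<in> carrier (F 0)" by (rule mod_hom_closed[OF d_hom x(1)])
  have "d 0 x = ev (T0.ten (d 0 x) \<one>)"
    using dx by (simp add: ev(2))
  also have "\<dots> = ev (dN (reg_module R) 0 z)"
    using x by (simp add: tensor_map_pure[OF F_module reg F_module reg d_hom id_mod_hom])
  also have "\<dots> = \<zero>\<^bsub>F 0\<^esub>"
    unfolding zz by (rule mod_hom_zero[OF T0.tensor_is_module F_module ev(1)])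
  finally have "x \<in> mod_ker (F (Suc 0)) (F 0) (d 0)" using x by (simp add: mod_ker_def)
  then obtain y where y: "y \<in> carrier (F (Suc (Suc 0)))" "x = d (Suc 0) y"
    using exact_Suc[of 0] unfolding mod_exact_def by blast
  have "z = dN (reg_module R) (Suc 0) (T2.ten y \<one>)"
    using x y by (simp add: tensor_map_pure[OF F_module reg F_module reg d_hom id_mod_hom])
  then have "z \<in> Bd (reg_module R)"
    using BdI[OF reg T2.ten_closed[OF y(1), of \<one>]] by simp
  then show ?thesis
    using z(2) quotient_module.coset_zero_iff[OF Bd_quotient[OF reg] zc] tor_zero[OF reg] by simp
qed

end

text \<open>The vertical maps carry lifting data for a representative of \<open>Z\<close> to lifting
  data for its image, so both sides are computed from one and the same lift.\<close>

lemma tor_connecting_natural: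
  assumes "tor_sequence R L F d \<epsilon> A B C \<iota> \<pi>" "tor_sequence R L F d \<epsilon> A' B' C' \<iota>' \<pi>'"
    and \<alpha>: "\<alpha> \<in> mod_hom R A A'" and \<beta>: "\<beta> \<in> mod_hom R B B'" and \<gamma>: "\<gamma> \<in> mod_hom R C C'"
    and sq1: "\<And>x. x \<in> carrier A \<Longrightarrow> \<iota>' (\<alpha> x) = \<beta> (\<iota> x)"
    and sq2: "\<And>x. x \<in> carrier B \<Longrightarrow> \<pi>' (\<beta> x) = \<gamma> (\<pi> x)"
    and Z: "Z \<in> carrier (tor R F d C (Suc 0))"
  shows "tor_connecting R L F d \<epsilon> A' \<iota>' B' \<pi>' C' (tor_map R F d C' \<gamma> (Suc 0) Z)
    = tensor_map R L A' id \<alpha> (tor_connecting R L F d \<epsilon> A \<iota> B \<pi> C Z)"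
proof -
  interpret S: tor_sequence R L F d \<epsilon> A B C \<iota> \<pi> by fact
  interpret S': tor_sequence R L F d \<epsilon> A' B' C' \<iota>' \<pi>' by fact
  note comp = S.id_tensor_comp
  obtain b a z where Zz: "Z = S.Bd C +>\<^bsub>tensor R (F (Suc 0)) C\<^esub> z" "S.lift_of b a z"
    using S.tor_class_lift[OF Z] .
  note b = Zz(2)[unfolded S.lift_of_def]
  let ?b = "tensor_map R (F (Suc 0)) B' id \<beta> b" and ?a = "tensor_map R (F 0) A' id \<alpha> a"
    and ?z = "tensor_map R (F (Suc 0)) C' id \<gamma> z"
  have m1: "(\<lambda>x. \<gamma> (\<pi> x)) \<in> mod_hom R B C'" by (rule mod_hom_comp[OF S.\<pi> \<gamma>])
  have m2: "(\<lambda>x. \<beta> (\<iota> x)) \<in> mod_hom R A B'" by (rule mod_hom_comp[OF S.\<iota> \<beta>])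
  have 1: "S'.pN (Suc 0) ?b = ?z"
    using comp[OF S.B S'.B S'.C \<beta> S'.\<pi> m1 sq2, of b "Suc 0"] comp[OF S.B S.C S'.C S.\<pi> \<gamma> m1 refl, of b "Suc 0"] b by simp
  have "S'.iN 0 ?a = tensor_map R (F 0) B' id \<beta> (S.iN 0 a)"
    using comp[OF S.A S'.A S'.B \<alpha> S'.\<iota> m2 sq1, of a 0] comp[OF S.A S.B S'.B S.\<iota> \<beta> m2 refl, of a 0] b by simp
  also have "\<dots> = S.dN B' 0 ?b"
    using S.dN_natural[OF S.B S'.B \<beta>, of b 0] b by simp
  finally have 2: "S'.iN 0 ?a = S.dN B' 0 ?b" .
  have lift: "S'.lift_of ?b ?a ?z"
    unfolding S'.lift_of_def
    using 1 2 b mod_hom_closed[OF S.id_tensor_hom(1)[OF S.B S'.B \<beta>]] mod_hom_closed[OF S.id_tensor_hom(1)[OF S.A S'.A \<alpha>]]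
    by blast
  have zc: "z \<in> carrier (tensor R (F (Suc 0)) C)" using S.Cyc_closed[OF S.C S.lift_cycle[OF Zz(2)]] .
  show ?thesis
    unfolding Zz(1) S.tor_map_cls[OF S.C S'.C \<gamma> zc] S'.conn_eq[OF lift] S.conn_eq[OF Zz(2)]
    using S.eN_natural[OF S.A S'.A \<alpha>, of a] b by simp
qed

text \<open>With the next lemma this replaces the isomorphism of \<open>R/U \<otimes> N\<close> with
  \<open>N/UN\<close>. A class in \<open>R/U\<close> acts on the values of \<open>g\<close> through
  a chosen representative \<open>s\<close>, and the choice is immaterial because \<open>U\<close>
  annihilates these values.\<close>

lemma (in cring) cyclic_tensor_lift:
  assumes U: "ideal U R" and N: "module R N" and L: "module R L" and g: "g \<in> mod_hom R N L"
    and zero: "\<And>u n. u \<in> U \<Longrightarrow> n \<in> carrier N \<Longrightarrow> u \<odot>\<^bsub>L\<^esub> g n = \<zero>\<^bsub>L\<^esub>"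
  obtains \<tau> where "\<tau> \<in> mod_hom R (tensor R (cyclic_module R U) N) L"
    and "\<And>n. n \<in> carrier N \<Longrightarrow> \<tau> (pure_tensor R (cyclic_module R U) N (U +> \<one>) n) = g n"
proof -
  let ?C = "cyclic_module R U"
  interpret N: module R N by fact
  interpret L: module R L by fact
  interpret T: module_pair R ?C N
    by (intro module_pairI cyclic_is_module U N)
  interpret U: ideal U R by fact
  define s where "s Z = (SOME r. r \<in> Z)" for Z :: "'a set"
  have s: "s (U +> r) \<odot>\<^bsub>L\<^esub> g n = r \<odot>\<^bsub>L\<^esub> g n" if r: "r \<in> carrier R" "n \<in> carrier N" for r n
  proof -
    have "s (U +> r) \<in> U +> r"
      unfolding s_def by (rule someI, rule ideal_coset_self[OF U r(1)])
    then have *: "s (U +> r) \<in> carrier R" "s (U +> r) \<ominus> r \<in> U"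
      using ideal_coset_memD[OF U r(1)] by blast+
    have gn: "g n \<in> carrier L" by (rule mod_hom_closed[OF g r(2)])
    have "s (U +> r) \<odot>\<^bsub>L\<^esub> g n \<ominus>\<^bsub>L\<^esub> r \<odot>\<^bsub>L\<^esub> g n = (s (U +> r) \<ominus> r) \<odot>\<^bsub>L\<^esub> g n"
      using *(1) r gn by (simp add: a_minus_def L.smult_l_distr L.smult_l_minus)
    also have "\<dots> = \<zero>\<^bsub>L\<^esub>" by (rule zero[OF *(2) r(2)])
    finally show ?thesis using L.eq_iff_minus *(1) r gn by simp
  qed
  have carr: "\<exists>r\<in>carrier R. x = U +> r" if "x \<in> carrier (?C)" for x
    using that unfolding ideal_quot_simps(1) by blast
  have g_closed: "g n \<in> carrier L" if "n \<in> carrier N" for n by (rule mod_hom_closed[OF g that])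
  obtain \<tau> where \<tau>: "\<tau> \<in> mod_hom R (tensor R (?C) N) L"
    "\<And>x n. x \<in> carrier (?C) \<Longrightarrow> n \<in> carrier N \<Longrightarrow>
      \<tau> (T.ten x n) = s x \<odot>\<^bsub>L\<^esub> g n"
  proof (rule T.tensor_lift[OF L, of "\<lambda>x n. s x \<odot>\<^bsub>L\<^esub> g n"])
    fix x n assume x: "x \<in> carrier (?C)" and n: "n \<in> carrier N"
    obtain r where r: "r \<in> carrier R" "x = U +> r" using carr[OF x] by blast
    show "s x \<odot>\<^bsub>L\<^esub> g n \<in> carrier L"
      using r n by (simp add: s g_closed)
  next
    fix x x' n assume x: "x \<in> carrier (?C)" "x' \<in> carrier (?C)" and n: "n \<in> carrier N"
    obtain r r' where r: "r \<in> carrier R" "x = U +> r" "r' \<in> carrier R" "x' = U +> r'"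
      using carr[OF x(1)] carr[OF x(2)] by blast
    show "s (x \<oplus>\<^bsub>?C\<^esub> x') \<odot>\<^bsub>L\<^esub> g n = s x \<odot>\<^bsub>L\<^esub> g n \<oplus>\<^bsub>L\<^esub> s x' \<odot>\<^bsub>L\<^esub> g n"
      using r n by (simp add: s ideal_coset_add[OF U] L.smult_l_distr g_closed)
  next
    fix x n n' assume x: "x \<in> carrier (?C)" and n: "n \<in> carrier N" "n' \<in> carrier N"
    obtain r where r: "r \<in> carrier R" "x = U +> r" using carr[OF x] by blast
    show "s x \<odot>\<^bsub>L\<^esub> g (n \<oplus>\<^bsub>N\<^esub> n') = s x \<odot>\<^bsub>L\<^esub> g n \<oplus>\<^bsub>L\<^esub> s x \<odot>\<^bsub>L\<^esub> g n'"
      using s[OF r(1) N.a_closed[OF n]] s[OF r(1) n(1)] s[OF r(1) n(2)] r n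
      by (simp add: mod_hom_add[OF g] L.smult_r_distr g_closed)
  next
    fix q x n assume q: "q \<in> carrier R" and x: "x \<in> carrier (?C)" and n: "n \<in> carrier N"
    obtain r where r: "r \<in> carrier R" "x = U +> r" using carr[OF x] by blast
    show "s (q \<odot>\<^bsub>?C\<^esub> x) \<odot>\<^bsub>L\<^esub> g n = q \<odot>\<^bsub>L\<^esub> (s x \<odot>\<^bsub>L\<^esub> g n)"
      using r n q by (simp add: s ideal_coset_smult[OF U] L.smult_assoc1 g_closed)
    have "r \<odot>\<^bsub>L\<^esub> (q \<odot>\<^bsub>L\<^esub> g n) = q \<odot>\<^bsub>L\<^esub> (r \<odot>\<^bsub>L\<^esub> g n)"
      using L.smult_assoc1[of r q "g n"] L.smult_assoc1[of q r "g n"] m_comm[of r q] q r n g_closed by simp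
    then show "s x \<odot>\<^bsub>L\<^esub> g (q \<odot>\<^bsub>N\<^esub> n) = q \<odot>\<^bsub>L\<^esub> (s x \<odot>\<^bsub>L\<^esub> g n)"
      using s[OF r(1) N.smult_closed[OF q n]] s[OF r(1) n] r n q by (simp add: mod_hom_smult[OF g])
  qed blast
  show thesis
  proof (rule that[OF \<tau>(1)])
    fix n assume n: "n \<in> carrier N"
    have "U +> \<one> \<in> carrier (?C)" unfolding ideal_quot_simps(1) by blast
    then show "\<tau> (T.ten (U +> \<one>) n) = g n"
      using \<tau>(2)[of "U +> \<one>" n] n s[of \<one> n] mod_hom_closed[OF g n] by simp
  qed
qed

text \<open>The class of \<open>r\<close> is \<open>r\<close> times the class of one, and
  \<open>r\<close> can be moved into the right factor. Sums then collapse to a single tensor whose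
  left factor is the class of one.\<close>

lemma (in cring) cyclic_tensor_pure:
  assumes U: "ideal U R" and N: "module R N" and z: "z \<in> carrier (tensor R (cyclic_module R U) N)"
  obtains n where "n \<in> carrier N" "z = pure_tensor R (cyclic_module R U) N (U +> \<one>) n"
proof -
  let ?C = "cyclic_module R U"
  interpret N: module R N by fact
  interpret T: module_pair R ?C N
    by (intro module_pairI cyclic_is_module U N)
  have one: "U +> \<one> \<in> carrier (?C)" unfolding ideal_quot_simps(1) by blast
  have "\<exists>n\<in>carrier N. z = T.ten (U +> \<one>) n"
    using z
  proof (induction rule: T.tensor_induct)
    case zero
    show ?case by (rule bexI[of _ "\<zero>\<^bsub>N\<^esub>"]) (simp_all add: T.ten_zero_right[OF one])
  next
    case (add z z')
    then obtain n n' where "n \<in> carrier N" "z = T.ten (U +> \<one>) n"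
      "n' \<in> carrier N" "z' = T.ten (U +> \<one>) n'" by blast
    then show ?case
      by (intro bexI[of _ "n \<oplus>\<^bsub>N\<^esub> n'"]) (simp_all add: T.ten_add_right[OF one])
  next
    case (ten x n)
    then obtain r where r: "r \<in> carrier R" "x = U +> r" unfolding ideal_quot_simps(1) by blast
    have "x = r \<odot>\<^bsub>?C\<^esub> (U +> \<one>)" using r by (simp add: ideal_coset_smult[OF U])
    then show ?case
      using T.ten_smult_swap[OF r(1) one ten(2)] r ten by (intro bexI[of _ "r \<odot>\<^bsub>N\<^esub> n"]) simp_all
  qed
  then show thesis using that by blast
qed

text \<open>For (1) this is needed with \<open>J\<close> the ideal \<open>M\<close> and, to describe
  the kernel, with \<open>J\<close> the ideal \<open>P\<close>.\<close>

lemma ideal_tor_sequence: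
  fixes R (structure) and F :: "nat \<Rightarrow> ('a, 'f) module"
  assumes "resolved_module R L F d \<epsilon>" "ideal J R"
  shows "tor_sequence R L F d \<epsilon> (ideal_module R J) (reg_module R) (cyclic_module R J) id (\<lambda>r. J +> r)"
proof -
  interpret resolved_module R L F d \<epsilon> by fact
  show ?thesis
  proof (intro tor_sequence.intro tor_sequence_axioms.intro assms(1))
    show "id \<in> mod_hom R (ideal_module R J) (reg_module R)"
      by (rule mod_homI) (use L.ideal_subset[OF assms(2)] in \<open>simp_all add: subset_iff\<close>)
    show "(\<lambda>r. J +> r) ` carrier (reg_module R) = carrier (cyclic_module R J)"
      by (simp add: ideal_quot_simps)
    show "id ` carrier (ideal_module R J) = mod_ker (reg_module R) (cyclic_module R J) (\<lambda>r. J +> r)"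
      using L.ideal_subset[OF assms(2)] L.ideal_coset_zero_iff[OF assms(2)]
      by (auto simp: mod_ker_def ideal_quot_simps)
  qed (intro L.ideal_module_is_module L.reg_module_is_module L.cyclic_is_module L.coset_hom assms(2) inj_on_id)+
qed

lemma (in cring) coset_map_id:
  assumes "ideal I R" "ideal I' R" "I \<subseteq> I'" "x \<in> carrier R"
  shows "coset_map R I' id (I +> x) = I' +> x"
  using coset_map_coset[OF assms(1,2) id_mod_hom, of x] assms(3,4) by simp

lemma (in cring) coset_map_id_hom:
  assumes "ideal I R" "ideal J R" "I \<subseteq> J" "ideal I' R" "ideal J' R" "I' \<subseteq> J'" "I \<subseteq> I'" "J \<subseteq> J'"
  shows "coset_map R I' id \<in> mod_hom R (ideal_quot R J I) (ideal_quot R J' I')"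
  by (rule coset_map_hom[OF assms(1-6) id_mod_hom]) (use assms(7,8) in simp_all)

text \<open>The first map can be \<open>id\<close> because an element of \<open>J/I\<close> is a
  coset of \<open>I\<close> and hence already an element of \<open>R/I\<close>.\<close>

lemma quot_tor_sequence:
  fixes R (structure) and F :: "nat \<Rightarrow> ('a, 'f) module"
  assumes "resolved_module R L F d \<epsilon>" "ideal I R" "ideal J R" "I \<subseteq> J"
  shows "tor_sequence R L F d \<epsilon> (ideal_quot R J I) (cyclic_module R I) (cyclic_module R J) id (coset_map R J id)"
proof -
  interpret resolved_module R L F d \<epsilon> by fact
  note sub = L.ideal_subset[OF assms(2)] L.ideal_subset[OF assms(3)]
  note cm = L.coset_map_id[OF assms(2-4)]
  show ?thesis
  proof (intro tor_sequence.intro tor_sequence_axioms.intro assms(1))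
    show "id \<in> mod_hom R (ideal_quot R J I) (cyclic_module R I)"
      by (rule mod_homI) (use sub(2) in \<open>auto simp: ideal_quot_simps\<close>)
    show "coset_map R J id \<in> mod_hom R (cyclic_module R I) (cyclic_module R J)"
      by (rule L.coset_map_id_hom) (use assms sub L.oneideal in simp_all)
    show "coset_map R J id ` carrier (cyclic_module R I) = carrier (cyclic_module R J)"
      unfolding ideal_quot_simps image_image by (rule image_cong[OF refl cm])
    show "id ` carrier (ideal_quot R J I) = mod_ker (cyclic_module R I) (cyclic_module R J) (coset_map R J id)"
    proof (intro subset_antisym subsetI)
      fix x assume "x \<in> id ` carrier (ideal_quot R J I)"
      then obtain r where "r \<in> J" "r \<in> carrier R" "x = I +> r" using sub(2) by (auto simp: ideal_quot_simps)
      then show "x \<in> mod_ker (cyclic_module R I) (cyclic_module R J) (coset_map R J id)"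
        using L.ideal_coset_zero_iff[OF assms(3)] by (simp add: mod_ker_def ideal_quot_simps cm)
    next
      fix x assume "x \<in> mod_ker (cyclic_module R I) (cyclic_module R J) (coset_map R J id)"
      then obtain r where "r \<in> carrier R" "x = I +> r" "coset_map R J id x = J"
        by (auto simp: ideal_quot_simps mod_ker_def)
      then show "x \<in> id ` carrier (ideal_quot R J I)"
        using L.ideal_coset_zero_iff[OF assms(3)] by (simp add: ideal_quot_simps cm)
    qed
  qed (intro L.ideal_quot_is_module L.cyclic_is_module assms inj_on_id)+
qed

lemma (in cring) colon_ideal:
  assumes "ideal I R" "e \<in> carrier R"
  shows "ideal (colon R I e) R"
proof -
  interpret I: ideal I R by fact
  interpret M: module R "reg_module R" by (rule reg_module_is_module)
  have "submodule (colon R I e) R (reg_module R)"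
    by (rule M.submodule_intro)
      (use assms(2) in \<open>auto simp: colon_def l_distr m_assoc I.I_l_closed\<close>)
  then have "subgroup (colon R I e) (add_monoid R)"
    unfolding submodule_def by (simp add: subgroup_def m_inv_def)
  then show ?thesis
  proof (rule idealI[OF ring_axioms])
    fix a x assume ax: "a \<in> colon R I e" "x \<in> carrier R"
    then have "a \<in> carrier R" "x \<otimes> (a \<otimes> e) \<in> I"
      by (simp_all add: colon_def I.I_l_closed)
    then show "x \<otimes> a \<in> colon R I e" "a \<otimes> x \<in> colon R I e"
      using ax(2) assms(2) by (simp_all add: colon_def m_assoc m_comm[of a x])
  qed
qed

section \<open>The two sequences\<close>

locale ideal_family = cring R for R (structure) +
  fixes U M P e
  assumes U: "ideal U R" and M: "ideal M R" and P: "ideal P R" and PM: "P \<subseteq> M" and eM: "e \<in> M"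
begin

definition "Q = (U \<cdot> M) <+>\<^bsub>R\<^esub> P"
definition "S = U <+>\<^bsub>R\<^esub> P"
text \<open>The numerator of \<open>T_module\<close>. Because of \<open>P \<subseteq> M\<close> it
  consists of the elements of \<open>S\<close> that lie in \<open>M\<close>.\<close>

definition "W = (U \<inter> M) <+>\<^bsub>R\<^esub> P"
definition "E = Idl {e}"

lemma e_carrier: "e \<in> carrier R"
  using eM ideal_subset[OF M] by blast

lemma Q_ideal: "ideal Q R"
  unfolding Q_def by (intro add_ideals ideal_prod_is_ideal U M P)

lemma S_ideal: "ideal S R"
  unfolding S_def by (intro add_ideals U P)

lemma W_ideal: "ideal W R"
  unfolding W_def by (intro add_ideals i_intersect U M P)

lemma E_ideal: "ideal E R"
  unfolding E_def by (rule genideal_ideal) (simp add: e_carrier)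

lemma sum_iff: "x \<in> I <+>\<^bsub>R\<^esub> J \<longleftrightarrow> (\<exists>a\<in>I. \<exists>b\<in>J. x = a \<oplus> b)"
  by (auto simp: set_add_def')

lemma sum_mono: "I \<subseteq> I' \<Longrightarrow> I <+>\<^bsub>R\<^esub> J \<subseteq> I' <+>\<^bsub>R\<^esub> J"
  by (rule subsetI) (unfold sum_iff, blast)

lemma add_minus_cancel_left: "x \<in> carrier R \<Longrightarrow> y \<in> carrier R \<Longrightarrow> x \<oplus> y \<ominus> x = y"
  by (simp add: a_minus_def a_comm[of x y] a_assoc r_neg)

lemma E_iff: "x \<in> E \<longleftrightarrow> (\<exists>r\<in>carrier R. x = r \<otimes> e)"
  unfolding E_def cgenideal_eq_genideal[OF e_carrier, symmetric] cgenideal_def by blast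

lemma summand_subset:
  assumes "ideal I R" "ideal J R"
  shows "I \<subseteq> I <+>\<^bsub>R\<^esub> J" "J \<subseteq> I <+>\<^bsub>R\<^esub> J"
proof -
  interpret I: ideal I R by fact
  interpret J: ideal J R by fact
  show "I \<subseteq> I <+>\<^bsub>R\<^esub> J"
  proof
    fix x assume "x \<in> I"
    then have "x = x \<oplus> \<zero>" by simp
    then show "x \<in> I <+>\<^bsub>R\<^esub> J" unfolding sum_iff using \<open>x \<in> I\<close> J.zero_closed by blast
  qed
  show "J \<subseteq> I <+>\<^bsub>R\<^esub> J"
  proof
    fix x assume "x \<in> J"
    then have "x = \<zero> \<oplus> x" by simp
    then show "x \<in> I <+>\<^bsub>R\<^esub> J" unfolding sum_iff using \<open>x \<in> J\<close> I.zero_closed by blast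
  qed
qed

lemma P_Q: "P \<subseteq> Q"
  unfolding Q_def by (rule summand_subset(2)[OF ideal_prod_is_ideal[OF U M] P])

lemma UM_Q: "U \<cdot> M \<subseteq> Q"
  unfolding Q_def by (rule summand_subset(1)[OF ideal_prod_is_ideal[OF U M] P])

lemma UM_W: "U \<inter> M \<subseteq> W"
  unfolding W_def by (rule summand_subset(1)[OF i_intersect[OF U M] P])

lemma Q_W: "Q \<subseteq> W"
  unfolding Q_def W_def by (rule sum_mono[OF ideal_prod_inter[OF U M]])

lemma W_S: "W \<subseteq> S"
  unfolding S_def W_def by (rule sum_mono) blast

lemma Q_S: "Q \<subseteq> S"
  using Q_W W_S by (rule subset_trans)

text \<open>In \<open>x = u + p\<close> the summand \<open>p\<close> lies in \<open>M\<close> by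
  \<open>P \<subseteq> M\<close>, hence so does \<open>u\<close>.\<close>

lemma modular:
  assumes "x \<in> S" "x \<in> M"
  shows "x \<in> W"
proof -
  interpret M: ideal M R by (rule M)
  obtain u p where up: "u \<in> U" "p \<in> P" "x = u \<oplus> p" using assms(1) unfolding S_def sum_iff by blast
  then have c: "u \<in> carrier R" "p \<in> carrier R" using ideal_subset U P by blast+
  have "u = x \<ominus> p" using up c by (simp add: a_minus_def a_assoc r_neg)
  moreover have "x \<ominus> p \<in> M" unfolding a_minus_def using assms(2) up PM by (intro M.a_closed M.a_inv_closed) blast+
  ultimately have "u \<in> U \<inter> M" using up by simp
  then show ?thesis unfolding W_def sum_iff using up by blast
qed

text \<open>Because of this, \<open>R/\<langle>e\<rangle> \<otimes> S/Q\<close> is \<open>S/Q\<close> itself.\<close>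

lemma E_S_Q:
  assumes "x \<in> E" "s \<in> S"
  shows "x \<otimes> s \<in> Q"
proof -
  interpret P: ideal P R by (rule P)
  interpret M: ideal M R by (rule M)
  obtain r where r: "r \<in> carrier R" "x = r \<otimes> e" using assms(1) unfolding E_iff by blast
  obtain u p where up: "u \<in> U" "p \<in> P" "s = u \<oplus> p" using assms(2) unfolding S_def sum_iff by blast
  then have c: "u \<in> carrier R" "p \<in> carrier R" using ideal_subset U P by blast+
  have xM: "x \<in> M" "x \<in> carrier R" using r eM e_carrier by (simp_all add: M.I_l_closed)
  \<comment> \<open>The first product lies in \<open>UM\<close> because multiples of
    \<open>e\<close> lie in \<open>M\<close>, the second in \<open>P\<close>.\<close>
  have "x \<otimes> s = u \<otimes> x \<oplus> x \<otimes> p" using up c xM by (simp add: r_distr m_comm)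
  moreover have "u \<otimes> x \<in> U \<cdot> M" by (rule ideal_prod.prod[OF up(1) xM(1)])
  moreover have "x \<otimes> p \<in> P" by (rule P.I_l_closed[OF up(2) xM(2)])
  ultimately show ?thesis unfolding Q_def sum_iff by blast
qed

lemma U_M_Q: "u \<in> U \<Longrightarrow> m \<in> M \<Longrightarrow> u \<otimes> m \<in> Q"
  using UM_Q ideal_prod.prod[of u U m M R] by blast

lemma first_sequence:
  assumes "free_resolution R (cyclic_module R U) F d \<epsilon>"
  shows "\<exists>\<theta>.
        mod_exact R (tor R F d (cyclic_module R P) 1)
            (tor_map R F d (cyclic_module R M) (coset_map R M id) 1)
          (tor R F d (cyclic_module R M) 1)
            \<theta>
          (ideal_quot R W Q) \<and>
        \<theta> ` carrier (tor R F d (cyclic_module R M) 1) = carrier (ideal_quot R W Q) \<and>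
        (\<forall>Z \<in> carrier (tor R F d (cyclic_module R M) 1). \<exists>m \<in> U \<inter> M.
           tor_connecting R (cyclic_module R U) F d \<epsilon>
             (ideal_module R M) id (reg_module R) (\<lambda>r. M +> r) (cyclic_module R M) Z
           = pure_tensor R (cyclic_module R U) (ideal_module R M) (U +> \<one>) m \<and>
           \<theta> Z = Q +> m)"
proof -
  let ?L = "cyclic_module R U"
  let ?TM = "tor R F d (cyclic_module R M) (Suc 0)" and ?TP = "tor R F d (cyclic_module R P) (Suc 0)"
  let ?LM = "tensor R ?L (ideal_module R M)" and ?LP = "tensor R ?L (ideal_module R P)"
    and ?LR = "tensor R ?L (reg_module R)" and ?to_R = "tensor_map R ?L (reg_module R) id id"
  have resolved: "resolved_module R ?L F d \<epsilon>"
    by (intro resolved_module.intro resolved_module_axioms.intro cyclic_is_module U assms)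
  interpret S: tor_sequence R ?L F d \<epsilon> "ideal_module R M" "reg_module R" "cyclic_module R M" id "\<lambda>r. M +> r"
    by (rule ideal_tor_sequence[OF resolved M])
  interpret SP: tor_sequence R ?L F d \<epsilon> "ideal_module R P" "reg_module R" "cyclic_module R P" id "\<lambda>r. P +> r"
    by (rule ideal_tor_sequence[OF resolved P])
  interpret U: ideal U R by (rule U)
  interpret M: ideal M R by (rule M)
  interpret P: ideal P R by (rule P)
  interpret Q: ideal Q R by (rule Q_ideal)
  note modM = ideal_module_is_module[OF M] and modP = ideal_module_is_module[OF P]
    and reg = reg_module_is_module and modL = cyclic_is_module[OF U]
  interpret LM: module_pair R ?L "ideal_module R M" by (intro module_pairI modL modM)
  interpret LP: module_pair R ?L "ideal_module R P" by (intro module_pairI modL modP)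
  interpret LR: module_pair R ?L "reg_module R" by (intro module_pairI modL reg)
  let ?t = "pure_tensor R ?L (ideal_module R M) (U +> \<one>)"
  let ?tP = "pure_tensor R ?L (ideal_module R P) (U +> \<one>)"
  let ?tR = "pure_tensor R ?L (reg_module R) (U +> \<one>)"
  have one: "U +> \<one> \<in> carrier ?L" by (simp add: ideal_quot_simps)
  have idM: "id \<in> mod_hom R (ideal_module R M) (reg_module R)"
    and idP: "id \<in> mod_hom R (ideal_module R P) (reg_module R)"
    by (rule S.\<iota>, rule SP.\<iota>)
  have idPM: "id \<in> mod_hom R (ideal_module R P) (ideal_module R M)"
    by (rule mod_homI) (use PM in auto)
  \<comment> \<open>The target is \<open>R/Q\<close> rather than \<open>W/Q\<close>, because
    \<open>\<tau>\<close> is defined on \<open>1 \<otimes> m\<close> for every \<open>m\<close> in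
    \<open>M\<close>. That the values on the image of the connecting map lie in \<open>W/Q\<close>
    is checked afterwards.\<close>
  obtain \<tau> where \<tau>: "\<tau> \<in> mod_hom R (?LM) (cyclic_module R Q)"
    "\<And>m. m \<in> M \<Longrightarrow> \<tau> (?t m) = Q +> m"
  proof (rule cyclic_tensor_lift[OF U modM cyclic_is_module[OF Q_ideal], of "\<lambda>r. Q +> r"])
    show "(\<lambda>r. Q +> r) \<in> mod_hom R (ideal_module R M) (cyclic_module R Q)"
      using mod_hom_comp[OF idM coset_hom[OF Q_ideal]] by simp
    show "u \<odot>\<^bsub>cyclic_module R Q\<^esub> (Q +> n) = \<zero>\<^bsub>cyclic_module R Q\<^esub>"
      if "u \<in> U" "n \<in> carrier (ideal_module R M)" for u n
    proof -
      have "n \<in> M" using that by simp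
      then show ?thesis
        using that(1) U.Icarr[OF that(1)] M.Icarr[of n] ideal_coset_smult[OF Q_ideal, of u n]
          ideal_coset_zero_iff[OF Q_ideal, of "u \<otimes> n"] U_M_Q[of u n]
        by (simp add: ideal_quot_simps(2))
    qed
  qed simp
  \<comment> \<open>\<open>\<rho>\<close> serves to detect when a tensor
    \<open>1 \<otimes> r\<close> in \<open>R/U \<otimes> R\<close> vanishes: its value there is the
    class of \<open>r\<close> modulo \<open>U\<close>.\<close>
  obtain \<rho> where \<rho>: "\<rho> \<in> mod_hom R (?LR) ?L"
    "\<And>r. r \<in> carrier R \<Longrightarrow> \<rho> (?tR r) = U +> r"
  proof (rule cyclic_tensor_lift[OF U reg modL coset_hom[OF U]])
    show "u \<odot>\<^bsub>?L\<^esub> (U +> n) = \<zero>\<^bsub>?L\<^esub>" if "u \<in> U" "n \<in> carrier (reg_module R)" for u n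
      using that U.Icarr[OF that(1)] ideal_coset_smult[OF U, of u n]
        ideal_coset_zero_iff[OF U, of "u \<otimes> n"] U.I_r_closed[of u n]
      by (simp add: ideal_quot_simps(2))
  qed simp
  have tR_zero: "?tR r = \<zero>\<^bsub>?LR\<^esub> \<longleftrightarrow> r \<in> U" if r: "r \<in> carrier R" for r
  proof
    assume "?tR r = \<zero>\<^bsub>?LR\<^esub>"
    then have "U +> r = U"
      using \<rho>(2)[OF r] mod_hom_zero[OF LR.tensor_is_module modL \<rho>(1)] by (simp add: ideal_quot_simps)
    then show "r \<in> U" using ideal_coset_zero_iff[OF U r] by simp
  next
    assume "r \<in> U"
    have "?tR r = pure_tensor R ?L (reg_module R) (r \<odot>\<^bsub>?L\<^esub> (U +> \<one>)) \<one>"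
      using LR.ten_smult_swap[OF r one, of \<one>] r by simp
    also have "r \<odot>\<^bsub>?L\<^esub> (U +> \<one>) = \<zero>\<^bsub>?L\<^esub>"
      using r \<open>r \<in> U\<close> ideal_coset_zero_iff[OF U r] by (simp add: ideal_coset_smult[OF U] ideal_quot_simps(2))
    finally show "?tR r = \<zero>\<^bsub>?LR\<^esub>"
      using LR.ten_zero_left[of \<one>] by simp
  qed
  have to_R: "?to_R (?t m) = ?tR m" if "m \<in> M" for m
    using tensor_map_pure[OF modL modM modL reg id_mod_hom idM one, of m] that by simp
  have to_R_P: "?to_R (?tP m) = ?tR m" if "m \<in> P" for m
    using tensor_map_pure[OF modL modP modL reg id_mod_hom idP one, of m] that by simp
  have to_M: "tensor_map R ?L (ideal_module R M) id id (?tP m) = ?t m" if "m \<in> P" for m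
    using tensor_map_pure[OF modL modP modL modM id_mod_hom idPM one, of m] that by simp
  \<comment> \<open>The image of the connecting map is the kernel of
    \<open>R/U \<otimes> M \<rightarrow> R/U \<otimes> R\<close>, and \<open>1 \<otimes> m\<close>
    dies there precisely when \<open>m\<close> lies in \<open>U\<close>.\<close>
  have image_M: "\<exists>Z\<in>carrier (?TM). S.conn Z = ?t m" if m: "m \<in> U \<inter> M" for m
  proof -
    have "?t m \<in> mod_ker (?LM) (?LR) (?to_R)"
      unfolding mod_ker_def using m to_R[of m] tR_zero[of m] LM.ten_closed[OF one, of m] by simp
    then show ?thesis unfolding S.conn_image[symmetric] by blast
  qed
  have image_P: "\<exists>Z\<in>carrier (?TP). SP.conn Z = ?tP m" if m: "m \<in> U \<inter> P" for m
  proof -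
    have "?tP m \<in> mod_ker (?LP) (?LR) (?to_R)"
      unfolding mod_ker_def using m to_R_P[of m] tR_zero[of m] LP.ten_closed[OF one, of m] by simp
    then show ?thesis unfolding SP.conn_image[symmetric] by blast
  qed
  have conn_M: "\<exists>m\<in>U \<inter> M. S.conn Z = ?t m" if Z: "Z \<in> carrier (?TM)" for Z
  proof -
    have "S.conn Z \<in> mod_ker (?LM) (?LR) (?to_R)"
      unfolding S.conn_image[symmetric] using Z by blast
    then have c: "S.conn Z \<in> carrier (?LM)"
      "?to_R (S.conn Z) = \<zero>\<^bsub>?LR\<^esub>"
      by (simp_all add: mod_ker_def)
    obtain m where m: "m \<in> carrier (ideal_module R M)" "S.conn Z = ?t m"
      using cyclic_tensor_pure[OF U modM c(1)] .
    then have "m \<in> U" using c(2) to_R[of m] tR_zero[of m] by simp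
    then show ?thesis using m by auto
  qed
  have conn_P: "\<exists>m\<in>P. SP.conn Z = ?tP m" if Z: "Z \<in> carrier (?TP)" for Z
    using cyclic_tensor_pure[OF U modP mod_hom_closed[OF SP.conn_hom Z]] by (metis partial_object.select_convs(1) partial_object.surjective partial_object.update_convs(1))
  let ?\<gamma> = "coset_map R M id"
  let ?tm = "tor_map R F d (cyclic_module R M) ?\<gamma> (Suc 0)"
  have \<gamma>: "?\<gamma> \<in> mod_hom R (cyclic_module R P) (cyclic_module R M)"
    by (rule coset_map_id_hom) (use M P PM oneideal ideal_subset in simp_all)
  have tm: "?tm \<in> mod_hom R (?TP) (?TM)"
    by (rule S.tor_map_hom[OF SP.C S.C \<gamma>])
  \<comment> \<open>Naturality for the map of sequences given by the inclusion
    \<open>P \<subseteq> M\<close>, the identity of \<open>R\<close> and the projection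
    \<open>R/P \<rightarrow> R/M\<close>.\<close>
  have nat: "S.conn (?tm Z) = tensor_map R ?L (ideal_module R M) id id (SP.conn Z)"
    if "Z \<in> carrier (?TP)" for Z
    by (rule tor_connecting_natural[OF SP.tor_sequence_axioms S.tor_sequence_axioms idPM id_mod_hom \<gamma> _ _ that])
      (simp_all add: coset_map_id[OF P M PM])
  \<comment> \<open>The difference of two classes with equal images lies in the kernel of the
    connecting map, which is the image of \<open>Tor\<^sub>1(R/U, R)\<close> and hence zero.\<close>
  have inj: "Z = Z'" if Z: "Z \<in> carrier (?TM)"
      "Z' \<in> carrier (?TM)" "S.conn Z = S.conn Z'" for Z Z'
  proof -
    interpret TM: module R ?TM by (rule S.tor_is_module[OF S.C])
    interpret TL: module R "?LM" by (rule LM.tensor_is_module)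
    have "S.conn (Z \<ominus>\<^bsub>?TM\<^esub> Z') = \<zero>\<^bsub>?LM\<^esub>"
      using Z mod_hom_closed[OF S.conn_hom] by (simp add: mod_hom_minus[OF TM.module_axioms TL.module_axioms S.conn_hom] TL.eq_iff_minus)
    then have "Z \<ominus>\<^bsub>?TM\<^esub> Z' \<in> mod_ker ?TM (?LM) S.conn"
      unfolding mod_ker_def using Z by simp
    then obtain Y where Y: "Y \<in> carrier (tor R F d (reg_module R) (Suc 0))"
      "Z \<ominus>\<^bsub>?TM\<^esub> Z' = tor_map R F d (cyclic_module R M) (\<lambda>r. M +> r) (Suc 0) Y"
      unfolding S.conn_kernel by blast
    have "Z \<ominus>\<^bsub>?TM\<^esub> Z' = \<zero>\<^bsub>?TM\<^esub>"
      using Y(2) S.tor_reg_module[OF Y(1)]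
        mod_hom_zero[OF S.tor_is_module[OF reg] TM.module_axioms S.tor_map_hom[OF reg S.C S.\<pi>]] by simp
    then show ?thesis using TM.eq_iff_minus Z by simp
  qed
  define \<theta> where "\<theta> Z = \<tau> (S.conn Z)" for Z
  let ?T = "ideal_quot R W Q"
  have \<theta>_eq: "\<theta> Z = Q +> m" if "S.conn Z = ?t m" "m \<in> M" for Z m
    using that \<tau>(2) by (simp add: \<theta>_def)
  have \<theta>1: "\<theta> \<in> mod_hom R (?TM) (cyclic_module R Q)"
    unfolding \<theta>_def by (rule mod_hom_comp[OF S.conn_hom \<tau>(1)])
  have \<theta>: "\<theta> \<in> mod_hom R (?TM) ?T"
  proof (rule mod_homI)
    fix Z assume Z: "Z \<in> carrier (?TM)"
    obtain m where m: "m \<in> U \<inter> M" "S.conn Z = ?t m" using conn_M[OF Z] by blast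
    then have "\<theta> Z = Q +> m" by (intro \<theta>_eq) simp_all
    then show "\<theta> Z \<in> carrier ?T" unfolding ideal_quot_simps(1) using m UM_W by blast
  qed (use mod_hom_add[OF \<theta>1] mod_hom_smult[OF \<theta>1] in \<open>simp_all add: ideal_quot_simps\<close>)
  have surj: "\<theta> ` carrier (?TM) = carrier ?T"
  proof (intro subset_antisym subsetI)
    fix y assume "y \<in> carrier ?T"
    then obtain x where x: "x \<in> W" "y = Q +> x" unfolding ideal_quot_simps(1) by blast
    then obtain m p where mp: "m \<in> U \<inter> M" "p \<in> P" "x = m \<oplus> p" unfolding W_def sum_iff by blast
    have c: "m \<in> carrier R" "p \<in> carrier R" using mp M.Icarr P.Icarr by simp_all
    \<comment> \<open>The summand from \<open>P\<close> is invisible modulo \<open>Q\<close>, so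
      every class of \<open>W/Q\<close> has a representative in \<open>U \<inter> M\<close>.\<close>
    have "x \<ominus> m = p" using mp(3) add_minus_cancel_left[OF c] by simp
    then have "x \<ominus> m \<in> Q" using mp P_Q by blast
    then have "y = Q +> m" using x c mp ideal_coset_eq_iff[OF Q_ideal, of x m] by simp
    moreover obtain Z where "Z \<in> carrier (?TM)" "S.conn Z = ?t m"
      using image_M[OF mp(1)] by blast
    ultimately show "y \<in> \<theta> ` carrier (?TM)"
      using \<theta>_eq[of Z m] mp(1) by blast
  next
    fix y assume "y \<in> \<theta> ` carrier (?TM)"
    then show "y \<in> carrier ?T" using mod_hom_closed[OF \<theta>] by blast
  qed
  \<comment> \<open>Induction over the elements of the product ideal: in a generator
    \<open>u m\<close> the factor \<open>u\<close> moves to the left, where it annihilates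
    \<open>R/U\<close>.\<close>
  have prod_zero: "?t x = \<zero>\<^bsub>?LM\<^esub>" if "x \<in> U \<cdot> M" for x
    using that
  proof (induction rule: ideal_prod.induct)
    case (prod u m)
    have u: "u \<in> carrier R" using prod U.Icarr by simp
    have "?t (u \<otimes> m) = pure_tensor R ?L (ideal_module R M) (u \<odot>\<^bsub>?L\<^esub> (U +> \<one>)) m"
      using LM.ten_smult_swap[OF u one, of m] prod by simp
    also have "u \<odot>\<^bsub>?L\<^esub> (U +> \<one>) = \<zero>\<^bsub>?L\<^esub>"
      using u prod ideal_coset_zero_iff[OF U u] by (simp add: ideal_coset_smult[OF U] ideal_quot_simps(2))
    finally show ?case using LM.ten_zero_left[of m] prod by simp
  next
    case (sum x y)
    interpret TL: module R "?LM" by (rule LM.tensor_is_module)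
    have "x \<in> M" "y \<in> M" using sum ideal_prod_inter[OF U M] by blast+
    then show ?case using LM.ten_add_right[OF one, of x y] sum by simp
  qed
  have ker: "?tm ` carrier (?TP) = mod_ker (?TM) ?T \<theta>"
  proof (intro subset_antisym subsetI)
    fix Z assume "Z \<in> ?tm ` carrier (?TP)"
    then obtain Y where Y: "Y \<in> carrier (?TP)" "Z = ?tm Y" by blast
    obtain p where p: "p \<in> P" "SP.conn Y = ?tP p" using conn_P[OF Y(1)] by blast
    have "S.conn Z = ?t p" using nat[OF Y(1)] Y(2) p to_M by simp
    then have "\<theta> Z = Q +> p" using p PM by (intro \<theta>_eq) blast+
    then have "\<theta> Z = Q" using p P_Q P.Icarr[OF p(1)] ideal_coset_zero_iff[OF Q_ideal, of p] by blast
    then show "Z \<in> mod_ker (?TM) ?T \<theta>"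
      unfolding mod_ker_def ideal_quot_simps(2) using Y mod_hom_closed[OF tm] by blast
  next
    fix Z assume "Z \<in> mod_ker (?TM) ?T \<theta>"
    then have Z: "Z \<in> carrier (?TM)" "\<theta> Z = Q"
      by (simp_all add: mod_ker_def ideal_quot_simps(2))
    obtain m where m: "m \<in> U \<inter> M" "S.conn Z = ?t m" using conn_M[OF Z(1)] by blast
    have mc: "m \<in> carrier R" using m M.Icarr by simp
    have "Q +> m = Q" using Z(2) \<theta>_eq[OF m(2)] m(1) by simp
    then have "m \<in> Q" using ideal_coset_zero_iff[OF Q_ideal mc] by simp
    then obtain x p where xp: "x \<in> U \<cdot> M" "p \<in> P" "m = x \<oplus> p" unfolding Q_def sum_iff by blast
    have xUM: "x \<in> U" "x \<in> M" using xp ideal_prod_inter[OF U M] by blast+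
    have c: "x \<in> carrier R" "p \<in> carrier R" using xUM U.Icarr xp P.Icarr by simp_all
    \<comment> \<open>The remainder \<open>p\<close> has to lie in \<open>U\<close>, since only then
      is \<open>1 \<otimes> p\<close>, taken in \<open>R/U \<otimes> P\<close>, a value of the
      connecting map.\<close>
    have "p = m \<ominus> x" using xp(3) add_minus_cancel_left[OF c] by simp
    moreover have "m \<ominus> x \<in> U" unfolding a_minus_def using m xUM by (intro U.a_closed U.a_inv_closed) blast+
    ultimately have pU: "p \<in> U \<inter> P" using xp by simp
    have pM: "p \<in> M" using xp PM by blast
    interpret TL: module R "?LM" by (rule LM.tensor_is_module)
    have "?t m = ?t p"
      using LM.ten_add_right[OF one, of x p] prod_zero[OF xp(1)] xp(3) xUM pM LM.ten_closed[OF one, of p] by simp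
    moreover obtain Y where Y: "Y \<in> carrier (?TP)" "SP.conn Y = ?tP p"
      using image_P[OF pU] by blast
    ultimately have "S.conn (?tm Y) = S.conn Z" using nat[OF Y(1)] to_M[of p] xp(2) m(2) by simp
    then have "?tm Y = Z" by (intro inj mod_hom_closed[OF tm Y(1)] Z(1))
    then show "Z \<in> ?tm ` carrier (?TP)" using Y(1) by blast
  qed
  show ?thesis
    unfolding One_nat_def
  proof (intro exI[of _ \<theta>] conjI ballI)
    show "mod_exact R (?TP) ?tm (?TM) \<theta> ?T"
      unfolding mod_exact_def using tm \<theta> ker by blast
    fix Z assume Z: "Z \<in> carrier (?TM)"
    obtain m where m: "m \<in> U \<inter> M" "S.conn Z = ?t m" using conn_M[OF Z] by blast
    then show "\<exists>m\<in>U \<inter> M. S.conn Z = ?t m \<and> \<theta> Z = Q +> m"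
      using \<theta>_eq[OF m(2)] by blast
  qed (rule surj)
qed

end

text \<open>The passage from a five-term sequence to a right-exact one. As \<open>\<delta>\<close>
  and the injection \<open>\<kappa>\<close> have the same image, \<open>\<delta>\<close> is
  \<open>\<kappa>\<close> after a surjection \<open>\<psi>\<close>, and injectivity of
  \<open>\<kappa>\<close> leaves the kernel unchanged.\<close>

lemma mod_exact_through_injection:
  assumes M: "f \<in> mod_hom R M N" and P: "module R P"
    and \<kappa>: "\<kappa> \<in> mod_hom R D P" "inj_on \<kappa> (carrier D)" and D: "module R D" and N: "module R N"
    and im: "\<delta> ` carrier N = \<kappa> ` carrier D" and \<delta>: "mod_exact R M f N \<delta> P"
  obtains \<psi> where "mod_exact R M f N \<psi> D" "\<psi> ` carrier N = carrier D"
    and "\<And>x. x \<in> carrier N \<Longrightarrow> \<kappa> (\<psi> x) = \<delta> x"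
proof -
  interpret D: module R D by fact
  interpret N: module R N by fact
  have hom: "\<delta> \<in> mod_hom R N P" and ex: "f ` carrier M = mod_ker N P \<delta>"
    using \<delta> by (auto simp: mod_exact_def)
  define \<psi> where "\<psi> x = inv_into (carrier D) \<kappa> (\<delta> x)" for x
  have mem: "\<delta> x \<in> \<kappa> ` carrier D" if "x \<in> carrier N" for x
    using im that by blast
  have \<psi>: "\<psi> x \<in> carrier D" "\<kappa> (\<psi> x) = \<delta> x" if "x \<in> carrier N" for x
    unfolding \<psi>_def by (rule inv_into_into[OF mem[OF that]], rule f_inv_into_f[OF mem[OF that]])
  have unique: "\<psi> x = y" if "x \<in> carrier N" "y \<in> carrier D" "\<kappa> y = \<delta> x" for x y
    by (rule inj_onD[OF \<kappa>(2)]) (simp_all add: \<psi> that)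
  have \<psi>_hom: "\<psi> \<in> mod_hom R N D"
    by (rule mod_homI; (rule unique)?)
      (simp_all add: \<psi> mod_hom_add[OF hom] mod_hom_smult[OF hom] mod_hom_add[OF \<kappa>(1)] mod_hom_smult[OF \<kappa>(1)])
  have zero: "\<kappa> \<zero>\<^bsub>D\<^esub> = \<zero>\<^bsub>P\<^esub>" by (rule mod_hom_zero[OF D P \<kappa>(1)])
  have "mod_ker N P \<delta> = mod_ker N D \<psi>"
  proof (intro subset_antisym subsetI)
    fix x assume "x \<in> mod_ker N P \<delta>"
    then have "x \<in> carrier N" "\<kappa> \<zero>\<^bsub>D\<^esub> = \<delta> x" by (simp_all add: mod_ker_def zero)
    then show "x \<in> mod_ker N D \<psi>" using unique[of x "\<zero>\<^bsub>D\<^esub>"] by (simp add: mod_ker_def)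
  next
    fix x assume "x \<in> mod_ker N D \<psi>"
    then show "x \<in> mod_ker N P \<delta>" using \<psi>(2)[of x] by (simp add: mod_ker_def zero)
  qed
  then have "mod_exact R M f N \<psi> D"
    unfolding mod_exact_def using M \<psi>_hom ex by simp
  moreover have "\<psi> ` carrier N = carrier D"
  proof (intro subset_antisym subsetI)
    fix y assume y: "y \<in> carrier D"
    then have "\<kappa> y \<in> \<delta> ` carrier N" using im by blast
    then obtain x where "x \<in> carrier N" "\<kappa> y = \<delta> x" by blast
    then show "y \<in> \<psi> ` carrier N" using unique[OF _ y] by blast
  qed (use \<psi>(1) in blast)
  ultimately show thesis using \<psi>(2) by (rule that)
qed

section \<open>Multiplication by e on the quotient of colon ideals\<close>

context ideal_family
begin

abbreviation "D \<equiv> ideal_quot R (colon R S e) (colon R Q e)"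
abbreviation "mult_e \<equiv> coset_map R Q (\<lambda>r. r \<otimes> e)"

lemma colon_Q: "ideal (colon R Q e) R" and colon_S: "ideal (colon R S e) R"
  using colon_ideal Q_ideal S_ideal e_carrier by simp_all

lemma colon_subset: "colon R Q e \<subseteq> colon R S e"
  using Q_S by (auto simp: colon_def)

lemma D_module: "module R D"
  by (rule ideal_quot_is_module[OF colon_Q colon_S colon_subset])

lemma mult_e_coset: "r \<in> carrier R \<Longrightarrow> mult_e (colon R Q e +> r) = Q +> (r \<otimes> e)"
  by (rule coset_map_coset[OF colon_Q Q_ideal mult_right_hom[OF e_carrier]]) (auto simp: colon_def)

lemma D_carrier: "carrier D = (\<lambda>r. colon R Q e +> r) ` {r \<in> carrier R. r \<otimes> e \<in> S}"
  by (simp add: ideal_quot_simps colon_def)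

lemma mult_e_image: "mult_e ` carrier D = {Q +> (r \<otimes> e) | r. r \<in> carrier R \<and> r \<otimes> e \<in> S}"
  unfolding D_carrier image_image by (auto simp: mult_e_coset)

lemma mult_e_hom: "mult_e \<in> mod_hom R D (ideal_quot R S Q)"
  by (rule coset_map_hom[OF colon_Q colon_S colon_subset Q_ideal S_ideal Q_S mult_right_hom[OF e_carrier]])
    (auto simp: colon_def)

text \<open>\<open>r e\<close> and \<open>s e\<close> agree modulo \<open>Q\<close> exactly when
  \<open>r - s\<close> lies in the colon ideal of \<open>Q\<close> and \<open>e\<close>, which is
  the denominator of \<open>D\<close>.\<close>

lemma mult_e_inj: "inj_on mult_e (carrier D)"
proof (rule inj_onI)
  fix x y assume "x \<in> carrier D" "y \<in> carrier D" and eq: "mult_e x = mult_e y"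
  then obtain r s where rs: "r \<in> carrier R" "x = colon R Q e +> r" "s \<in> carrier R" "y = colon R Q e +> s"
    unfolding D_carrier by blast
  then have "r \<otimes> e \<ominus> s \<otimes> e \<in> Q"
    using eq e_carrier ideal_coset_eq_iff[OF Q_ideal, of "r \<otimes> e" "s \<otimes> e"] by (simp add: mult_e_coset)
  then have "(r \<ominus> s) \<otimes> e \<in> Q"
    using rs e_carrier by (simp add: a_minus_def l_distr l_minus)
  then show "x = y"
    using rs ideal_coset_eq_iff[OF colon_Q, of r s] by (simp add: colon_def)
qed

text \<open>The ideal \<open>J\<close> is arbitrary because the operations of \<open>ideal_quot R J Q\<close> do not depend on it.\<close>

lemma mult_e_iso:
  assumes "mult_e ` carrier D = H"
  shows "mult_e \<in> mod_iso R D ((ideal_quot R J Q)\<lparr>carrier := H\<rparr>)"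
proof -
  have "mult_e \<in> mod_hom R D ((ideal_quot R J Q)\<lparr>carrier := H\<rparr>)"
    by (rule mod_homI)
      (use assms mod_hom_add[OF mult_e_hom] mod_hom_smult[OF mult_e_hom] in \<open>auto simp: ideal_quot_simps\<close>)
  then show ?thesis
    using mult_e_inj assms by (simp add: mod_iso_def bij_betw_def)
qed

section \<open>The end of the five-term sequence\<close>

abbreviation "QE \<equiv> Q <+>\<^bsub>R\<^esub> E"
abbreviation "SE \<equiv> S <+>\<^bsub>R\<^esub> E"

lemma QE_ideal: "ideal QE R" and SE_ideal: "ideal SE R"
  by (intro add_ideals Q_ideal E_ideal, intro add_ideals S_ideal E_ideal)

lemma Q_QE: "Q \<subseteq> QE" and E_QE: "E \<subseteq> QE" and S_SE: "S \<subseteq> SE"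
  using summand_subset Q_ideal S_ideal E_ideal by simp_all

lemma QE_SE: "QE \<subseteq> SE"
  by (rule sum_mono[OF Q_S])

abbreviation "to_QE \<equiv> coset_map R QE id"
abbreviation "to_SE \<equiv> coset_map R SE id"

lemma to_QE_hom: "to_QE \<in> mod_hom R (cyclic_module R Q) (cyclic_module R QE)"
  by (rule coset_map_id_hom[OF Q_ideal oneideal ideal_subset[OF Q_ideal] QE_ideal oneideal ideal_subset[OF QE_ideal] Q_QE subset_refl])

lemma to_QE_hom_S: "to_QE \<in> mod_hom R (ideal_quot R S Q) (cyclic_module R QE)"
  by (rule coset_map_id_hom[OF Q_ideal S_ideal Q_S QE_ideal oneideal ideal_subset[OF QE_ideal] Q_QE ideal_subset[OF S_ideal]])

lemma to_SE_hom: "to_SE \<in> mod_hom R (cyclic_module R QE) (cyclic_module R SE)"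
  by (rule coset_map_id_hom[OF QE_ideal oneideal ideal_subset[OF QE_ideal] SE_ideal oneideal ideal_subset[OF SE_ideal] QE_SE subset_refl])

lemma to_QE_coset: "x \<in> carrier R \<Longrightarrow> to_QE (Q +> x) = QE +> x"
  by (rule coset_map_id[OF Q_ideal QE_ideal Q_QE])

lemma to_SE_coset: "x \<in> carrier R \<Longrightarrow> to_SE (QE +> x) = SE +> x"
  by (rule coset_map_id[OF QE_ideal SE_ideal QE_SE])

abbreviation "mod_QE \<equiv> cyclic_module R QE"
abbreviation "mod_SE \<equiv> cyclic_module R SE"
abbreviation "ker_QE \<equiv> mod_ker (ideal_quot R S Q) mod_QE to_QE"

text \<open>If \<open>x = q + r e\<close> with \<open>q\<close> in \<open>Q\<close>, then
  \<open>r e = x - q\<close> is again in \<open>S\<close> because \<open>Q \<subseteq> S\<close>,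
  and it represents the same class as \<open>x\<close>.\<close>

lemma to_QE_ker_iff:
  assumes "x \<in> S"
  shows "to_QE (Q +> x) = \<zero>\<^bsub>mod_QE\<^esub> \<longleftrightarrow> (\<exists>r\<in>carrier R. r \<otimes> e \<in> S \<and> Q +> x = Q +> (r \<otimes> e))"
proof -
  interpret S: ideal S R by (rule S_ideal)
  interpret Q: ideal Q R by (rule Q_ideal)
  have x: "x \<in> carrier R" by (rule S.Icarr[OF assms])
  have "to_QE (Q +> x) = \<zero>\<^bsub>mod_QE\<^esub> \<longleftrightarrow> x \<in> QE"
    using ideal_coset_zero_iff[OF QE_ideal x] by (simp add: to_QE_coset[OF x] ideal_quot_simps(2))
  also have "\<dots> \<longleftrightarrow> (\<exists>r\<in>carrier R. r \<otimes> e \<in> S \<and> Q +> x = Q +> (r \<otimes> e))"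
  proof
    assume "x \<in> QE"
    then obtain q t where qt: "q \<in> Q" "t \<in> E" "x = q \<oplus> t" unfolding sum_iff by (elim bexE)
    obtain r where r: "r \<in> carrier R" "t = r \<otimes> e" using qt(2) unfolding E_iff by (elim bexE)
    have qr: "q \<in> Q" "r \<in> carrier R" "x = q \<oplus> r \<otimes> e" using qt r by simp_all
    have qc: "q \<in> carrier R" and rc: "r \<otimes> e \<in> carrier R" using qr e_carrier Q.Icarr by simp_all
    have d: "x \<ominus> r \<otimes> e = q"
      using qr(3) qc rc add_minus_cancel_left[OF rc qc] by (simp add: a_comm)
    have "r \<otimes> e = x \<ominus> q" using qr(3) add_minus_cancel_left[OF qc rc] by simp
    moreover have "x \<ominus> q \<in> S"
      unfolding a_minus_def using assms qr(1) Q_S by (intro S.a_closed S.a_inv_closed) blast+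
    ultimately have "r \<otimes> e \<in> S" by simp
    moreover have "Q +> x = Q +> (r \<otimes> e)"
      using ideal_coset_eq_iff[OF Q_ideal x rc] d qr(1) by simp
    ultimately show "\<exists>r\<in>carrier R. r \<otimes> e \<in> S \<and> Q +> x = Q +> (r \<otimes> e)" using qr(2) by blast
  next
    assume "\<exists>r\<in>carrier R. r \<otimes> e \<in> S \<and> Q +> x = Q +> (r \<otimes> e)"
    then obtain r where r: "r \<in> carrier R" "Q +> x = Q +> (r \<otimes> e)" by blast
    have rc: "r \<otimes> e \<in> carrier R" using r e_carrier by simp
    have "x \<ominus> r \<otimes> e \<in> Q" using ideal_coset_eq_iff[OF Q_ideal x rc] r(2) by simp
    moreover have "x = (x \<ominus> r \<otimes> e) \<oplus> r \<otimes> e" using x rc by (simp add: a_minus_def a_assoc l_neg)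
    moreover have "r \<otimes> e \<in> E" unfolding E_iff using r(1) by (intro bexI[of _ r]) simp_all
    ultimately show "x \<in> QE" unfolding sum_iff by (intro bexI)
  qed
  finally show ?thesis .
qed

lemma to_QE_ker: "ker_QE = mult_e ` carrier D"
proof (intro subset_antisym subsetI)
  fix z assume "z \<in> ker_QE"
  then obtain x where "x \<in> S" "z = Q +> x" "to_QE (Q +> x) = \<zero>\<^bsub>mod_QE\<^esub>"
    unfolding mod_ker_def ideal_quot_simps(1) by blast
  then show "z \<in> mult_e ` carrier D"
    unfolding mult_e_image to_QE_ker_iff[OF \<open>x \<in> S\<close>] by blast
next
  fix z assume "z \<in> mult_e ` carrier D"
  then obtain r where "r \<in> carrier R" "r \<otimes> e \<in> S" "z = Q +> (r \<otimes> e)" unfolding mult_e_image by blast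
  then show "z \<in> ker_QE"
    using to_QE_ker_iff[of "r \<otimes> e"] unfolding mod_ker_def ideal_quot_simps(1) by blast
qed

text \<open>An element of \<open>S + E\<close> differs from its part in \<open>S\<close> by an
  element of \<open>E\<close>, which is zero modulo \<open>Q + E\<close>; so the kernel on the right
  is filled by classes from \<open>S\<close>.\<close>

lemma to_QE_image: "to_QE ` carrier (ideal_quot R S Q)
    = mod_ker mod_QE mod_SE to_SE"
proof (intro subset_antisym subsetI)
  fix z assume "z \<in> to_QE ` carrier (ideal_quot R S Q)"
  then obtain x where x: "x \<in> S" "z = to_QE (Q +> x)" unfolding ideal_quot_simps(1) by blast
  have xc: "x \<in> carrier R" using x(1) ideal_subset[OF S_ideal] by blast
  have "z = QE +> x" using x(2) to_QE_coset[OF xc] by simp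
  moreover have "SE +> x = SE"
    using ideal_coset_zero_iff[OF SE_ideal xc] x(1) S_SE by blast
  ultimately show "z \<in> mod_ker mod_QE mod_SE to_SE"
    using xc by (simp add: mod_ker_def ideal_quot_simps(1,2) to_SE_coset)
next
  fix z assume "z \<in> mod_ker mod_QE mod_SE to_SE"
  then obtain x where x: "x \<in> carrier R" "z = QE +> x" "to_SE z = SE"
    unfolding mod_ker_def ideal_quot_simps(1,2) by blast
  have "x \<in> SE" using x to_SE_coset[OF x(1)] ideal_coset_zero_iff[OF SE_ideal x(1)] by simp
  then obtain s t where st: "s \<in> S" "t \<in> E" "x = s \<oplus> t" unfolding sum_iff by blast
  have c: "s \<in> carrier R" "t \<in> carrier R" using st ideal_subset S_ideal E_ideal by blast+
  have "x \<ominus> s = t" using st(3) add_minus_cancel_left[OF c] by simp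
  then have "z = QE +> s"
    using x(2) ideal_coset_eq_iff[OF QE_ideal x(1) c(1)] st(2) E_QE by blast
  then show "z \<in> to_QE ` carrier (ideal_quot R S Q)"
    unfolding ideal_quot_simps(1) using to_QE_coset[OF c(1)] st(1) by blast
qed

lemma to_SE_surj: "to_SE ` carrier mod_QE = carrier mod_SE"
  unfolding ideal_quot_simps(1) image_image by (rule image_cong[OF refl to_SE_coset])

text \<open>Both sides are classes modulo \<open>Q\<close> of multiples of \<open>e\<close>, those
  in \<open>W\<close> on the left and those in \<open>S\<close> on the right. The conditions agree
  since multiples of \<open>e\<close> lie in \<open>M\<close>, where membership in \<open>S\<close>
  implies membership in \<open>W\<close>.\<close>

lemma T_classes: "{Z \<in> carrier (ideal_quot R W Q). \<exists>r\<in>carrier R. r \<otimes> e \<in> Z} = mult_e ` carrier D"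
proof (intro subset_antisym subsetI)
  fix Z assume "Z \<in> {Z \<in> carrier (ideal_quot R W Q). \<exists>r\<in>carrier R. r \<otimes> e \<in> Z}"
  then obtain x r where x: "x \<in> W" "Z = Q +> x" "r \<in> carrier R" "r \<otimes> e \<in> Q +> x"
    unfolding ideal_quot_simps(1) by blast
  interpret W: ideal W R by (rule W_ideal)
  have xc: "x \<in> carrier R" by (rule W.Icarr[OF x(1)])
  have d: "r \<otimes> e \<in> carrier R" "r \<otimes> e \<ominus> x \<in> Q" using ideal_coset_memD[OF Q_ideal xc x(4)] by blast+
  have "r \<otimes> e = (r \<otimes> e \<ominus> x) \<oplus> x" using d(1) xc by (simp add: a_minus_def a_assoc l_neg)
  moreover have "(r \<otimes> e \<ominus> x) \<oplus> x \<in> W" using d(2) Q_W x(1) by (intro W.a_closed) blast+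
  ultimately have "r \<otimes> e \<in> S" using W_S by auto
  moreover have "Z = Q +> (r \<otimes> e)"
    using x(2) ideal_coset_eq_iff[OF Q_ideal d(1) xc] d(2) by simp
  ultimately show "Z \<in> mult_e ` carrier D" unfolding mult_e_image using x(3) by blast
next
  fix Z assume "Z \<in> mult_e ` carrier D"
  then obtain r where r: "r \<in> carrier R" "r \<otimes> e \<in> S" "Z = Q +> (r \<otimes> e)" unfolding mult_e_image by blast
  have "r \<otimes> e \<in> W" by (rule modular[OF r(2) ideal.I_l_closed[OF M eM r(1)]])
  moreover have "r \<otimes> e \<in> Q +> (r \<otimes> e)"
    using ideal_coset_self[OF Q_ideal] r(1) e_carrier by simp
  ultimately show "Z \<in> {Z \<in> carrier (ideal_quot R W Q). \<exists>r\<in>carrier R. r \<otimes> e \<in> Z}"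
    unfolding ideal_quot_simps(1) using r by blast
qed

text \<open>By the preceding equality the set is the image of \<open>mult_e\<close>, which is also
  linear as a map into \<open>W/Q\<close> because \<open>W/Q\<close> and \<open>S/Q\<close> share
  their operations.\<close>

lemma T_classes_submodule:
  "submodule {Z \<in> carrier (ideal_quot R W Q). \<exists>r\<in>carrier R. r \<otimes> e \<in> Z} R (ideal_quot R W Q)"
proof -
  have sub: "mult_e ` carrier D \<subseteq> carrier (ideal_quot R W Q)" unfolding T_classes[symmetric] by blast
  have "mult_e \<in> mod_hom R D (ideal_quot R W Q)"
    by (rule mod_homI)
      (use sub mod_hom_add[OF mult_e_hom] mod_hom_smult[OF mult_e_hom] in \<open>auto simp: ideal_quot_simps(2,3,4)\<close>)
  then show ?thesis
    unfolding T_classes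
    by (rule image_submodule[OF D_module ideal_quot_is_module[OF Q_ideal W_ideal Q_W]])
qed

lemma second_sequence:
  assumes "free_resolution R (cyclic_module R E) F d \<epsilon>"
  shows "\<exists>\<delta> \<psi>.
        mod_exact R (tor R F d (cyclic_module R Q) 1)
            (tor_map R F d (cyclic_module R S) (coset_map R S id) 1)
          (tor R F d (cyclic_module R S) 1) \<delta> (ideal_quot R S Q) \<and>
        mod_exact R (tor R F d (cyclic_module R S) 1) \<delta> (ideal_quot R S Q) to_QE mod_QE \<and>
        mod_exact R (ideal_quot R S Q) to_QE mod_QE to_SE mod_SE \<and>
        to_SE ` carrier mod_QE = carrier mod_SE \<and>
        (\<forall>Z \<in> carrier (tor R F d (cyclic_module R S) 1).
           tor_connecting R (cyclic_module R E) F d \<epsilon>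
             (ideal_quot R S Q) id (cyclic_module R Q) (coset_map R S id) (cyclic_module R S) Z
           = pure_tensor R (cyclic_module R E) (ideal_quot R S Q) (E +> \<one>) (\<delta> Z)) \<and>
        mod_exact R (tor R F d (cyclic_module R Q) 1)
            (tor_map R F d (cyclic_module R S) (coset_map R S id) 1)
          (tor R F d (cyclic_module R S) 1) \<psi> D \<and>
        \<psi> ` carrier (tor R F d (cyclic_module R S) 1) = carrier D \<and>
        (\<forall>Z \<in> carrier (tor R F d (cyclic_module R S) 1). mult_e (\<psi> Z) = \<delta> Z) \<and>
        mult_e \<in> mod_iso R D
          ((ideal_quot R S Q)\<lparr>carrier := \<delta> ` carrier (tor R F d (cyclic_module R S) 1)\<rparr>) \<and>
        mult_e \<in> mod_iso R D
          ((ideal_quot R S Q)\<lparr>carrier := ker_QE\<rparr>)"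
proof -
  let ?L = "cyclic_module R E" and ?A = "ideal_quot R S Q" and ?B = "cyclic_module R Q"
    and ?C = "cyclic_module R S"
  let ?to_B = "tensor_map R ?L ?B id id"
  have resolved: "resolved_module R ?L F d \<epsilon>"
    by (intro resolved_module.intro resolved_module_axioms.intro cyclic_is_module E_ideal assms)
  interpret X: tor_sequence R ?L F d \<epsilon> ?A ?B ?C id "coset_map R S id"
    by (rule quot_tor_sequence[OF resolved Q_ideal S_ideal Q_S])
  note modL = cyclic_is_module[OF E_ideal]
  interpret LA: module_pair R ?L ?A by (intro module_pairI modL X.A)
  interpret LB: module_pair R ?L ?B by (intro module_pairI modL X.B)
  interpret B: module R ?B by (rule X.B)
  let ?t = "pure_tensor R ?L ?A (E +> \<one>)" and ?tB = "pure_tensor R ?L ?B (E +> \<one>)"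
  have one: "E +> \<one> \<in> carrier ?L" by (simp add: ideal_quot_simps)
  interpret E: ideal E R by (rule E_ideal)
  interpret S: ideal S R by (rule S_ideal)
  have e_E: "e \<in> E" unfolding E_iff using e_carrier by (intro bexI[of _ \<one>]) simp_all
  \<comment> \<open>\<open>\<tau>\<close> is the inverse of
    \<open>a \<mapsto> 1 \<otimes> a\<close>; it exists because multiples of \<open>e\<close>
    annihilate \<open>S/Q\<close>.\<close>
  obtain \<tau> where \<tau>: "\<tau> \<in> mod_hom R (tensor R ?L ?A) ?A" "\<And>a. a \<in> carrier ?A \<Longrightarrow> \<tau> (?t a) = a"
  proof (rule cyclic_tensor_lift[OF E_ideal X.A X.A id_mod_hom])
    show "u \<odot>\<^bsub>?A\<^esub> id n = \<zero>\<^bsub>?A\<^esub>" if un: "u \<in> E" "n \<in> carrier ?A" for u n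
    proof -
      obtain s where s: "s \<in> S" "n = Q +> s" using un(2) unfolding ideal_quot_simps(1) by blast
      then show ?thesis
        using E.Icarr[OF un(1)] S.Icarr[OF s(1)] E_S_Q[OF un(1) s(1)]
          ideal_coset_zero_iff[OF Q_ideal, of "u \<otimes> s"]
        by (simp add: ideal_coset_smult[OF Q_ideal] ideal_quot_simps(2))
    qed
  qed simp
  \<comment> \<open>Through \<open>\<rho>\<close>, vanishing of \<open>1 \<otimes> b\<close> in
    \<open>R/E \<otimes> R/Q\<close> forces the class \<open>b\<close> to become zero modulo
    \<open>Q + E\<close>.\<close>
  obtain \<rho> where \<rho>: "\<rho> \<in> mod_hom R (tensor R ?L ?B) mod_QE"
    "\<And>b. b \<in> carrier ?B \<Longrightarrow> \<rho> (?tB b) = to_QE b"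
  proof (rule cyclic_tensor_lift[OF E_ideal X.B cyclic_is_module[OF QE_ideal] to_QE_hom])
    show "u \<odot>\<^bsub>mod_QE\<^esub> to_QE n = \<zero>\<^bsub>mod_QE\<^esub>"
      if un: "u \<in> E" "n \<in> carrier ?B" for u n
    proof -
      obtain s where s: "s \<in> carrier R" "n = Q +> s" using un(2) unfolding ideal_quot_simps(1) by blast
      have "u \<otimes> s \<in> QE" using E.I_r_closed[OF un(1) s(1)] E_QE by blast
      then show ?thesis
        using E.Icarr[OF un(1)] s ideal_coset_zero_iff[OF QE_ideal, of "u \<otimes> s"]
        by (simp add: to_QE_coset ideal_coset_smult[OF QE_ideal] ideal_quot_simps(2))
    qed
  qed simp
  have to_B: "?to_B (?t a) = ?tB a" if "a \<in> carrier ?A" for a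
    using tensor_map_pure[OF modL X.A modL X.B id_mod_hom X.\<iota> one that] by simp
  define \<delta> where "\<delta> Z = \<tau> (X.conn Z)" for Z
  let ?T = "tor R F d ?C (Suc 0)"
  have \<delta>_hom: "\<delta> \<in> mod_hom R ?T ?A"
    unfolding \<delta>_def by (rule mod_hom_comp[OF X.conn_hom \<tau>(1)])
  \<comment> \<open>Every element of \<open>R/E \<otimes> S/Q\<close> is some
    \<open>1 \<otimes> a\<close>, and \<open>\<tau>\<close> returns that \<open>a\<close>; hence
    passing from the connecting map to \<open>\<delta>\<close> loses nothing.\<close>
  have conn: "X.conn Z = ?t (\<delta> Z)" if Z: "Z \<in> carrier ?T" for Z
  proof -
    obtain a where a: "a \<in> carrier ?A" "X.conn Z = ?t a"
      using cyclic_tensor_pure[OF E_ideal X.A mod_hom_closed[OF X.conn_hom Z]] .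
    then show ?thesis using \<tau>(2)[OF a(1)] by (simp add: \<delta>_def)
  qed
  let ?tm = "tor_map R F d ?C (coset_map R S id) (Suc 0)"
  have tm: "?tm \<in> mod_hom R (tor R F d ?B (Suc 0)) ?T"
    by (rule X.tor_map_hom[OF X.B X.C X.\<pi>])
  have t_zero: "?t \<zero>\<^bsub>?A\<^esub> = \<zero>\<^bsub>tensor R ?L ?A\<^esub>" by (rule LA.ten_zero_right[OF one])
  have "mod_ker ?T (tensor R ?L ?A) X.conn = mod_ker ?T ?A \<delta>"
  proof (intro subset_antisym subsetI)
    fix Z assume "Z \<in> mod_ker ?T (tensor R ?L ?A) X.conn"
    then show "Z \<in> mod_ker ?T ?A \<delta>"
      using mod_hom_zero[OF LA.tensor_is_module X.A \<tau>(1)] by (simp add: mod_ker_def \<delta>_def)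
  next
    fix Z assume "Z \<in> mod_ker ?T ?A \<delta>"
    then show "Z \<in> mod_ker ?T (tensor R ?L ?A) X.conn"
      using conn[of Z] t_zero by (simp add: mod_ker_def)
  qed
  then have ex1: "mod_exact R (tor R F d ?B (Suc 0)) ?tm ?T \<delta> ?A"
    unfolding mod_exact_def using tm \<delta>_hom X.conn_kernel by simp
  have image: "\<delta> ` carrier ?T = mult_e ` carrier D"
  proof (intro subset_antisym subsetI)
    fix a assume "a \<in> \<delta> ` carrier ?T"
    then obtain Z where Z: "Z \<in> carrier ?T" "a = \<delta> Z" by blast
    have ac: "a \<in> carrier ?A" using Z mod_hom_closed[OF \<delta>_hom] by simp
    then have aB: "a \<in> carrier ?B" using mod_hom_closed[OF X.\<iota>] by (metis id_apply)
    have "X.conn Z \<in> mod_ker (tensor R ?L ?A) (tensor R ?L ?B) (?to_B)"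
      unfolding X.conn_image[symmetric] using Z by blast
    then have "?tB a = \<zero>\<^bsub>tensor R ?L ?B\<^esub>"
      using conn[OF Z(1)] Z(2) to_B[OF ac] by (simp add: mod_ker_def)
    then have "to_QE a = \<zero>\<^bsub>mod_QE\<^esub>"
      using \<rho>(2)[OF aB] mod_hom_zero[OF LB.tensor_is_module cyclic_is_module[OF QE_ideal] \<rho>(1)] by simp
    then show "a \<in> mult_e ` carrier D"
      unfolding to_QE_ker[symmetric] mod_ker_def using ac by simp
  next
    fix a assume a: "a \<in> mult_e ` carrier D"
    then have ac: "a \<in> carrier ?A" using mod_hom_closed[OF mult_e_hom] by blast
    obtain r where r: "r \<in> carrier R" "a = Q +> (r \<otimes> e)" using a unfolding mult_e_image by blast
    have Qr: "Q +> r \<in> carrier ?B" unfolding ideal_quot_simps(1) using r(1) by blast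
    \<comment> \<open>In \<open>R/Q\<close> the class of \<open>r e\<close> is \<open>e\<close>
      times the class of \<open>r\<close>, and \<open>e\<close> becomes zero when moved to the left
      factor. In \<open>S/Q\<close> this is in general not possible, as \<open>r\<close> need not
      lie in \<open>S\<close>; that is how \<open>1 \<otimes> a\<close> can be nonzero there and
      still lie in the kernel.\<close>
    have "?tB a = ?tB (e \<odot>\<^bsub>?B\<^esub> (Q +> r))"
      using r e_carrier by (simp add: ideal_coset_smult[OF Q_ideal] m_comm)
    also have "\<dots> = pure_tensor R ?L ?B (e \<odot>\<^bsub>?L\<^esub> (E +> \<one>)) (Q +> r)"
      by (rule LB.ten_smult_swap[OF e_carrier one Qr, symmetric])
    also have "e \<odot>\<^bsub>?L\<^esub> (E +> \<one>) = \<zero>\<^bsub>?L\<^esub>"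
      using e_carrier e_E ideal_coset_zero_iff[OF E_ideal e_carrier]
      by (simp add: ideal_coset_smult[OF E_ideal] ideal_quot_simps(2))
    also have "pure_tensor R ?L ?B \<zero>\<^bsub>?L\<^esub> (Q +> r) = \<zero>\<^bsub>tensor R ?L ?B\<^esub>"
      by (rule LB.ten_zero_left[OF Qr])
    finally have "?t a \<in> mod_ker (tensor R ?L ?A) (tensor R ?L ?B) (?to_B)"
      using to_B[OF ac] LA.ten_closed[OF one ac] by (simp add: mod_ker_def)
    then obtain Z where "Z \<in> carrier ?T" "X.conn Z = ?t a" unfolding X.conn_image[symmetric] by blast
    then show "a \<in> \<delta> ` carrier ?T" using \<tau>(2)[OF ac] unfolding \<delta>_def by (metis imageI)
  qed
  obtain \<psi> where \<psi>: "mod_exact R (tor R F d ?B (Suc 0)) ?tm ?T \<psi> D" "\<psi> ` carrier ?T = carrier D"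
    "\<And>Z. Z \<in> carrier ?T \<Longrightarrow> mult_e (\<psi> Z) = \<delta> Z"
    by (rule mod_exact_through_injection[OF tm X.A mult_e_hom mult_e_inj D_module X.tor_is_module[OF X.C] image ex1])
      (rule that, assumption, assumption, simp)
  show ?thesis
    unfolding One_nat_def
  proof (rule exI[of _ \<delta>], rule exI[of _ \<psi>], intro conjI ballI)
    show "mod_exact R ?T \<delta> ?A to_QE mod_QE"
      unfolding mod_exact_def using \<delta>_hom to_QE_hom_S image to_QE_ker by simp
    show "mod_exact R ?A to_QE mod_QE to_SE mod_SE"
      unfolding mod_exact_def using to_QE_hom_S to_SE_hom to_QE_image by simp
    show "mult_e \<in> mod_iso R D (?A\<lparr>carrier := \<delta> ` carrier ?T\<rparr>)"
      by (rule mult_e_iso[OF image[symmetric]])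
    show "mult_e \<in> mod_iso R D (?A\<lparr>carrier := ker_QE\<rparr>)"
      by (rule mult_e_iso[OF to_QE_ker[symmetric]])
  qed (rule ex1 to_SE_surj conn \<psi>; assumption?)+
qed

end

section \<open>Formal power series\<close>

text \<open>The left summand \<open>p\<close> is bounded by \<open>m\<close> componentwise and
  determines \<open>q\<close>. This makes the coefficients of a product of power series finite
  sums.\<close>

lemma finite_antidiagonal: "finite {(p, q). p + q = (m :: nat^'n::finite)}"
proof -
  have "finite {p :: nat^'n. \<forall>j. p $ j \<le> m $ j}"
  proof -
    have "finite (PiE UNIV (\<lambda>j. {..m $ j}))" by (rule finite_PiE) simp_all
    moreover have "vec_nth ` {p :: nat^'n. \<forall>j. p $ j \<le> m $ j} \<subseteq> PiE UNIV (\<lambda>j. {..m $ j})"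
      by (auto simp: PiE_UNIV_domain)
    ultimately have "finite (vec_nth ` {p :: nat^'n. \<forall>j. p $ j \<le> m $ j})" by (rule finite_subset[rotated])
    then show ?thesis by (rule finite_imageD) (simp add: inj_on_def vec_eq_iff)
  qed
  moreover have "{(p, q). p + q = m} \<subseteq> (\<lambda>p. (p, m - p)) ` {p. \<forall>j. p $ j \<le> m $ j}"
    by (auto simp: image_iff)
  ultimately show ?thesis by (meson finite_imageI finite_subset)
qed

lemma mps_ring_simps [simp]:
  "carrier mps_ring = UNIV"
  "f \<oplus>\<^bsub>mps_ring\<^esub> g = (\<lambda>m. f m + g m)"
  "\<zero>\<^bsub>mps_ring\<^esub> = (\<lambda>m. 0)"
  "\<one>\<^bsub>mps_ring\<^esub> = (\<lambda>m. if m = 0 then 1 else 0)"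
  by (simp_all add: mps_ring_def)

lemma mps_mult: "f \<otimes>\<^bsub>mps_ring\<^esub> g = (\<lambda>m. \<Sum>(p, q) | p + q = m. f p * g q)"
  by (simp add: mps_ring_def)

lemma mps_mult_comm: "f \<otimes>\<^bsub>mps_ring\<^esub> g = g \<otimes>\<^bsub>mps_ring\<^esub> (f :: 'n::finite mps)"
proof
  fix m :: "nat^'n"
  have "(\<Sum>(p, q) | p + q = m. f p * g q) = (\<Sum>(p, q) | p + q = m. g p * f q)"
    by (rule sum.reindex_bij_witness[of _ prod.swap prod.swap]) (auto simp: add.commute mult.commute)
  then show "(f \<otimes>\<^bsub>mps_ring\<^esub> g) m = (g \<otimes>\<^bsub>mps_ring\<^esub> f) m" by (simp add: mps_mult)
qed

lemma mps_mult_assoc: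
  fixes f g h :: "'n::finite mps"
  shows "f \<otimes>\<^bsub>mps_ring\<^esub> g \<otimes>\<^bsub>mps_ring\<^esub> h = f \<otimes>\<^bsub>mps_ring\<^esub> (g \<otimes>\<^bsub>mps_ring\<^esub> h)"
proof
  fix m :: "nat^'n"
  have "(f \<otimes>\<^bsub>mps_ring\<^esub> g \<otimes>\<^bsub>mps_ring\<^esub> h) m
      = (\<Sum>x | fst x + snd x = m. \<Sum>y | fst y + snd y = fst x. f (fst y) * g (snd y) * h (snd x))"
    by (simp add: mps_mult case_prod_unfold sum_distrib_right)
  also have "\<dots> = (\<Sum>(x, y) \<in> (SIGMA x:{x. fst x + snd x = m}. {y. fst y + snd y = fst x}). f (fst y) * g (snd y) * h (snd x))"
    using finite_antidiagonal by (subst sum.Sigma) (auto simp: case_prod_unfold)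
  \<comment> \<open>Both sums run over triples with \<open>p + q + r = m\<close>, bracketed as
    \<open>((p + q, r), (p, q))\<close> before and as \<open>((p, q + r), (q, r))\<close>
    after.\<close>
  also have "\<dots> = (\<Sum>(x, y) \<in> (SIGMA x:{x. fst x + snd x = m}. {y. fst y + snd y = snd x}). f (fst x) * (g (fst y) * h (snd y)))"
    by (rule sum.reindex_bij_witness[of _ "\<lambda>(x, y). ((fst x + fst y, snd y), (fst x, fst y))"
          "\<lambda>(x, y). ((fst y, snd y + snd x), (snd y, snd x))"])
      (auto simp: add.assoc mult.assoc)
  also have "\<dots> = (\<Sum>x | fst x + snd x = m. \<Sum>y | fst y + snd y = snd x. f (fst x) * (g (fst y) * h (snd y)))"
    using finite_antidiagonal by (subst sum.Sigma) (auto simp: case_prod_unfold)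
  also have "\<dots> = (f \<otimes>\<^bsub>mps_ring\<^esub> (g \<otimes>\<^bsub>mps_ring\<^esub> h)) m"
    by (simp add: mps_mult case_prod_unfold sum_distrib_left)
  finally show "(f \<otimes>\<^bsub>mps_ring\<^esub> g \<otimes>\<^bsub>mps_ring\<^esub> h) m = (f \<otimes>\<^bsub>mps_ring\<^esub> (g \<otimes>\<^bsub>mps_ring\<^esub> h)) m" .
qed

lemma mps_one_mult: "\<one>\<^bsub>mps_ring\<^esub> \<otimes>\<^bsub>mps_ring\<^esub> f = (f :: 'n::finite mps)"
proof
  fix m :: "nat^'n"
  have "(\<Sum>(p, q) | p + q = m. (if p = 0 then 1 else 0) * f q)
      = (\<Sum>(p, q) \<in> {(0 :: nat^'n, m)}. (if p = 0 then 1 else 0) * f q)"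
    by (rule sum.mono_neutral_right) (auto simp: finite_antidiagonal split: if_splits)
  then show "(\<one>\<^bsub>mps_ring\<^esub> \<otimes>\<^bsub>mps_ring\<^esub> f) m = f m" by (simp add: mps_mult)
qed

lemma mps_cring: "cring (mps_ring :: 'n::finite mps ring)"
proof (rule cringI)
  show "abelian_group (mps_ring :: 'n mps ring)"
  proof (rule abelian_groupI)
    fix f :: "'n mps"
    show "\<exists>g\<in>carrier mps_ring. g \<oplus>\<^bsub>mps_ring\<^esub> f = \<zero>\<^bsub>mps_ring\<^esub>"
      by (rule bexI[of _ "\<lambda>m. - f m"]) simp_all
  qed (simp_all add: ac_simps)
  show "comm_monoid (mps_ring :: 'n mps ring)"
    by (rule comm_monoidI) (simp, simp, rule mps_mult_assoc, rule mps_one_mult, rule mps_mult_comm)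
  fix f g h :: "'n mps"
  show "(f \<oplus>\<^bsub>mps_ring\<^esub> g) \<otimes>\<^bsub>mps_ring\<^esub> h = f \<otimes>\<^bsub>mps_ring\<^esub> h \<oplus>\<^bsub>mps_ring\<^esub> g \<otimes>\<^bsub>mps_ring\<^esub> h"
    by (simp add: mps_mult case_prod_unfold distrib_right sum.distrib)
qed

interpretation mps: cring "mps_ring :: 'n::finite mps ring"
  by (rule mps_cring)

lemma mps_monom_union:
  "B \<inter> C = {} \<Longrightarrow> mps_monom (B \<union> C) = mps_monom B \<otimes>\<^bsub>mps_ring\<^esub> mps_monom C"
  unfolding mps_monom_def by (rule mps.finprod_Un_disjoint) simp_all

text \<open>With \<open>K\<close> the intersection of the family, the monomial of
  \<open>(I \<union> J) - K\<close> is that of \<open>I - K\<close>, a generator of the larger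
  ideal, times that of \<open>J - I - K\<close>; the latter two sets are disjoint.\<close>

lemma complement_subset_family:
  fixes \<N> :: "'n::finite set set"
  shows "complement_ideal A v \<N> \<subseteq> family_ideal \<N>"
  unfolding complement_ideal_def
proof (rule mps.genideal_minimal)
  show ideal: "ideal (family_ideal \<N>) mps_ring"
    unfolding family_ideal_def by (rule mps.genideal_ideal) simp
  show "{mps_monom (I \<union> J - \<Inter>\<N>) | I J. I \<in> \<N> \<and> J \<in> nsupps A v - \<N>} \<subseteq> family_ideal \<N>"
  proof clarify
    fix I J assume "I \<in> \<N>"
    then have "mps_monom (I - \<Inter>\<N>) \<in> family_ideal \<N>"
      unfolding family_ideal_def using mps.genideal_self[of "{mps_monom (I - \<Inter>\<N>) | I. I \<in> \<N>}"] by auto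
    moreover have "I \<union> J - \<Inter>\<N> = (I - \<Inter>\<N>) \<union> (J - I - \<Inter>\<N>)" by blast
    then have "mps_monom (I \<union> J - \<Inter>\<N>) = mps_monom (I - \<Inter>\<N>) \<otimes>\<^bsub>mps_ring\<^esub> mps_monom (J - I - \<Inter>\<N>)"
      using mps_monom_union[of "I - \<Inter>\<N>" "J - I - \<Inter>\<N>"] by auto
    ultimately show "mps_monom (I \<union> J - \<Inter>\<N>) \<in> family_ideal \<N>"
      using ideal.I_r_closed[OF ideal] by simp
  qed
qed

text \<open>\<open>e\<close> is one of the generators of the family ideal, namely the one of the
  support of \<open>v\<close>; this is where membership of that support in the family
  enters.\<close>

lemma ideal_family_mps:
  assumes "nsupp v \<in> \<N>"
  shows "ideal_family mps_ring (linear_ideal A) (family_ideal \<N>) (complement_ideal A v \<N>) (e_monom v \<N>)"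
proof (intro ideal_family.intro ideal_family_axioms.intro mps.cring_axioms complement_subset_family)
  show "e_monom v \<N> \<in> family_ideal \<N>"
    unfolding family_ideal_def e_monom_def
    using assms mps.genideal_self[of "{mps_monom (I - \<Inter>\<N>) | I. I \<in> \<N>}"] by auto
qed (unfold linear_ideal_def family_ideal_def complement_ideal_def, (rule mps.genideal_ideal, simp)+)

text \<open>The clauses on \<open>tor_connecting\<close> express that \<open>\<theta>\<close> and
  \<open>\<delta>\<close> are the natural maps; exactness alone would leave other choices open. The
  two resolutions are arbitrary, so the sequences are obtained for every way of computing Tor from a
  free resolution.\<close>

theorem theorem3p6:
  fixes A :: "int^'n^'d" and \<beta> :: "complex^'d" and w :: "real^'n" and v :: "complex^'n"
    and \<N> :: "'n set set"
    and R :: "('n mps) ring" and U M P Q S E :: "('n mps) set" and e :: "'n mps"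
    and T D :: "('n mps, 'n mps set) module"
    and F :: "nat \<Rightarrow> ('n mps, 'f) module" and d :: "nat \<Rightarrow> 'f \<Rightarrow> 'f"
    and \<epsilon> :: "'f \<Rightarrow> 'n mps set"
    and G :: "nat \<Rightarrow> ('n mps, 'g) module" and d' :: "nat \<Rightarrow> 'g \<Rightarrow> 'g"
    and \<epsilon>' :: "'g \<Rightarrow> 'n mps set"
  assumes "homogeneous A"
    and "generic_direction A \<beta> w"
    and "fake_exponent A \<beta> w v"
    and "negative_support_family A w v \<N>"
    and "R = mps_ring"
    and "U = linear_ideal A"
    and "M = family_ideal \<N>"
    and "P = complement_ideal A v \<N>"
    and "Q = (U \<cdot>\<^bsub>R\<^esub> M) <+>\<^bsub>R\<^esub> P"
    and "S = U <+>\<^bsub>R\<^esub> P"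
    and "e = e_monom v \<N>"
    and "E = Idl\<^bsub>R\<^esub> {e}"
    and "T = T_module A v \<N>"
    and "D = D_module A v \<N>"
    and "free_resolution R (cyclic_module R U) F d \<epsilon>"
    and "free_resolution R (cyclic_module R E) G d' \<epsilon>'"
  shows
    "(\<exists>\<theta>.
        mod_exact R
          (tor R F d (cyclic_module R P) 1)
            (tor_map R F d (cyclic_module R M) (coset_map R M id) 1)
          (tor R F d (cyclic_module R M) 1)
            \<theta>
          T \<and>
        \<theta> ` carrier (tor R F d (cyclic_module R M) 1) = carrier T \<and>
        (\<forall>Z \<in> carrier (tor R F d (cyclic_module R M) 1). \<exists>m \<in> U \<inter> M.
           tor_connecting R (cyclic_module R U) F d \<epsilon>
             (ideal_module R M) id (reg_module R) (\<lambda>r. M +>\<^bsub>R\<^esub> r) (cyclic_module R M) Z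
           = pure_tensor R (cyclic_module R U) (ideal_module R M) (U +>\<^bsub>R\<^esub> \<one>\<^bsub>R\<^esub>) m \<and>
           \<theta> Z = Q +>\<^bsub>R\<^esub> m))
     \<and>
     (\<exists>\<delta> \<psi>.
        mod_exact R
          (tor R G d' (cyclic_module R Q) 1)
            (tor_map R G d' (cyclic_module R S) (coset_map R S id) 1)
          (tor R G d' (cyclic_module R S) 1)
            \<delta>
          (ideal_quot R S Q) \<and>
        mod_exact R
          (tor R G d' (cyclic_module R S) 1)
            \<delta>
          (ideal_quot R S Q)
            (coset_map R (Q <+>\<^bsub>R\<^esub> E) id)
          (cyclic_module R (Q <+>\<^bsub>R\<^esub> E)) \<and>
        mod_exact R
          (ideal_quot R S Q)
            (coset_map R (Q <+>\<^bsub>R\<^esub> E) id)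
          (cyclic_module R (Q <+>\<^bsub>R\<^esub> E))
            (coset_map R (S <+>\<^bsub>R\<^esub> E) id)
          (cyclic_module R (S <+>\<^bsub>R\<^esub> E)) \<and>
        coset_map R (S <+>\<^bsub>R\<^esub> E) id ` carrier (cyclic_module R (Q <+>\<^bsub>R\<^esub> E))
          = carrier (cyclic_module R (S <+>\<^bsub>R\<^esub> E)) \<and>
        (\<forall>Z \<in> carrier (tor R G d' (cyclic_module R S) 1).
           tor_connecting R (cyclic_module R E) G d' \<epsilon>'
             (ideal_quot R S Q) id (cyclic_module R Q) (coset_map R S id) (cyclic_module R S) Z
           = pure_tensor R (cyclic_module R E) (ideal_quot R S Q) (E +>\<^bsub>R\<^esub> \<one>\<^bsub>R\<^esub>) (\<delta> Z)) \<and>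
        mod_exact R
          (tor R G d' (cyclic_module R Q) 1)
            (tor_map R G d' (cyclic_module R S) (coset_map R S id) 1)
          (tor R G d' (cyclic_module R S) 1)
            \<psi>
          D \<and>
        \<psi> ` carrier (tor R G d' (cyclic_module R S) 1) = carrier D \<and>
        (\<forall>Z \<in> carrier (tor R G d' (cyclic_module R S) 1).
           coset_map R Q (\<lambda>r. r \<otimes>\<^bsub>R\<^esub> e) (\<psi> Z) = \<delta> Z) \<and>
        coset_map R Q (\<lambda>r. r \<otimes>\<^bsub>R\<^esub> e) \<in> mod_iso R D
          ((ideal_quot R S Q)\<lparr>carrier := \<delta> ` carrier (tor R G d' (cyclic_module R S) 1)\<rparr>) \<and>
        coset_map R Q (\<lambda>r. r \<otimes>\<^bsub>R\<^esub> e) \<in> mod_iso R D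
          ((ideal_quot R S Q)\<lparr>carrier := mod_ker (ideal_quot R S Q)
              (cyclic_module R (Q <+>\<^bsub>R\<^esub> E)) (coset_map R (Q <+>\<^bsub>R\<^esub> E) id)\<rparr>))
     \<and>
     submodule {Z \<in> carrier T. \<exists>r \<in> carrier R. r \<otimes>\<^bsub>R\<^esub> e \<in> Z} R T \<and>
     coset_map R Q (\<lambda>r. r \<otimes>\<^bsub>R\<^esub> e) \<in> mod_iso R D
       (T\<lparr>carrier := {Z \<in> carrier T. \<exists>r \<in> carrier R. r \<otimes>\<^bsub>R\<^esub> e \<in> Z}\<rparr>)"
proof -
  have "nsupp v \<in> \<N>" using assms(4) by (simp add: negative_support_family_def)
  note family = ideal_family_mps[OF this, of A, folded assms(5-8,11)]
  have Q: "Q = ideal_family.Q R U M P" and S: "S = ideal_family.S R U P" and E: "E = ideal_family.E R e"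
    by (simp_all add: assms(9,10,12) ideal_family.Q_def[OF family] ideal_family.S_def[OF family]
        ideal_family.E_def[OF family])
  have Q': "Q_ideal A v \<N> = Q"
    by (simp add: Q_ideal_def assms(5-9))
  have T: "T = ideal_quot R (ideal_family.W R U M P) Q"
    unfolding assms(13) T_module_def Q' ideal_family.W_def[OF family] by (simp add: assms(5-8))
  have D: "D = ideal_quot R (colon R S e) (colon R Q e)"
    unfolding assms(14) D_module_def Q' by (simp add: assms(5-8,10,11))
  note W = ideal_family.T_classes[OF family]
  show ?thesis
    unfolding T D Q S E
    by (intro conjI ideal_family.first_sequence[OF family] ideal_family.second_sequence[OF family]
        ideal_family.T_classes_submodule[OF family] ideal_family.mult_e_iso[OF family] W[symmetric])
      (use assms(15,16) E in simp_all)
qed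

end
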